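(* There exists a strictly positive numerical constant $h>0$ such that for every random environment satisfying assumptions (i)--(iii) of the context and every $\gamma>2$ there exists $n_0\equiv n_0(\gamma)$ such that for all $n>n_0$ there exists $G_n\subset\Omega_1$, on which the basic valley $\{\tilde M_0',\tilde m_0,\tilde M_0\}$ exists, with $Q[G_n]\ge1-h\left((\log_3 n)(\log_2 n)^{-1}\right)^{1/2}$ and $$\sup_{\alpha\in G_n}\left\{\mathbb P^\alpha_0\left[\bigcup_{m=0}^n\left\{X_m\notin[\tilde M_0',\tilde M_0]\right\}\right]\right\}\le\frac{2\log_2 n}{\sigma^2(\log n)^{\gamma-2}},$$ and moreover $$\sup_{\alpha\in G_n}\left\{\mathbb P^\alpha_0\left[\bigcup_{m=0}^n\left\{X_m\notin\left[-(\sigma^{-1}\log n)^2\log_2 n,\ (\sigma^{-1}\log n)^2\log_2 n\right]\right\}\right]\right\}\le\frac{2\log_2 n}{\sigma^2(\log n)^{\gamma-2}}.$$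
   Context: Environment and walk. Let $\alpha=(\alpha_i)_{i\in\mathbb Z}$ be i.i.d. random variables with values in $(0,1)$ on a probability space $(\Omega_1,\mathcal F_1,Q)$ (the random environment); $\beta_i=1-\alpha_i$, $\epsilon_i=\log\frac{1-\alpha_i}{\alpha_i}$, and $\mathbb E_Q$ is expectation under $Q$. Assumptions: (i) $\mathbb E_Q[\epsilon_0]=0$; (ii) $\sigma^2:=\mathbb E_Q[\epsilon_0^2]>0$ (with $\sigma>0$); (iii) there is $\kappa^+>0$ such that for all $\kappa\in(0,\kappa^+)$, $\mathbb E_Q[e^{\kappa\epsilon_0}]<\infty$ and $\mathbb E_Q[e^{-\kappa\epsilon_0}]<\infty$. For fixed $\alpha$, $\mathbb P^\alpha_x$ is the law of the Markov chain $(X_k)_{k\in\mathbb N}$ on $\mathbb Z$ with $X_0=x$ that jumps from $i$ to $i+1$ with probability $\alpha_i$ and from $i$ to $i-1$ with probability $\beta_i$. For $G\subset\Omega_1$, "$\alpha\in G$" means $\alpha=\alpha(\omega)$ with $\omega\in G$. Conventions. $\log_2 n=\log\log n$, $\log_3 n=\log\log\log n$; $n$ is always large enough for iterated logarithms to be positive. A numerical constant does not depend on the law of the environment, $\gamma$ or $n$; the threshold $n_0$ may also depend on the law of $\epsilon_0$. Potential. $S_0=0$, $S_k=\sum_{i=1}^k\epsilon_i$ for $k\ge1$, $S_k=-\sum_{i=k+1}^{0}\epsilon_i$ for $k\le-1$, extended to $\mathbb R$ by linear interpolation; $S^n_t=S_t/\log n$. Valleys. A triplet $\{\tilde M',\tilde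 m,\tilde M''\}$ with $\tilde M'\le\tilde m\le\tilde M''$ is a valley if $S^n_{\tilde M'}=\max_{\tilde M'\le t\le\tilde m}S^n_t$, $S^n_{\tilde M''}=\max_{\tilde m\le t\le\tilde M''}S^n_t$, $S^n_{\tilde m}=\min_{\tilde M'\le t\le\tilde M''}S^n_t$ (if $\tilde m$ is not unique take the one of smallest absolute value). Its depth is $\min(S^n_{\tilde M'}-S^n_{\tilde m},S^n_{\tilde M''}-S^n_{\tilde m})$. A right refinement of it gives the couple $(\tilde M_1,\tilde m_1)$, $\tilde m\le\tilde M_1<\tilde m_1\le\tilde M''$, with $S^n_{\tilde M_1}-S^n_{\tilde m_1}=\max_{\tilde m\le t'\le t''\le\tilde M''}(S^n_{t'}-S^n_{t''})$ (smallest absolute values if not unique); left refinement is defined symmetrically. For $\gamma>0$ put $\gamma(n)=\gamma\log_2 n/\log n$. A valley contains $0$ and is of depth larger than $1+\gamma(n)$ if: (1) $0\in[\tilde M',\tilde M'']$; (2) its depth is $\ge1+\gamma(n)$; (3) if $\tilde m<0$, $S^n_{\tilde M''}-\max_{\tilde m\le t\le0}S^n_t\ge\gamma(n)$, and if $\tilde m>0$, $S^n_{\tilde M'}-\max_{0\le t\le\tilde m}S^n_t\ge\gamma(n)$. Basic valley $\{\tilde M_0',\tilde m_0,\tilde M_0\}$ (depends on $n$, $\gamma$, $\alpha$). $\tilde m_0$ is the bottom of the smallest valley containing $0$ and of depth larger than $1+\gamma(n)$, where smallest means that any other valley constructed inside it by refinement fails one of (1)--(3). Then: if $\tilde m_0>0$,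 $\tilde M_0'=\sup\{l\in\mathbb Z_-: l<\tilde m_0,\ S^n_l-S^n_{\tilde m_0}\ge1+\gamma(n),\ S^n_l-\max_{0\le k\le\tilde m_0}S^n_k\ge\gamma(n)\}$ and $\tilde M_0=\inf\{l\in\mathbb Z_+: l>\tilde m_0,\ S^n_l-S^n_{\tilde m_0}\ge1+\gamma(n)\}$; if $\tilde m_0<0$, $\tilde M_0'=\sup\{l\in\mathbb Z_-: l<\tilde m_0,\ S^n_l-S^n_{\tilde m_0}\ge1+\gamma(n)\}$ and $\tilde M_0=\inf\{l\in\mathbb Z_+: l>\tilde m_0,\ S^n_l-S^n_{\tilde m_0}\ge1+\gamma(n),\ S^n_l-\max_{\tilde m_0\le k\le0}S^n_k\ge\gamma(n)\}$; if $\tilde m_0=0$, $\tilde M_0'=\sup\{l\in\mathbb Z_-: l<0,\ S^n_l-S^n_{\tilde m_0}\ge1+\gamma(n)\}$ and $\tilde M_0=\inf\{l\in\mathbb Z_+: l>0,\ S^n_l-S^n_{\tilde m_0}\ge1+\gamma(n)\}$. *)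

theory Defs
  imports "HOL-Probability.Probability"
begin

section \<open>The random environment\<close>

text \<open>An environment is a function from the integers to the reals; a random environment is a
  random element \<open>\<alpha>\<close>, given by \<open>\<omega> \<mapsto> \<alpha> \<omega>\<close>, on a probability space \<open>Q\<close>.\<close>

definition eps :: "(int \<Rightarrow> real) \<Rightarrow> int \<Rightarrow> real" where
  "eps a i = ln ((1 - a i) / a i)"

text \<open>Assumption \<open>exp_moments\<close> makes all moments of \<open>\<epsilon>\<^sub>0\<close> finite, so the Bochner integrals in
  \<open>centred\<close> and \<open>variance_pos\<close> are genuine expectations. Independence of the family includes the
  measurability of each coordinate.\<close>

locale random_environment = prob_space Q for Q :: "'a measure" +
  fixes \<alpha> :: "'a \<Rightarrow> int \<Rightarrow> real"
  assumes indep: "indep_vars (\<lambda>_. borel) (\<lambda>i \<omega>. \<alpha> \<omega> i) UNIV"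
    and identically_distributed:
      "\<And>i. distr Q borel (\<lambda>\<omega>. \<alpha> \<omega> i) = distr Q borel (\<lambda>\<omega>. \<alpha> \<omega> 0)"
    and range: "\<And>\<omega> i. \<omega> \<in> space Q \<Longrightarrow> \<alpha> \<omega> i \<in> {0<..<1}"
    and centred: "expectation (\<lambda>\<omega>. eps (\<alpha> \<omega>) 0) = 0"
    and variance_pos: "expectation (\<lambda>\<omega>. (eps (\<alpha> \<omega>) 0)\<^sup>2) > 0"
    and exp_moments: "\<exists>\<kappa>\<^sub>0>0. \<forall>\<kappa>\<in>{0<..<\<kappa>\<^sub>0}.
        integrable Q (\<lambda>\<omega>. exp (\<kappa> * eps (\<alpha> \<omega>) 0)) \<and>
        integrable Q (\<lambda>\<omega>. exp (- \<kappa> * eps (\<alpha> \<omega>) 0))"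

definition sigma :: "'a measure \<Rightarrow> ('a \<Rightarrow> int \<Rightarrow> real) \<Rightarrow> real" where
  "sigma Q \<alpha> = sqrt (\<integral>\<omega>. (eps (\<alpha> \<omega>) 0)\<^sup>2 \<partial>Q)"


section \<open>The walk in a fixed environment\<close>

definition jump :: "(int \<Rightarrow> real) \<Rightarrow> int \<Rightarrow> int pmf" where
  "jump a i = map_pmf (\<lambda>b. if b then i + 1 else i - 1) (bernoulli_pmf (a i))"

primrec step :: "(int \<Rightarrow> real) \<Rightarrow> int \<Rightarrow> nat \<Rightarrow> (nat \<Rightarrow> int) \<Rightarrow> int measure" where
  "step a x 0 X = measure_pmf (return_pmf x)"
| "step a x (Suc k) X = measure_pmf (jump a (X k))"

lemma step_kernels: "Ionescu_Tulcea (step a x) (\<lambda>_. count_space UNIV)"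
proof (rule Ionescu_Tulcea.intro)
  fix i
  show "step a x i \<in> (PiM {0..<i} (\<lambda>_. count_space UNIV)) \<rightarrow>\<^sub>M subprob_algebra (count_space UNIV)"
  proof (cases i)
    case 0
    have "step a x 0 = (\<lambda>_. measure_pmf (return_pmf x))"
      by (simp add: fun_eq_iff)
    then show ?thesis
      using 0 by (simp add: measure_pmf_in_subprob_algebra)
  next
    case (Suc k)
    have "(\<lambda>X. X k) \<in> (PiM {0..<i} (\<lambda>_. count_space (UNIV :: int set))) \<rightarrow>\<^sub>M count_space UNIV"
      by (rule measurable_component_singleton) (simp add: Suc)
    moreover have "(\<lambda>j. measure_pmf (jump a j)) \<in> count_space UNIV \<rightarrow>\<^sub>M subprob_algebra (count_space UNIV)"
      by (simp add: measure_pmf_in_subprob_algebra)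
    ultimately have "(\<lambda>X. measure_pmf (jump a (X k))) \<in>
        (PiM {0..<i} (\<lambda>_. count_space UNIV)) \<rightarrow>\<^sub>M subprob_algebra (count_space UNIV)"
      by (rule measurable_compose)
    moreover have "step a x i = (\<lambda>X. measure_pmf (jump a (X k)))"
      by (simp add: fun_eq_iff Suc)
    ultimately show ?thesis by simp
  qed
  show "prob_space (step a x i X)" for X
    by (cases i) (simp_all add: measure_pmf.prob_space_axioms)
qed

text \<open>The law \<open>walk_law a x\<close> of the chain started at \<open>x\<close> is the measure on path space which the
  Ionescu Tulcea theorem provides for the conditional laws \<open>step a x k\<close> of \<open>X k\<close> given
  \<open>X 0, \<dots>, X (k - 1)\<close>.\<close>

global_interpretation walk: Ionescu_Tulcea "step a x" "\<lambda>_. count_space UNIV"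
  for a :: "int \<Rightarrow> real" and x :: int
  defines walk_law = walk.PF.lim
  by (rule step_kernels)


lemma emeasure_walk_C:
  fixes p :: "nat \<Rightarrow> int"
  shows "emeasure (walk.C a x 0 (Suc n) (\<lambda>_. undefined)) {restrict p {0..<Suc n}} =
    (if p 0 = x then ennreal (\<Prod>k<n. pmf (jump a (p k)) (p (Suc k))) else 0)"
proof -
  have sing: "{restrict p {0..<m}} \<in> sets (PiM {0..<m} (\<lambda>_. count_space (UNIV::int set)))" for m
  proof -
    have "{restrict p {0..<m}} = PiE {0..<m} (\<lambda>i. {p i})"
      by (auto simp: PiE_iff extensional_def fun_eq_iff)
    then show ?thesis by (auto intro!: sets_PiM_I_finite)
  qed
  have rec: "emeasure (walk.C a x 0 (Suc m) (\<lambda>_. undefined)) {restrict p {0..<Suc m}} =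
     emeasure (step a x m (restrict p {0..<m})) {p m} *
     emeasure (walk.C a x 0 m (\<lambda>_. undefined)) {restrict p {0..<m}}" for m
  proof -
    let ?C = "walk.C a x 0 m (\<lambda>_. undefined)"
    have u: "(\<lambda>_. undefined) \<in> space (PiM {0..<0} (\<lambda>_. count_space (UNIV::int set)))"
      by (simp add: space_PiM PiE_iff extensional_def)
    have "emeasure (walk.C a x 0 (Suc m) (\<lambda>_. undefined)) {restrict p {0..<Suc m}} =
       (\<integral>\<^sup>+\<omega>. emeasure (walk.eP a x m \<omega>) {restrict p {0..<Suc m}} \<partial>?C)"
      unfolding walk.C.simps add_0
      by (rule emeasure_bind[where N="PiM {0..<Suc m} (\<lambda>_. count_space UNIV)"])
         (use walk.space_C[OF u, of a x m] walk.measurable_eP[of a x m] sing[of "Suc m"]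
           in \<open>auto simp: space_PiM measurable_cong_sets[OF walk.sets_C[OF u, of a x m] refl]\<close>)
    also have "\<dots> = (\<integral>\<^sup>+\<omega>. emeasure (step a x m (restrict p {0..<m})) {p m} *
        indicator {restrict p {0..<m}} \<omega> \<partial>?C)"
    proof (rule nn_integral_cong)
      fix \<omega> assume "\<omega> \<in> space ?C"
      then have w: "\<omega> \<in> space (PiM {0..<m} (\<lambda>_. count_space (UNIV::int set)))"
        using walk.space_C[OF u, of a x m] by simp
      have "fun_upd \<omega> m -` {restrict p {0..<Suc m}} =
         (if \<omega> = restrict p {0..<m} then {p m} else {})"
      proof -
        have "fun_upd \<omega> m y = restrict p {0..<Suc m} \<longleftrightarrow> y = p m \<and> \<omega> = restrict p {0..<m}" for y
        proof
          assume "fun_upd \<omega> m y = restrict p {0..<Suc m}"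
          then have eq: "fun_upd \<omega> m y i = restrict p {0..<Suc m} i" for i by simp
          have "\<omega> i = restrict p {0..<m} i" for i
            using eq[of i] w by (cases "i = m") (auto simp: space_PiM PiE_iff extensional_def split: if_splits)
          then show "y = p m \<and> \<omega> = restrict p {0..<m}"
            using eq[of m] by auto
        qed (auto simp: fun_eq_iff)
        then show ?thesis by auto
      qed
      then show "emeasure (walk.eP a x m \<omega>) {restrict p {0..<Suc m}} =
        emeasure (step a x m (restrict p {0..<m})) {p m} * indicator {restrict p {0..<m}} \<omega>"
        by (simp add: walk.emeasure_eP[OF w sing])
    qed
    also have "\<dots> = emeasure (step a x m (restrict p {0..<m})) {p m} * emeasure ?C {restrict p {0..<m}}"
      using sing[of m] walk.sets_C[OF u, of a x m]
      by (subst nn_integral_cmult_indicator) auto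
    finally show ?thesis .
  qed
  show ?thesis
  proof (induction n)
    case 0
    show ?case
      unfolding rec by (auto simp: emeasure_pmf_single pmf_return PiM_empty restrict_def)
  next
    case (Suc n)
    show ?case
      unfolding rec[of "Suc n"] Suc
      by (simp add: emeasure_pmf_single ennreal_mult'[symmetric] mult.commute prod_nonneg)
  qed
qed

text \<open>The finite-dimensional distributions identify \<open>walk_law a x\<close> as the law of the nearest-neighbour
  chain.\<close>

lemma walk_law_path:
  "emeasure (walk_law a x) {X. \<forall>k\<le>n. X k = p k} =
    (if p 0 = x then ennreal (\<Prod>k<n. pmf (jump a (p k)) (p (Suc k))) else 0)"
proof -
  have eq: "{restrict p {0..<Suc n}} = PiE {0..<Suc n} (\<lambda>i. {p i})"
    by (auto simp: PiE_iff extensional_def fun_eq_iff)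
  then have sets: "{restrict p {0..<Suc n}} \<in> sets (PiM {0..<Suc n} (\<lambda>_. count_space (UNIV::int set)))"
    by (auto intro!: sets_PiM_I_finite)
  have "{X. \<forall>k\<le>n. X k = p k} =
      prod_emb UNIV (\<lambda>_. count_space UNIV) {0..<Suc n} {restrict p {0..<Suc n}}"
    by (simp add: prod_emb_def fun_eq_iff less_Suc_eq_le set_eq_iff)
  moreover have "emeasure (walk.CI a x {0..<Suc n}) {restrict p {0..<Suc n}} =
      emeasure (walk.C a x 0 (Suc n) (\<lambda>_. undefined)) {restrict p {0..<Suc n}}"
    using walk.emeasure_CI[OF order_refl sets] sets.sets_into_space[OF sets]
    by (simp add: prod_emb_id)
  ultimately show ?thesis
    using walk.lim[OF _ sets] emeasure_walk_C[of a x n p] by simp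
qed


section \<open>Potential and valleys\<close>

definition S_int :: "(int \<Rightarrow> real) \<Rightarrow> int \<Rightarrow> real" where
  "S_int a k = (if k \<ge> 0 then \<Sum>i\<in>{1..k}. eps a i else - (\<Sum>i\<in>{k+1..0}. eps a i))"

definition S_real :: "(int \<Rightarrow> real) \<Rightarrow> real \<Rightarrow> real" where
  "S_real a t = S_int a \<lfloor>t\<rfloor> + frac t * (S_int a (\<lfloor>t\<rfloor> + 1) - S_int a \<lfloor>t\<rfloor>)"

definition Sn :: "(int \<Rightarrow> real) \<Rightarrow> nat \<Rightarrow> real \<Rightarrow> real" where
  "Sn a n t = S_real a t / ln (real n)"

definition gamma_n :: "real \<Rightarrow> nat \<Rightarrow> real" where
  "gamma_n \<gamma> n = \<gamma> * ln (ln (real n)) / ln (real n)"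

text \<open>From here on \<open>V\<close> stands for the rescaled potential \<open>Sn a n\<close>, \<open>g\<close> for \<open>gamma_n \<gamma> n\<close>, and a
  valley is a triple (left top, bottom, right top) of reals.\<close>

type_synonym triplet = "real \<times> real \<times> real"

fun valley :: "(real \<Rightarrow> real) \<Rightarrow> triplet \<Rightarrow> bool" where
  "valley V (l, m, r) \<longleftrightarrow> l \<le> m \<and> m \<le> r \<and>
     (\<forall>t\<in>{l..m}. V t \<le> V l) \<and>
     (\<forall>t\<in>{m..r}. V t \<le> V r) \<and>
     (\<forall>t\<in>{l..r}. V m \<le> V t \<and> (V t = V m \<longrightarrow> \<bar>m\<bar> \<le> \<bar>t\<bar>))"

fun depth :: "(real \<Rightarrow> real) \<Rightarrow> triplet \<Rightarrow> real" where
  "depth V (l, m, r) = min (V l - V m) (V r - V m)"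

text \<open>\<open>M\<close> and \<open>b\<close> are the top and the bottom of the new valley. If the maximizing couple is not
  unique, the one with smallest \<open>\<bar>M\<bar>\<close>, and among these smallest \<open>\<bar>b\<bar>\<close>, is taken.\<close>

definition right_couple :: "(real \<Rightarrow> real) \<Rightarrow> real \<Rightarrow> real \<Rightarrow> real \<Rightarrow> real \<Rightarrow> bool" where
  "right_couple V m r M b \<longleftrightarrow> m \<le> M \<and> M < b \<and> b \<le> r \<and>
     (\<forall>t' t''. m \<le> t' \<and> t' \<le> t'' \<and> t'' \<le> r \<longrightarrow>
        V t' - V t'' \<le> V M - V b \<and>
        (V t' - V t'' = V M - V b \<longrightarrow> \<bar>M\<bar> < \<bar>t'\<bar> \<or> \<bar>M\<bar> = \<bar>t'\<bar> \<and> \<bar>b\<bar> \<le> \<bar>t''\<bar>))"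

definition left_couple :: "(real \<Rightarrow> real) \<Rightarrow> real \<Rightarrow> real \<Rightarrow> real \<Rightarrow> real \<Rightarrow> bool" where
  "left_couple V l m M b \<longleftrightarrow> l \<le> b \<and> b < M \<and> M \<le> m \<and>
     (\<forall>t' t''. l \<le> t'' \<and> t'' \<le> t' \<and> t' \<le> m \<longrightarrow>
        V t' - V t'' \<le> V M - V b \<and>
        (V t' - V t'' = V M - V b \<longrightarrow> \<bar>M\<bar> < \<bar>t'\<bar> \<or> \<bar>M\<bar> = \<bar>t'\<bar> \<and> \<bar>b\<bar> \<le> \<bar>t''\<bar>))"

text \<open>A refinement at \<open>(M, b)\<close> cuts the valley at \<open>M\<close> into one with the old bottom and one with
  bottom \<open>b\<close>.\<close>

inductive refine :: "(real \<Rightarrow> real) \<Rightarrow> triplet \<Rightarrow> triplet \<Rightarrow> bool" for V where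
  right_old: "right_couple V m r M b \<Longrightarrow> refine V (l, m, r) (l, m, M)"
| right_new: "right_couple V m r M b \<Longrightarrow> refine V (l, m, r) (M, b, r)"
| left_old: "left_couple V l m M b \<Longrightarrow> refine V (l, m, r) (M, m, r)"
| left_new: "left_couple V l m M b \<Longrightarrow> refine V (l, m, r) (l, b, M)"

fun deep_valley_around_0 :: "(real \<Rightarrow> real) \<Rightarrow> real \<Rightarrow> triplet \<Rightarrow> bool" where
  "deep_valley_around_0 V g (l, m, r) \<longleftrightarrow> valley V (l, m, r) \<and>
     0 \<in> {l..r} \<and>
     depth V (l, m, r) \<ge> 1 + g \<and>
     (m < 0 \<longrightarrow> V r - (SUP t\<in>{m..0}. V t) \<ge> g) \<and>
     (m > 0 \<longrightarrow> V l - (SUP t\<in>{0..m}. V t) \<ge> g)"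

definition smallest_valley :: "(real \<Rightarrow> real) \<Rightarrow> real \<Rightarrow> triplet \<Rightarrow> bool" where
  "smallest_valley V g T \<longleftrightarrow> deep_valley_around_0 V g T \<and>
     (\<forall>T'. (refine V)\<^sup>+\<^sup>+ T T' \<longrightarrow> \<not> deep_valley_around_0 V g T')"

definition left_tops :: "(real \<Rightarrow> real) \<Rightarrow> real \<Rightarrow> int \<Rightarrow> int set" where
  "left_tops V g m = {l. l \<le> 0 \<and> l < m \<and> V l - V m \<ge> 1 + g \<and>
     (m > 0 \<longrightarrow> V l - (MAX k\<in>{0..m}. V (of_int k)) \<ge> g)}"

definition right_tops :: "(real \<Rightarrow> real) \<Rightarrow> real \<Rightarrow> int \<Rightarrow> int set" where
  "right_tops V g m = {l. l \<ge> 0 \<and> l > m \<and> V l - V m \<ge> 1 + g \<and>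
     (m < 0 \<longrightarrow> V l - (MAX k\<in>{m..0}. V (of_int k)) \<ge> g)}"

text \<open>The bottom of a valley of positive depth of a piecewise linear \<open>V\<close> with integer nodes is an
  integer. The set of tops is required to be nonempty because the supremum (infimum) over an empty
  set of integers would be an arbitrary integer. As a relation, \<open>basic_valley\<close> does not presuppose
  that the smallest valley has only one possible bottom.\<close>

definition basic_valley :: "(int \<Rightarrow> real) \<Rightarrow> nat \<Rightarrow> real \<Rightarrow> int \<Rightarrow> int \<Rightarrow> int \<Rightarrow> bool" where
  "basic_valley a n \<gamma> L m R \<longleftrightarrow>
     (let V = Sn a n; g = gamma_n \<gamma> n in
       (\<exists>l r. smallest_valley V g (l, of_int m, r)) \<and>
       left_tops V g m \<noteq> {} \<and> L = Sup (left_tops V g m) \<and>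
       right_tops V g m \<noteq> {} \<and> R = Inf (right_tops V g m))"


section \<open>Confinement\<close>

text \<open>\<open>confinement h Q \<alpha>\<close> is the assertion about one random environment, with \<open>h\<close> the constant in
  the bound for the probability of \<open>G\<close>. The constant has to be the same for all random
  environments, whatever the type of their sample space. Since a type cannot be quantified over
  below \<open>\<exists>h\<close>, the theorem asserts that some \<open>h\<close> is good for all random environments with sample
  space in \<open>int \<Rightarrow> real\<close> (which includes the canonical ones), and that every such \<open>h\<close> is good
  for the random environments over an arbitrary type as well; so a single \<open>h\<close> serves all types.

  The suprema are taken in \<open>ennreal\<close>. The first one ranges over all \<open>\<omega> \<in> G\<close> and over
  every basic valley of \<open>\<alpha> \<omega>\<close>, which is the strongest reading should there be several.\<close>

definition confinement :: "real \<Rightarrow> 'a measure \<Rightarrow> ('a \<Rightarrow> int \<Rightarrow> real) \<Rightarrow> bool" where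
  "confinement h Q \<alpha> \<longleftrightarrow>
     (\<forall>\<gamma>>2. \<exists>n\<^sub>0::nat. \<forall>n>n\<^sub>0. \<exists>G\<in>sets Q.
        (\<forall>\<omega>\<in>G. \<exists>L m R. basic_valley (\<alpha> \<omega>) n \<gamma> L m R) \<and>
        measure Q G \<ge> 1 - h * sqrt (ln (ln (ln (real n))) / ln (ln (real n))) \<and>
        (SUP (\<omega>, L, m, R) \<in> {(\<omega>, L, m, R). \<omega> \<in> G \<and> basic_valley (\<alpha> \<omega>) n \<gamma> L m R}.
           emeasure (walk_law (\<alpha> \<omega>) 0) (\<Union>k\<in>{0..n}. {X. X k \<notin> {L..R}}))
         \<le> ennreal (2 * ln (ln (real n)) / ((sigma Q \<alpha>)\<^sup>2 * ln (real n) powr (\<gamma> - 2))) \<and>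
        (SUP \<omega>\<in>G.
           emeasure (walk_law (\<alpha> \<omega>) 0)
             (\<Union>k\<in>{0..n}. {X. real_of_int (X k) \<notin>
                {- (ln (real n) / sigma Q \<alpha>)\<^sup>2 * ln (ln (real n)) ..
                   (ln (real n) / sigma Q \<alpha>)\<^sup>2 * ln (ln (real n))}}))
         \<le> ennreal (2 * ln (ln (real n)) / ((sigma Q \<alpha>)\<^sup>2 * ln (real n) powr (\<gamma> - 2))))"

end

theory Submission
  imports Defs "HOL-Real_Asymp.Real_Asymp"
begin

text \<open>
  Write \<open>L = ln n\<close>, \<open>l = ln L\<close>, \<open>g = \<gamma> l / L\<close>, and let \<open>V\<close> be the potential divided by \<open>L\<close>.

  Environment. Within \<open>T = L\<^sup>2 l / \<sigma>\<^sup>2\<close> steps both halves of the potential rise to \<open>(1 + 2 g) L\<close>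
  except with probability \<open>O (sqrt (ln l / l))\<close>: the walk leaves an interval of width about
  \<open>L sqrt (l / ln l)\<close> in time, by a fourth moment bound on blocks, and leaves it at the bottom with
  small probability, by optional stopping. Optional stopping also shows that, given a grid of mesh
  \<open>1 / l\<close>, a fixed half hardly ever reaches a grid level and then falls by almost 1 before it has risen
  two more meshes; since the halves are independent, they do not do so for the same level, up to
  probability \<open>O (1 / l)\<close>.

  Valleys. On this event refine a large valley around 0 only at couples of height at least \<open>1 + g\<close>. The
  result has no rise of \<open>1 + g\<close> to the left of its bottom and no such drop to the right, and if
  condition (3) failed for it, both halves would fall from nearly the same level. So the result is a
  deep valley around 0. Hence a smallest valley exists, and its bottom and tops lie in \<open>{- T..T}\<close>.

  Walk. The exit probability is bounded by an explicit supersolution, glued at the bottom from two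
  sums of the resistances \<open>exp (S k)\<close>.
\<close>

section \<open>Refinement of valleys\<close>

text \<open>The rate is a trade-off: an interval of depth \<open>w\<close> is left at the bottom
  with probability of order \<open>L / w\<close>, but it must be left within \<open>T\<close> steps.
  Cutting \<open>T\<close> into about \<open>8 * ln l\<close> blocks, each of which has a small
  increment with probability at most 15/16, pushes the failure down to \<open>1 / sqrt l\<close> and
  allows \<open>w\<close> of order \<open>L * sqrt (l / ln l)\<close>. The other obstacle is a tie
  up to \<open>g\<close> between the two halves. One half plunges from a given grid level with
  probability O(1 / l), so a union over the O(l) levels would give only O(1); the product over two
  independent halves gives O(1 / l^2) per level and O(1 / l) in total. Fixed levels replace the
  random maximum before the fall, at the price of an uncertainty of two meshes. The surplus in the
  height \<open>1 + 2 * g\<close> lets an end that was never cut exceed by \<open>g\<close> every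
  top below \<open>1 + g\<close>. The fourth moment enters only through the threshold for
  \<open>n\<close>, so the constant is numerical: 83 = 41 + 41 + 1, for the rise of either half and
  for the ties.\<close>

lemma ball_uminus_atLeastAtMost: "(\<forall>t\<in>{-b..-a}. P (- t)) \<longleftrightarrow> (\<forall>t\<in>{a..b::real}. P t)"
proof
  assume *: "\<forall>t\<in>{-b..-a}. P (- t)"
  show "\<forall>t\<in>{a..b}. P t"
  proof
    fix t assume "t \<in> {a..b}"
    then show "P t" using *[rule_format, of "- t"] by simp
  qed
qed auto

text \<open>The competing couples include the degenerate ones with \<open>t' = t''\<close>. If the
  drop were 0, all of them would tie: \<open>(M, M)\<close> and \<open>(b, b)\<close> then force
  \<open>\<bar>M\<bar> = \<bar>b\<bar>\<close>, so \<open>M = - b < 0\<close>, and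
  \<open>(0, 0)\<close> beats the couple in the tie-breaking order.\<close>

lemma right_couple_drop_pos:
  assumes "right_couple V m r M b"
  shows "V b < V M"
proof (rule ccontr)
  have c: "m \<le> M" "M < b" "b \<le> r"
    and p: "\<And>t' t''. m \<le> t' \<Longrightarrow> t' \<le> t'' \<Longrightarrow> t'' \<le> r \<Longrightarrow> V t' - V t'' \<le> V M - V b \<and>
      (V t' - V t'' = V M - V b \<longrightarrow> \<bar>M\<bar> < \<bar>t'\<bar> \<or> \<bar>M\<bar> = \<bar>t'\<bar> \<and> \<bar>b\<bar> \<le> \<bar>t''\<bar>)"
    using assms unfolding right_couple_def by blast+
  assume "\<not> V b < V M"
  then have "V M - V b = 0" using p[of M M] c by auto
  then show False using p[of M M] p[of b b] p[of 0 0] c by (auto simp: abs_if split: if_splits)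
qed

lemma right_coupleD:
  assumes "right_couple V m r M b"
  shows "m \<le> M" "M < b" "b \<le> r" "V b < V M"
    "\<And>t. m \<le> t \<Longrightarrow> t \<le> b \<Longrightarrow> V t \<le> V M" "\<And>t. M \<le> t \<Longrightarrow> t \<le> r \<Longrightarrow> V b \<le> V t"
    "\<And>t. m \<le> t \<Longrightarrow> t \<le> b \<Longrightarrow> V t = V M \<Longrightarrow> \<bar>M\<bar> \<le> \<bar>t\<bar>"
    "\<And>t. M \<le> t \<Longrightarrow> t \<le> r \<Longrightarrow> V t = V b \<Longrightarrow> \<bar>b\<bar> \<le> \<bar>t\<bar>"
    "\<And>t' t''. m \<le> t' \<Longrightarrow> t' \<le> t'' \<Longrightarrow> t'' \<le> r \<Longrightarrow> V t' - V t'' \<le> V M - V b"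
proof -
  show c: "m \<le> M" "M < b" "b \<le> r" and d: "V b < V M"
    using assms right_couple_drop_pos[OF assms] unfolding right_couple_def by blast+
  have p: "\<And>t' t''. m \<le> t' \<Longrightarrow> t' \<le> t'' \<Longrightarrow> t'' \<le> r \<Longrightarrow> V t' - V t'' \<le> V M - V b \<and>
      (V t' - V t'' = V M - V b \<longrightarrow> \<bar>M\<bar> < \<bar>t'\<bar> \<or> \<bar>M\<bar> = \<bar>t'\<bar> \<and> \<bar>b\<bar> \<le> \<bar>t''\<bar>)"
    using assms unfolding right_couple_def by blast
  show "V t \<le> V M" if "m \<le> t" "t \<le> b" for t
    using p[of t b] that c by auto
  show "V b \<le> V t" if "M \<le> t" "t \<le> r" for t
    using p[of M t] that c by auto
  show "\<bar>M\<bar> \<le> \<bar>t\<bar>" if "m \<le> t" "t \<le> b" "V t = V M" for t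
    using p[of t b] that c by auto
  show "\<bar>b\<bar> \<le> \<bar>t\<bar>" if "M \<le> t" "t \<le> r" "V t = V b" for t
    using p[of M t] that c by auto
  show "V t' - V t'' \<le> V M - V b" if "m \<le> t'" "t' \<le> t''" "t'' \<le> r" for t' t''
    using p[of t' t''] that by auto
qed

text \<open>Lexicographic optimization on compact sets: maximize the drop, then minimize
  \<open>\<bar>M\<bar>\<close> among the maximizers, then \<open>\<bar>b\<bar>\<close>. The given
  positive drop excludes \<open>M = b\<close>.\<close>

lemma right_couple_exists:
  assumes V: "continuous_on UNIV V" and t: "m \<le> t'" "t' \<le> t''" "t'' \<le> r" "V t'' < V t'"
  obtains M b where "right_couple V m r M b"
proof -
  define K where "K = ({m..r} \<times> {m..r}) \<inter> {z. fst z \<le> snd z}"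
  define D where "D = (\<lambda>z::real\<times>real. V (fst z) - V (snd z))"
  have KI: "(a, b) \<in> K \<longleftrightarrow> m \<le> a \<and> a \<le> b \<and> b \<le> r" for a b
    by (auto simp: K_def)
  have "closed {z::real\<times>real. fst z \<le> snd z}"
    by (intro closed_Collect_le continuous_intros)
  then have K: "compact K" unfolding K_def
    by (intro compact_Int_closed compact_Times) auto
  have D: "continuous_on UNIV D" unfolding D_def
    by (intro continuous_intros continuous_on_compose2[OF V]) auto
  obtain z0 where z0: "z0 \<in> K" "\<And>z. z \<in> K \<Longrightarrow> D z \<le> D z0"
    using continuous_attains_sup[OF K _ continuous_on_subset[OF D]] KI[of t' t''] t by blast
  define K1 where "K1 = K \<inter> {z. D z = D z0}"
  have K1: "compact K1" unfolding K1_def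
    by (intro compact_Int_closed K closed_Collect_eq D continuous_intros)
  have "continuous_on K1 (\<lambda>z. \<bar>fst z\<bar>)" "K1 \<noteq> {}"
    using z0 by (auto intro!: continuous_intros simp: K1_def)
  then obtain z1 where z1: "z1 \<in> K1" "\<And>z. z \<in> K1 \<Longrightarrow> \<bar>fst z1\<bar> \<le> \<bar>fst z\<bar>"
    using continuous_attains_inf[OF K1] by metis
  define K2 where "K2 = K1 \<inter> {z. \<bar>fst z\<bar> = \<bar>fst z1\<bar>}"
  have K2: "compact K2" unfolding K2_def
    by (intro compact_Int_closed K1 closed_Collect_eq continuous_intros)
  have "continuous_on K2 (\<lambda>z. \<bar>snd z\<bar>)" "K2 \<noteq> {}"
    using z1 by (auto intro!: continuous_intros simp: K2_def)
  then obtain z2 where z2: "z2 \<in> K2" "\<And>z. z \<in> K2 \<Longrightarrow> \<bar>snd z2\<bar> \<le> \<bar>snd z\<bar>"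
    using continuous_attains_inf[OF K2] by metis
  obtain M b where Mb: "z2 = (M, b)" by force
  have k: "m \<le> M" "M \<le> b" "b \<le> r" "D (M, b) = D z0" "\<bar>M\<bar> = \<bar>fst z1\<bar>"
    using z2(1) unfolding Mb K2_def K1_def using KI by auto
  have mx: "V a - V c \<le> V M - V b" if "m \<le> a" "a \<le> c" "c \<le> r" for a c
    using z0(2)[of "(a, c)"] that k(4) KI by (auto simp: D_def)
  have "V t' - V t'' \<le> V M - V b" using mx t by auto
  then have "M \<noteq> b" using t by auto
  moreover have "\<bar>M\<bar> < \<bar>a\<bar> \<or> \<bar>M\<bar> = \<bar>a\<bar> \<and> \<bar>b\<bar> \<le> \<bar>c\<bar>"
    if "m \<le> a" "a \<le> c" "c \<le> r" "V a - V c = V M - V b" for a c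
  proof -
    have a: "(a, c) \<in> K1" using that k(4) KI by (auto simp: D_def K1_def)
    show ?thesis
    proof (cases "\<bar>M\<bar> = \<bar>a\<bar>")
      case True
      then have "(a, c) \<in> K2" using a k(5) by (auto simp: K2_def)
      then show ?thesis using z2(2)[of "(a, c)"] True Mb by auto
    next
      case False
      then show ?thesis using z1(2)[OF a] k(5) by auto
    qed
  qed
  ultimately have "right_couple V m r M b"
    using k mx unfolding right_couple_def by auto
  then show ?thesis by (rule that)
qed

text \<open>The tie-breaking rule involves only absolute values, hence reflection at 0 exchanges
  left and right couples. The facts about left cuts and left descents below are obtained from their
  right-hand versions in this way.\<close>

lemma left_couple_mirror:
  "left_couple V l m M b \<longleftrightarrow> right_couple (\<lambda>t. V (- t)) (- m) (- l) (- M) (- b)" (is "?L = ?R")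
proof
  assume L: ?L
  show ?R unfolding right_couple_def
  proof (intro conjI allI impI)
    fix s t assume a: "- m \<le> s \<and> s \<le> t \<and> t \<le> - l"
    then have "l \<le> - t \<and> - t \<le> - s \<and> - s \<le> m" by auto
    with L show "V (- s) - V (- t) \<le> V (- (- M)) - V (- (- b))"
      and "V (- s) - V (- t) = V (- (- M)) - V (- (- b)) \<Longrightarrow>
        \<bar>- M\<bar> < \<bar>s\<bar> \<or> \<bar>- M\<bar> = \<bar>s\<bar> \<and> \<bar>- b\<bar> \<le> \<bar>t\<bar>"
      unfolding left_couple_def by fastforce+
  qed (use L in \<open>auto simp: left_couple_def\<close>)
next
  assume R: ?R
  show ?L unfolding left_couple_def
  proof (intro conjI allI impI)
    fix s t assume a: "l \<le> t \<and> t \<le> s \<and> s \<le> m"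
    then have "- m \<le> - s \<and> - s \<le> - t \<and> - t \<le> - l" by auto
    with R show "V s - V t \<le> V M - V b"
      and "V s - V t = V M - V b \<Longrightarrow> \<bar>M\<bar> < \<bar>s\<bar> \<or> \<bar>M\<bar> = \<bar>s\<bar> \<and> \<bar>b\<bar> \<le> \<bar>t\<bar>"
      unfolding right_couple_def by fastforce+
  qed (use R in \<open>auto simp: right_couple_def\<close>)
qed

lemma valley_mirrorI:
  assumes "valley V (l, m, r)"
  shows "valley (\<lambda>t. V (- t)) (- r, - m, - l)"
proof -
  have 1: "(\<forall>t\<in>{- r.. - m}. V (- t) \<le> V r) \<longleftrightarrow> (\<forall>t\<in>{m..r}. V t \<le> V r)"
    by (rule ball_uminus_atLeastAtMost)
  have 2: "(\<forall>t\<in>{- m.. - l}. V (- t) \<le> V l) \<longleftrightarrow> (\<forall>t\<in>{l..m}. V t \<le> V l)"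
    by (rule ball_uminus_atLeastAtMost)
  have 3: "(\<forall>t\<in>{- r.. - l}. V m \<le> V (- t) \<and> (V (- t) = V m \<longrightarrow> \<bar>m\<bar> \<le> \<bar>- t\<bar>)) \<longleftrightarrow>
      (\<forall>t\<in>{l..r}. V m \<le> V t \<and> (V t = V m \<longrightarrow> \<bar>m\<bar> \<le> \<bar>t\<bar>))"
    by (rule ball_uminus_atLeastAtMost)
  show ?thesis using assms 1 2 3 by simp
qed

lemma valley_mirror: "valley (\<lambda>t. V (- t)) (- r, - m, - l) \<longleftrightarrow> valley V (l, m, r)"
proof
  assume "valley (\<lambda>t. V (- t)) (- r, - m, - l)"
  from valley_mirrorI[OF this] show "valley V (l, m, r)"
    by (simp only: minus_minus)
qed (rule valley_mirrorI)

fun mirror :: "triplet \<Rightarrow> triplet" where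
  "mirror (l, m, r) = (- r, - m, - l)"

lemma mirror_mirror [simp]: "mirror (mirror T) = T"
  by (cases T) auto

lemma refine_mirror:
  assumes "refine V T T'"
  shows "refine (\<lambda>t. V (- t)) (mirror T) (mirror T')"
  using assms
proof cases
  case (right_old m r M b l)
  then show ?thesis
    using left_couple_mirror[of "\<lambda>t. V (- t)" "- r" "- m" "- M" "- b"]
    by (auto intro: refine.intros)
next
  case (right_new m r M b l)
  then show ?thesis
    using left_couple_mirror[of "\<lambda>t. V (- t)" "- r" "- m" "- M" "- b"]
    by (auto intro: refine.intros)
next
  case (left_old l m M b r)
  then show ?thesis
    using left_couple_mirror[of V l m M b] by (auto intro: refine.intros)
next
  case (left_new l m M b r)
  then show ?thesis
    using left_couple_mirror[of V l m M b] by (auto intro: refine.intros)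
qed

lemma refine_rtranclp_mirror:
  "(refine V)\<^sup>*\<^sup>* T T' \<Longrightarrow> (refine (\<lambda>t. V (- t)))\<^sup>*\<^sup>* (mirror T) (mirror T')"
proof (induction rule: rtranclp_induct)
  case (step T' T'')
  show ?case by (rule rtranclp.rtrancl_into_rtrancl[OF step(3) refine_mirror[OF step(2)]])
qed simp

section \<open>Piecewise linear potentials with integer nodes\<close>

locale polygon =
  fixes V :: "real \<Rightarrow> real"
  assumes linear_between: "\<And>(k::int) t. of_int k \<le> t \<Longrightarrow> t \<le> of_int k + 1 \<Longrightarrow>
    V t = V (of_int k) + (t - of_int k) * (V (of_int k + 1) - V (of_int k))"
begin

lemma polygon_mirror: "polygon (\<lambda>t. V (- t))"
proof
  fix k :: int and t :: real assume "of_int k \<le> t" "t \<le> of_int k + 1"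
  then have "V (- t) = V (of_int (- k - 1)) +
      (- t - of_int (- k - 1)) * (V (of_int (- k - 1) + 1) - V (of_int (- k - 1)))"
    by (intro linear_between) auto
  then show "V (- t) = V (- of_int k) + (t - of_int k) * (V (- (of_int k + 1)) - V (- of_int k))"
    by (simp add: algebra_simps minus_diff_commute)
qed

lemma continuous: "continuous_on UNIV V"
proof -
  have piece: "continuous_on {of_int k .. of_int k + 1} V" for k :: int
  proof -
    have "continuous_on {of_int k .. of_int k + 1}
        (\<lambda>t. V (of_int k) + (t - of_int k) * (V (of_int k + 1) - V (of_int k)))"
      by (intro continuous_intros)
    then show ?thesis
      by (rule continuous_on_eq) (auto simp: linear_between)
  qed
  have "isCont V t" for t
  proof -
    define k where "k = \<lfloor>t\<rfloor>"
    have "{of_int (k - 1) .. of_int k + 1} =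
        {of_int (k - 1) .. of_int (k - 1) + 1} \<union> {of_int k .. of_int k + (1::real)}" by auto
    then have "continuous_on {of_int (k - 1) .. of_int k + 1} V"
      using continuous_on_closed_Un[OF _ _ piece[of "k - 1"] piece[of k]] by simp
    moreover have "t \<in> interior {of_int (k - 1) .. of_int k + 1}"
      unfolding interior_atLeastAtMost_real k_def by (auto; linarith)
    ultimately show ?thesis by (rule continuous_on_interior)
  qed
  then show ?thesis by (simp add: continuous_at_imp_continuous_on)
qed

lemma le_int_bound:
  assumes "\<And>k::int. i \<le> k \<Longrightarrow> k \<le> j \<Longrightarrow> V (of_int k) \<le> C" "of_int i \<le> t" "t \<le> of_int j"
  shows "V t \<le> C"
proof (cases "t = of_int j")
  case True
  then show ?thesis using assms by auto
next
  case False
  define k where "k = \<lfloor>t\<rfloor>"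
  have k: "i \<le> k" "k + 1 \<le> j" "of_int k \<le> t" "t \<le> of_int k + 1"
    using assms False unfolding k_def by linarith+
  define s where "s = t - of_int k"
  have s: "0 \<le> s" "s \<le> 1" using k by (auto simp: s_def)
  have "V t = (1 - s) * V (of_int k) + s * V (of_int (k + 1))"
    using linear_between[OF k(3,4)] by (simp add: s_def algebra_simps)
  also have "\<dots> \<le> (1 - s) * C + s * C"
    using k s by (intro add_mono mult_left_mono assms(1)) auto
  finally show ?thesis by (simp add: algebra_simps)
qed

text \<open>At a non-integer interior extremum the polygon is flat, so it can be moved towards 0.\<close>

lemma closest_extremum_Ints:
  assumes "a < t" "t < b"
    and ext: "(\<forall>u\<in>{a..b}. V u \<le> V t) \<or> (\<forall>u\<in>{a..b}. V t \<le> V u)"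
    and closest: "\<And>u. u \<in> {a..b} \<Longrightarrow> V u = V t \<Longrightarrow> \<bar>t\<bar> \<le> \<bar>u\<bar>"
  shows "t \<in> \<int>"
proof (rule ccontr)
  assume "t \<notin> \<int>"
  define k where "k = \<lfloor>t\<rfloor>"
  have "of_int k \<noteq> t" using \<open>t \<notin> \<int>\<close> by auto
  then have k: "of_int k < t" "t < of_int k + 1" unfolding k_def by linarith+
  define s where "s = V (of_int k + 1) - V (of_int k)"
  define lo hi where "lo = max a (of_int k)" and "hi = min b (of_int k + 1)"
  have lh: "lo < t" "t < hi" "a \<le> lo" "hi \<le> b" "of_int k \<le> lo" "hi \<le> of_int k + 1"
    using assms k by (auto simp: lo_def hi_def)
  have lin: "V u = V t + s * (u - t)" if "lo \<le> u" "u \<le> hi" for u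
    using linear_between[of k u] linear_between[of k t] that lh
    by (simp add: s_def algebra_simps)
  have "s = 0"
  proof (rule ccontr)
    assume "s \<noteq> 0"
    have "V lo = V t + s * (lo - t)" "V hi = V t + s * (hi - t)"
      using lh by (intro lin; linarith)+
    moreover have "s * (lo - t) < 0 \<and> s * (hi - t) > 0 \<or> s * (lo - t) > 0 \<and> s * (hi - t) < 0"
      using \<open>s \<noteq> 0\<close> lh by (auto simp: mult_less_0_iff zero_less_mult_iff)
    moreover have "lo \<in> {a..b}" "hi \<in> {a..b}" using lh by auto
    ultimately show False using ext by fastforce
  qed
  then have flat: "V u = V t" if "lo \<le> u" "u \<le> hi" for u
    unfolding lin[OF that] by simp
  show False
  proof (cases "k \<ge> 0")
    case True
    then have "0 \<le> lo" by (simp add: lo_def)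
    then show False using closest[OF _ flat[of lo]] lh by auto
  next
    case False
    then have "real_of_int k + 1 \<le> 0" by linarith
    then have "hi \<le> 0" by (simp add: hi_def)
    then show False using closest[OF _ flat[of hi]] lh by auto
  qed
qed

lemma valley_bottom_Ints:
  assumes "valley V (l, m, r)" "V m < V l" "V m < V r"
  shows "m \<in> \<int>"
proof (rule closest_extremum_Ints)
  have "l \<noteq> m" "m \<noteq> r" using assms by auto
  then show "l < m" "m < r" using assms by auto
  show "(\<forall>u\<in>{l..r}. V u \<le> V m) \<or> (\<forall>u\<in>{l..r}. V m \<le> V u)" using assms(1) by simp
  show "\<bar>m\<bar> \<le> \<bar>u\<bar>" if "u \<in> {l..r}" "V u = V m" for u using assms(1) that by simp
qed

text \<open>As \<open>m\<close> is the bottom, a positive drop cannot start at \<open>m\<close>, so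
  \<open>M\<close> is an interior maximum of \<open>{m..b}\<close>. Being the one closest to 0, it
  is an integer, which is what makes refinement terminate.\<close>

lemma right_cut:
  assumes v: "valley V (l, m, r)" and c: "right_couple V m r M b"
  shows "m < M" "M \<in> \<int>" "valley V (l, m, M)" "valley V (M, b, r)" "V m \<le> V b" "V M \<le> V r"
proof -
  note c = right_coupleD[OF c]
  show mb: "V m \<le> V b" using v c by auto
  then show mM: "m < M" using c by (cases "m = M") auto
  show "M \<in> \<int>"
    by (rule closest_extremum_Ints[of m M b]) (use mM c in auto)
  show "valley V (l, m, M)"
    using v c by auto
  show "valley V (M, b, r)"
    using v c by auto
  show "V M \<le> V r" using v c by auto
qed

end

lemma (in polygon) left_cut:
  assumes v: "valley V (l, m, r)" and c: "left_couple V l m M b"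
  shows "M < m" "M \<in> \<int>" "valley V (M, m, r)" "valley V (l, b, M)" "V m \<le> V b" "V M \<le> V l"
proof -
  interpret m: polygon "\<lambda>t. V (- t)" by (rule polygon_mirror)
  note * = m.right_cut[OF valley_mirrorI[OF v] c[unfolded left_couple_mirror]]
  show "M < m" "V m \<le> V b" "V M \<le> V l" using * by simp_all
  show "M \<in> \<int>" using Ints_minus[OF *(2)] by simp
  show "valley V (M, m, r)" "valley V (l, b, M)" using * by (simp_all only: valley_mirror)
qed

text \<open>Termination measure: every cut is made at an integer strictly inside the valley, and
  this integer is an end of the new valley.\<close>

definition inner_ints :: "triplet \<Rightarrow> int set" where
  "inner_ints T = {k. fst T < of_int k \<and> of_int k < snd (snd T)}"

lemma finite_inner_ints: "finite (inner_ints T)"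
proof (rule finite_subset)
  show "inner_ints T \<subseteq> {\<lfloor>fst T\<rfloor>..\<lceil>snd (snd T)\<rceil>}" unfolding inner_ints_def by (auto; linarith)
qed simp

lemma inner_ints_psubset:
  assumes "l \<le> l'" "r' \<le> r" "l < of_int k" "of_int k < r" "l' = of_int k \<or> r' = of_int k"
  shows "inner_ints (l', m', r') \<subset> inner_ints (l, m, r)"
proof
  show "inner_ints (l', m', r') \<subseteq> inner_ints (l, m, r)"
    using assms by (auto simp: inner_ints_def)
  have "k \<in> inner_ints (l, m, r)" "k \<notin> inner_ints (l', m', r')"
    using assms by (auto simp: inner_ints_def)
  then show "inner_ints (l', m', r') \<noteq> inner_ints (l, m, r)" by blast
qed

lemma (in polygon) refine_valley:
  assumes "refine V T T'" "valley V T"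
  shows "valley V T'" "card (inner_ints T') < card (inner_ints T)"
proof -
  have "valley V T' \<and> inner_ints T' \<subset> inner_ints T"
    using assms(1)
  proof cases
    case (right_old m r M b l)
    then have v: "valley V (l, m, r)" using assms by simp
    note c = right_cut[OF v right_old(3)] right_coupleD(1-3)[OF right_old(3)]
    obtain k where k: "M = of_int k" using c(2) by (rule Ints_cases)
    have "l \<le> m" using v by simp
    then have "inner_ints (l, m, M) \<subset> inner_ints (l, m, r)"
      using c k by (intro inner_ints_psubset[where k=k]) auto
    then show ?thesis using c right_old by simp
  next
    case (right_new m r M b l)
    then have v: "valley V (l, m, r)" using assms by simp
    note c = right_cut[OF v right_new(3)] right_coupleD(1-3)[OF right_new(3)]
    obtain k where k: "M = of_int k" using c(2) by (rule Ints_cases)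
    have "l \<le> m" using v by simp
    then have "inner_ints (M, b, r) \<subset> inner_ints (l, m, r)"
      using c k by (intro inner_ints_psubset[where k=k]) auto
    then show ?thesis using c right_new by simp
  next
    case (left_old l m M b r)
    then have v: "valley V (l, m, r)" using assms by simp
    note c = left_cut[OF v left_old(3)] right_coupleD(1-3)[OF left_old(3)[unfolded left_couple_mirror]]
    obtain k where k: "M = of_int k" using c(2) by (rule Ints_cases)
    have "m \<le> r" using v by simp
    then have "inner_ints (M, m, r) \<subset> inner_ints (l, m, r)"
      using c k by (intro inner_ints_psubset[where k=k]) auto
    then show ?thesis using c left_old by simp
  next
    case (left_new l m M b r)
    then have v: "valley V (l, m, r)" using assms by simp
    note c = left_cut[OF v left_new(3)] right_coupleD(1-3)[OF left_new(3)[unfolded left_couple_mirror]]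
    obtain k where k: "M = of_int k" using c(2) by (rule Ints_cases)
    have "m \<le> r" using v by simp
    then have "inner_ints (l, b, M) \<subset> inner_ints (l, m, r)"
      using c k by (intro inner_ints_psubset[where k=k]) auto
    then show ?thesis using c left_new by simp
  qed
  then show "valley V T'" "card (inner_ints T') < card (inner_ints T)"
    by (auto intro: psubset_card_mono finite_inner_ints)
qed

lemma (in polygon) refine_tranclp_valley:
  assumes "(refine V)\<^sup>+\<^sup>+ T T'" "valley V T"
  shows "valley V T' \<and> card (inner_ints T') < card (inner_ints T)"
  using assms(1)
proof (induction rule: tranclp_induct)
  case (base T')
  then show ?case using refine_valley[OF base assms(2)] by blast
next
  case (step T' T'')
  then show ?case using refine_valley[OF step(2)] by fastforce
qed

text \<open>Minimality refers to iterated refinements, whose intermediate valleys may fail to be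
  deep. Hence the number of inner integers is minimized over all deep valleys around 0 at once,
  instead of following one chain of refinements.\<close>

lemma (in polygon) smallest_valley_exists:
  assumes "deep_valley_around_0 V g T"
  shows "\<exists>T'. smallest_valley V g T'"
proof -
  define T' where "T' = (ARG_MIN (\<lambda>T. card (inner_ints T)) T. deep_valley_around_0 V g T)"
  have T': "deep_valley_around_0 V g T'"
    unfolding T'_def using assms by (rule arg_min_natI[where P="deep_valley_around_0 V g"])
  have "\<not> deep_valley_around_0 V g T''" if "(refine V)\<^sup>+\<^sup>+ T' T''" for T''
  proof
    assume T'': "deep_valley_around_0 V g T''"
    have "valley V T'" using T' by (cases T') auto
    then have "card (inner_ints T'') < card (inner_ints T')"
      using refine_tranclp_valley[OF that] by blast
    then show False
      using arg_min_nat_le[where P="deep_valley_around_0 V g" and m="\<lambda>T. card (inner_ints T)", OF T''] unfolding T'_def by auto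
  qed
  then show ?thesis using T' unfolding smallest_valley_def by blast
qed

text \<open>The left end \<open>l\<close> was cut off a larger valley at a drop of at least \<open>c\<close>.\<close>

definition cut_left :: "(real \<Rightarrow> real) \<Rightarrow> real \<Rightarrow> real \<Rightarrow> bool" where
  "cut_left V c l \<longleftrightarrow> l \<in> \<int> \<and> (\<exists>s\<in>\<int>. s < l \<and> V s \<le> V l - c \<and> (\<forall>t\<in>{s..l}. V t \<le> V l))"

definition cut_right :: "(real \<Rightarrow> real) \<Rightarrow> real \<Rightarrow> real \<Rightarrow> bool" where
  "cut_right V c r \<longleftrightarrow> r \<in> \<int> \<and> (\<exists>s\<in>\<int>. r < s \<and> V s \<le> V r - c \<and> (\<forall>t\<in>{r..s}. V t \<le> V r))"

lemma cut_left_mirror: "cut_left (\<lambda>t. V (- t)) c (- r) \<longleftrightarrow> cut_right V c r"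
proof -
  have "(\<forall>t\<in>{- s..- r}. V (- t) \<le> V r) \<longleftrightarrow> (\<forall>t\<in>{r..s}. V t \<le> V r)" for s
    by (rule ball_uminus_atLeastAtMost)
  moreover have "(\<exists>s\<in>\<int>. P s) \<longleftrightarrow> (\<exists>s\<in>\<int>. P (- s))" for P :: "real \<Rightarrow> bool"
    by (metis Ints_minus minus_minus)
  moreover have "- r \<in> \<int> \<longleftrightarrow> r \<in> \<int>"
    by (metis Ints_minus minus_minus)
  ultimately show ?thesis
    unfolding cut_left_def cut_right_def
    by (subst (1) \<open>\<And>P. (\<exists>s\<in>\<int>. P s) \<longleftrightarrow> (\<exists>s\<in>\<int>. P (- s))\<close>) simp
qed

lemma cut_right_mirror: "cut_right (\<lambda>t. V (- t)) c (- r) \<longleftrightarrow> cut_left V c r"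
  using cut_left_mirror[of "\<lambda>t. V (- t)" c "- r"] by simp

section \<open>Descent to a valley without high couples\<close>

fun valley0 :: "(real \<Rightarrow> real) \<Rightarrow> real \<Rightarrow> triplet \<Rightarrow> bool" where
  "valley0 V c (l, m, r) \<longleftrightarrow> valley V (l, m, r) \<and> l \<le> 0 \<and> 0 \<le> r \<and> V m + c \<le> V l \<and> V m + c \<le> V r"

text \<open>Refinement moves the bottom to the right only by replacing the left end, and conversely.
  So a left end that survives comes with a bottom that has not moved right: if the new bottom is
  positive, so was the old one, and a height known for the old left end is still available.\<close>

fun ends_from :: "(real \<Rightarrow> real) \<Rightarrow> real \<Rightarrow> triplet \<Rightarrow> triplet \<Rightarrow> bool" where
  "ends_from V c (l, m, r) (l', m', r') \<longleftrightarrow>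
     (l' = l \<and> m' \<le> m \<or> cut_left V c l') \<and> (r' = r \<and> m \<le> m' \<or> cut_right V c r')"

definition drop_free :: "(real \<Rightarrow> real) \<Rightarrow> real \<Rightarrow> real \<Rightarrow> real \<Rightarrow> bool" where
  "drop_free V c a b \<longleftrightarrow> (\<forall>s t. a \<le> s \<and> s \<le> t \<and> t \<le> b \<longrightarrow> V s - V t < c)"

definition rise_free :: "(real \<Rightarrow> real) \<Rightarrow> real \<Rightarrow> real \<Rightarrow> real \<Rightarrow> bool" where
  "rise_free V c a b \<longleftrightarrow> (\<forall>s t. a \<le> s \<and> s \<le> t \<and> t \<le> b \<longrightarrow> V t - V s < c)"

lemma drop_free_mirror: "drop_free (\<lambda>t. V (- t)) c (- b) (- a) \<longleftrightarrow> rise_free V c a b"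
  unfolding drop_free_def rise_free_def
proof safe
  fix s t
  assume "\<forall>s t. - b \<le> s \<and> s \<le> t \<and> t \<le> - a \<longrightarrow> V (- s) - V (- t) < c" "a \<le> s" "s \<le> t" "t \<le> b"
  then show "V t - V s < c" by (elim allE[of _ "- t"] allE[of _ "- s"]) auto
next
  fix s t
  assume "\<forall>s t. a \<le> s \<and> s \<le> t \<and> t \<le> b \<longrightarrow> V t - V s < c" "- b \<le> s" "s \<le> t" "t \<le> - a"
  then show "V (- s) - V (- t) < c" by (elim allE[of _ "- t"] allE[of _ "- s"]) auto
qed

lemma valley0_mirror: "valley0 (\<lambda>t. V (- t)) c (mirror T) \<longleftrightarrow> valley0 V c T"
proof (cases T)
  case (fields l m r)
  show ?thesis unfolding fields mirror.simps valley0.simps valley_mirror by auto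
qed

lemma ends_from_mirror: "ends_from (\<lambda>t. V (- t)) c (mirror T) (mirror T') \<longleftrightarrow> ends_from V c T T'"
proof (cases T, cases T')
  fix l m r l' m' r'
  assume "T = (l, m, r)" "T' = (l', m', r')"
  then show ?thesis
    by (simp only: mirror.simps ends_from.simps cut_left_mirror cut_right_mirror) auto
qed

lemma ends_from_trans:
  "ends_from V c T T' \<Longrightarrow> ends_from V c T' T'' \<Longrightarrow> ends_from V c T T''"
  by (cases T; cases T'; cases T'') auto

context polygon
begin

lemma bottom_Ints: "valley0 V c (l, m, r) \<Longrightarrow> 0 < c \<Longrightarrow> m \<in> \<int>"
  by (rule valley_bottom_Ints[of l m r]) auto

text \<open>Of the two pieces the one containing 0 is kept. Its depth stays at least
  \<open>c\<close> because the couple itself has height \<open>c\<close> and both \<open>b\<close>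
  and \<open>M\<close> lie between the levels of \<open>m\<close> and \<open>r\<close>. The
  discarded piece supplies the witness of the cut: its bottom \<open>b\<close> on the right, or the
  old bottom \<open>m\<close> on the left.\<close>

lemma right_step:
  assumes T: "valley0 V c (l, m, r)" and c: "0 < c" and drop: "\<not> drop_free V c m r"
  shows "\<exists>T'. refine V (l, m, r) T' \<and> valley0 V c T' \<and> ends_from V c (l, m, r) T'"
proof -
  obtain s t where st: "m \<le> s" "s \<le> t" "t \<le> r" "c \<le> V s - V t"
    using drop unfolding drop_free_def by (auto simp: not_less)
  obtain M b where couple: "right_couple V m r M b"
    by (rule right_couple_exists[OF continuous st(1-3)]) (use st c in auto)
  have v: "valley V (l, m, r)" using T by simp
  note C = right_coupleD[OF couple] right_cut[OF v couple]
  have big: "c \<le> V M - V b" using C(9)[OF st(1-3)] st by linarith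
  then have deep: "V m + c \<le> V M" "V b + c \<le> V M" "V b + c \<le> V r" using C(14,15) by linarith+
  show ?thesis
  proof (cases "0 \<le> M")
    case True
    have T': "valley0 V c (l, m, M)" using T C(12) deep True by simp
    have "b \<in> \<int>"
      by (rule valley_bottom_Ints[OF C(13)]) (use deep c in linarith)+
    then have "cut_right V c M" unfolding cut_right_def using C(1,2,5,10,11) deep
      by (auto intro!: bexI[of _ b])
    then show ?thesis using T' refine.right_old[OF couple, of l] by auto
  next
    case False
    have T': "valley0 V c (M, b, r)" using T C(13) deep False by simp
    have "cut_left V c M" unfolding cut_left_def using C(2,5,10,11) deep bottom_Ints[OF T c]
      by (auto intro!: bexI[of _ m])
    moreover have "m \<le> b" using C(1,2) by linarith
    ultimately show ?thesis using T' refine.right_new[OF couple, of l] by auto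
  qed
qed

end

lemma (in polygon) left_step:
  assumes T: "valley0 V c (l, m, r)" and c: "0 < c" and rise: "\<not> rise_free V c l m"
  shows "\<exists>T'. refine V (l, m, r) T' \<and> valley0 V c T' \<and> ends_from V c (l, m, r) T'"
proof -
  interpret m: polygon "\<lambda>t. V (- t)" by (rule polygon_mirror)
  have "valley0 (\<lambda>t. V (- t)) c (- r, - m, - l)"
    using valley0_mirror[of V c "(l, m, r)"] T by simp
  then obtain T' where T': "refine (\<lambda>t. V (- t)) (- r, - m, - l) T'"
    "valley0 (\<lambda>t. V (- t)) c T'" "ends_from (\<lambda>t. V (- t)) c (- r, - m, - l) T'"
    using m.right_step[OF _ c] rise by (metis drop_free_mirror)
  show ?thesis
  proof (intro exI conjI)
    show "refine V (l, m, r) (mirror T')" using refine_mirror[OF T'(1)] by simp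
    show "valley0 V c (mirror T')" using T'(2) valley0_mirror[of V c "mirror T'"] by simp
    show "ends_from V c (l, m, r) (mirror T')"
      using T'(3) ends_from_mirror[of V c "(l, m, r)" "mirror T'"] by simp
  qed
qed

text \<open>Refining only at couples of height at least \<open>c\<close> never spoils the depth.\<close>

lemma (in polygon) descent:
  assumes "valley0 V c T" "0 < c"
  obtains l m r where "(refine V)\<^sup>*\<^sup>* T (l, m, r)" "valley0 V c (l, m, r)"
    "ends_from V c T (l, m, r)" "rise_free V c l m" "drop_free V c m r"
proof -
  have "\<exists>l m r. (refine V)\<^sup>*\<^sup>* T (l, m, r) \<and> valley0 V c (l, m, r) \<and>
    ends_from V c T (l, m, r) \<and> rise_free V c l m \<and> drop_free V c m r"
    using assms(1)
  proof (induction "card (inner_ints T)" arbitrary: T rule: less_induct)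
    case less
    obtain l m r where T: "T = (l, m, r)" by (cases T)
    show ?case
    proof (cases "rise_free V c l m \<and> drop_free V c m r")
      case True
      then show ?thesis using less.prems T by (intro exI[of _ l] exI[of _ m] exI[of _ r]) auto
    next
      case False
      then obtain T' where T': "refine V T T'" "valley0 V c T'" "ends_from V c T T'"
        using left_step right_step less.prems assms(2) unfolding T by metis
      have "valley V T" using less.prems unfolding T by simp
      then have "card (inner_ints T') < card (inner_ints T)" using refine_valley T' by blast
      from less.hyps[OF this T'(2)] obtain l' m' r' where *: "(refine V)\<^sup>*\<^sup>* T' (l', m', r')"
        "valley0 V c (l', m', r')" "ends_from V c T' (l', m', r')"
        "rise_free V c l' m'" "drop_free V c m' r'" by blast
      show ?thesis
        using * T' ends_from_trans[OF T'(3) *(3)] by (metis converse_rtranclp_into_rtranclp)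
    qed
  qed
  then show ?thesis using that by blast
qed

section \<open>Condition (3) in pointwise form\<close>

lemma le_diff_Sup_iff:
  fixes f :: "real \<Rightarrow> real"
  assumes "a \<le> b" "\<And>t. t \<in> {a..b} \<Longrightarrow> f t \<le> B"
  shows "g \<le> x - (SUP t\<in>{a..b}. f t) \<longleftrightarrow> (\<forall>t\<in>{a..b}. f t + g \<le> x)"
proof -
  have "(SUP t\<in>{a..b}. f t) \<le> x - g \<longleftrightarrow> (\<forall>t\<in>{a..b}. f t \<le> x - g)"
    using assms by (intro cSUP_le_iff bdd_aboveI2[where M=B]) auto
  then show ?thesis by (auto simp: algebra_simps)
qed

lemma deep_valley_around_0_iff:
  "deep_valley_around_0 V g (l, m, r) \<longleftrightarrow> valley0 V (1 + g) (l, m, r) \<and>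
     (m < 0 \<longrightarrow> (\<forall>t\<in>{m..0}. V t + g \<le> V r)) \<and> (m > 0 \<longrightarrow> (\<forall>t\<in>{0..m}. V t + g \<le> V l))"
proof (cases "valley V (l, m, r) \<and> l \<le> 0 \<and> 0 \<le> r")
  case True
  have "g \<le> V r - (SUP t\<in>{m..0}. V t) \<longleftrightarrow> (\<forall>t\<in>{m..0}. V t + g \<le> V r)" if "m < 0"
    by (rule le_diff_Sup_iff[where B="V r"]) (use True that in auto)
  moreover have "g \<le> V l - (SUP t\<in>{0..m}. V t) \<longleftrightarrow> (\<forall>t\<in>{0..m}. V t + g \<le> V l)" if "m > 0"
    by (rule le_diff_Sup_iff[where B="V l"]) (use True that in auto)
  ultimately show ?thesis using True by auto
qed auto

lemma deep_valley_around_0_mirror: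
  "deep_valley_around_0 (\<lambda>t. V (- t)) g (mirror T) \<longleftrightarrow> deep_valley_around_0 V g T"
proof (cases T)
  case (fields l m r)
  have 1: "(\<forall>t\<in>{- m..0}. V (- t) + g \<le> V l) \<longleftrightarrow> (\<forall>t\<in>{0..m}. V t + g \<le> V l)"
    using ball_uminus_atLeastAtMost[of m 0 "\<lambda>t. V t + g \<le> V l"] by simp
  have 2: "(\<forall>t\<in>{0..- m}. V (- t) + g \<le> V r) \<longleftrightarrow> (\<forall>t\<in>{m..0}. V t + g \<le> V r)"
    using ball_uminus_atLeastAtMost[of 0 m "\<lambda>t. V t + g \<le> V r"] by simp
  show ?thesis
    using valley0_mirror[of V "1 + g" T] 1 2
    unfolding fields mirror.simps deep_valley_around_0_iff by auto
qed

lemma smallest_valley_mirror: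
  assumes "smallest_valley V g T"
  shows "smallest_valley (\<lambda>t. V (- t)) g (mirror T)"
  unfolding smallest_valley_def
proof (intro conjI allI impI notI)
  show "deep_valley_around_0 (\<lambda>t. V (- t)) g (mirror T)"
    using assms deep_valley_around_0_mirror unfolding smallest_valley_def by blast
  fix T' assume T': "(refine (\<lambda>t. V (- t)))\<^sup>+\<^sup>+ (mirror T) T'" "deep_valley_around_0 (\<lambda>t. V (- t)) g T'"
  have "(refine V)\<^sup>+\<^sup>+ T (mirror T')"
  proof -
    obtain T1 where T1: "refine (\<lambda>t. V (- t)) (mirror T) T1" "(refine (\<lambda>t. V (- t)))\<^sup>*\<^sup>* T1 T'"
      using tranclpD[OF T'(1)] by blast
    show ?thesis
      using refine_mirror[OF T1(1)] refine_rtranclp_mirror[OF T1(2)]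
      by (auto intro: rtranclp_into_tranclp2)
  qed
  moreover have "deep_valley_around_0 V g (mirror T')"
    using T'(2) deep_valley_around_0_mirror[of V g "mirror T'"] by simp
  ultimately show False using assms unfolding smallest_valley_def by blast
qed

section \<open>Valleys of a good potential\<close>

text \<open>A fall from a record: the bound \<open>h + u\<close> from time 0 on places the maximum
  before the fall between \<open>h\<close> and \<open>h + u\<close>, with \<open>h\<close>
  deterministic, so that the event is accessible to optional stopping.\<close>

definition plunges :: "(nat \<Rightarrow> real) \<Rightarrow> nat \<Rightarrow> real \<Rightarrow> real \<Rightarrow> real \<Rightarrow> bool" where
  "plunges f T h u d \<longleftrightarrow> (\<exists>i k. i < k \<and> k \<le> T \<and> h \<le> f i \<and> f k \<le> h - d \<and> (\<forall>t\<le>k. f t < h + u))"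

lemma left_tops_mirror: "k \<in> left_tops (\<lambda>t. V (- t)) g (- m) \<longleftrightarrow> - k \<in> right_tops V g m"
proof -
  have "uminus ` {0..- m} = {m..0}" by simp
  then have "(\<lambda>k. V (of_int k)) ` uminus ` {0..- m} = (\<lambda>k. V (of_int k)) ` {m..0}" by (simp only:)
  then have "(\<lambda>k::int. V (- of_int k)) ` {0..- m} = (\<lambda>k. V (of_int k)) ` {m..0}"
    by (simp only: image_image of_int_minus)
  then show ?thesis unfolding left_tops_def right_tops_def by auto
qed

lemma right_tops_mirror: "k \<in> right_tops (\<lambda>t. V (- t)) g (- m) \<longleftrightarrow> - k \<in> left_tops V g m"
  using left_tops_mirror[of "- k" "\<lambda>t. V (- t)" g "- m"] by simp

text \<open>No level \<open>j \<eta>\<close> is nearly the highest one reached on both sides of 0 before a deep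
  fall, which excludes a tie up to \<open>g\<close> between the two sides.\<close>

locale good_potential = polygon V for V +
  fixes g \<eta> :: real and T :: nat
  assumes V0: "V 0 = 0" and g: "0 < g" "g \<le> \<eta>"
    and reach_right: "\<exists>k\<le>T. 1 + 2 * g \<le> V (real k)"
    and reach_left: "\<exists>k\<le>T. 1 + 2 * g \<le> V (- real k)"
    and no_tie: "\<And>j::nat. real j * \<eta> \<le> 1 + g \<Longrightarrow>
      \<not> (plunges (\<lambda>k. V (real k)) T (real j * \<eta>) (2 * \<eta>) (1 - \<eta>) \<and>
         plunges (\<lambda>k. V (- real k)) T (real j * \<eta>) (2 * \<eta>) (1 - \<eta>))"
begin

lemma good_potential_mirror: "good_potential (\<lambda>t. V (- t)) g \<eta> T"
proof -
  interpret m: polygon "\<lambda>t. V (- t)" by (rule polygon_mirror)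
  show ?thesis
    by unfold_locales (use V0 g reach_right reach_left no_tie in auto)
qed

lemma bottom_nonpos:
  assumes "valley0 V c (l, m, r)"
  shows "V m \<le> 0"
proof -
  have "V m \<le> V 0" using assms by simp
  then show ?thesis by (simp only: V0)
qed

text \<open>Let \<open>w\<close> be the highest integer point of \<open>{0..m}\<close>. Since
  nothing to the left of \<open>m\<close> rises by \<open>1 + g\<close>, its level is below
  \<open>1 + g\<close>. If the claim failed, \<open>V l\<close> would exceed \<open>V w\<close> by
  less than \<open>g\<close>; then \<open>l\<close> is not an original end, so a cut left a fall of
  \<open>1 + g\<close> beyond \<open>l\<close>, while the right half falls from \<open>w\<close> to
  \<open>m\<close> by more than 1. Both halves thus plunge from the same grid level.\<close>

lemma left_top_high:
  assumes v: "valley0 V (1 + g) (l, m, r)" and rf: "rise_free V (1 + g) l m" and m: "0 < m"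
    and l: "1 + 2 * g \<le> V l \<or> cut_left V (1 + g) l"
    and t: "0 \<le> t" "t \<le> m"
  shows "V t + g \<le> V l"
proof (rule ccontr)
  assume neg: "\<not> V t + g \<le> V l"
  have "m \<in> \<int>" using bottom_Ints[OF v] g by simp
  then obtain m' where m': "m = of_int m'" by (rule Ints_cases)
  define n where "n = nat m'"
  have n: "m = real n" "n > 0" using m' m by (auto simp: n_def)
  obtain k0 where k0: "k0 \<le> T" "1 + 2 * g \<le> V (real k0)" using reach_right by blast
  define y where "y = (LEAST k::nat. 1 + g \<le> V (real k))"
  have y: "1 + g \<le> V (real y)" unfolding y_def
    by (rule LeastI[of "\<lambda>k. 1 + g \<le> V (real k)" k0]) (use k0 g in linarith)
  have yT: "y \<le> T"
    using Least_le[of "\<lambda>k. 1 + g \<le> V (real k)" k0] k0 g unfolding y_def by linarith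
  have "n < y"
  proof (rule ccontr)
    assume "\<not> n < y"
    then show False
      using rf[unfolded rise_free_def, rule_format, of 0 "real y"] y V0 n v by auto
  qed
  then have low: "V (real i) < 1 + g" if "i \<le> n" for i
    using that not_less_Least[of i "\<lambda>k. 1 + g \<le> V (real k)"] unfolding y_def by auto
  have "finite ((\<lambda>i. V (real i)) ` {..n})" "(\<lambda>i. V (real i)) ` {..n} \<noteq> {}" by auto
  then have "Max ((\<lambda>i. V (real i)) ` {..n}) \<in> (\<lambda>i. V (real i)) ` {..n}" by (rule Max_in)
  then obtain w where w: "w \<le> n" "V (real w) = Max ((\<lambda>i. V (real i)) ` {..n})"
    by (metis (mono_tags, lifting) atMost_iff imageE)
  have wi: "V (real i) \<le> V (real w)" if "i \<le> n" for i
    unfolding w(2) using that by (intro Max_ge) auto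
  have wt: "V t \<le> V (real w)" if "0 \<le> t" "t \<le> real n" for t
  proof (rule le_int_bound[of 0 "int n"])
    fix k :: int assume "0 \<le> k" "k \<le> int n"
    then show "V (of_int k) \<le> V (real w)" using wi[of "nat k"] by auto
  qed (use that in auto)
  have tie: "V l < V (real w) + g" using neg wt[of t] t n by auto
  have "\<not> 1 + 2 * g \<le> V l" using tie low[OF w(1)] by auto
  then obtain s where s: "s \<in> \<int>" "l \<in> \<int>" "s < l" "V s \<le> V l - (1 + g)" "\<And>t. s \<le> t \<Longrightarrow> t \<le> l \<Longrightarrow> V t \<le> V l"
    using l unfolding cut_left_def by auto
  have l0: "l \<le> 0" "V (real n) + (1 + g) \<le> V l" "\<And>t. l \<le> t \<Longrightarrow> t \<le> m \<Longrightarrow> V t \<le> V l"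
    using v n by auto
  have sl: "V t \<le> V l" if "s \<le> t" "t \<le> 0" for t
    using s(5)[of t] l0(3)[of t] that m by (cases "t \<le> l") auto
  have w0: "0 \<le> V (real w)" using wi[of 0] V0 by simp
  have \<eta>: "0 < \<eta>" using g by simp
  \<comment> \<open>Round \<open>V w\<close> down to the grid. Both tops lie below
    \<open>j * \<eta> + \<eta> + g\<close>, hence the two meshes of tolerance, and both falls end
    below \<open>V w - 1 < j * \<eta> - (1 - \<eta>)\<close>.\<close>
  define j where "j = nat \<lfloor>V (real w) / \<eta>\<rfloor>"
  have "real j = of_int \<lfloor>V (real w) / \<eta>\<rfloor>" using w0 \<eta> by (simp add: j_def)
  then have "real j \<le> V (real w) / \<eta>" "V (real w) / \<eta> < real j + 1" by linarith+
  then have j: "real j * \<eta> \<le> V (real w)" "V (real w) < real j * \<eta> + \<eta>"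
    using \<eta> by (simp_all add: field_simps)
  have wn: "w < n" using w l0(2) tie g by (cases "w = n") auto
  have right: "plunges (\<lambda>k. V (real k)) T (real j * \<eta>) (2 * \<eta>) (1 - \<eta>)"
    unfolding plunges_def
  proof (intro exI conjI allI impI)
    show "w < n" by fact
    show "n \<le> T" using \<open>n < y\<close> yT by simp
    show "real j * \<eta> \<le> V (real w)" by fact
    show "V (real n) \<le> real j * \<eta> - (1 - \<eta>)" using l0(2) tie j by linarith
    show "V (real t) < real j * \<eta> + 2 * \<eta>" if "t \<le> n" for t
      using wi[OF that] j \<eta> by linarith
  qed
  obtain s' l' where sl': "s = of_int s'" "l = of_int l'" using s(1,2) by (auto elim!: Ints_cases)
  have neg: "- real (nat (- s')) = s" "- real (nat (- l')) = l" using sl' l0(1) s(3) by auto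
  have left: "plunges (\<lambda>k. V (- real k)) T (real j * \<eta>) (2 * \<eta>) (1 - \<eta>)"
    unfolding plunges_def
  proof (intro exI conjI allI impI)
    show "nat (- l') < nat (- s')" using s(3) l0(1) sl' by auto
    \<comment> \<open>The left half attains \<open>1 + 2 * g\<close> by time \<open>T\<close>, but
      stays at most \<open>V l\<close> between \<open>s\<close> and 0; so the fall to
      \<open>s\<close> comes before that time.\<close>
    obtain k where k: "k \<le> T" "1 + 2 * g \<le> V (- real k)" using reach_left by blast
    have "\<not> s \<le> - real k" using sl[of "- real k"] k tie low[OF w(1)] by auto
    then have "nat (- s') < k" using sl' neg by linarith
    then show "nat (- s') \<le> T" using k by simp
    show "real j * \<eta> \<le> V (- real (nat (- l')))"
      unfolding neg using j(1) l0(3)[of "real w"] l0(1) n w(1) by linarith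
    show "V (- real (nat (- s'))) \<le> real j * \<eta> - (1 - \<eta>)"
      unfolding neg using s(4) tie j by linarith
    show "V (- real t) < real j * \<eta> + 2 * \<eta>" if "t \<le> nat (- s')" for t
    proof -
      have "s \<le> - real t" using that sl' neg by linarith
      then show ?thesis using sl[of "- real t"] tie j g by simp
    qed
  qed
  have "real j * \<eta> \<le> 1 + g" using j(1) low[OF w(1)] by simp
  then show False using no_tie right left by blast
qed

end

declare valley.simps [simp del] valley0.simps [simp del] deep_valley_around_0.simps [simp del]

context good_potential
begin

lemma right_top_high:
  assumes v: "valley0 V (1 + g) (l, m, r)" and rf: "drop_free V (1 + g) m r" and m: "m < 0"
    and r: "1 + 2 * g \<le> V r \<or> cut_right V (1 + g) r"
    and t: "m \<le> t" "t \<le> 0"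
  shows "V t + g \<le> V r"
proof -
  interpret m: good_potential "\<lambda>t. V (- t)" by (rule good_potential_mirror)
  have "V (- (- t)) + g \<le> V (- (- r))"
  proof (rule m.left_top_high)
    show "valley0 (\<lambda>t. V (- t)) (1 + g) (- r, - m, - l)"
      using v valley0_mirror[of V "1 + g" "(l, m, r)"] by simp
    show "rise_free (\<lambda>t. V (- t)) (1 + g) (- r) (- m)"
      using rf drop_free_mirror[of "\<lambda>t. V (- t)" "1 + g" "- m" "- r"] by simp
    show "1 + 2 * g \<le> V (- (- r)) \<or> cut_left (\<lambda>t. V (- t)) (1 + g) (- r)"
      using r cut_left_mirror by simp
  qed (use m t in auto)
  then show ?thesis by simp
qed

text \<open>Only the end opposite to 0 as seen from the bottom matters for condition (3). By
  \<open>ends_from\<close> it is either an original end of height \<open>1 + 2 * g\<close> or a cut,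
  and both cases are covered by the two preceding lemmas.\<close>

lemma descent_deep:
  assumes v: "valley0 V (1 + g) (l0, m0, r0)"
    and l0: "0 < m0 \<Longrightarrow> 1 + 2 * g \<le> V l0" and r0: "m0 < 0 \<Longrightarrow> 1 + 2 * g \<le> V r0"
  obtains l m r where "(refine V)\<^sup>*\<^sup>* (l0, m0, r0) (l, m, r)" "deep_valley_around_0 V g (l, m, r)"
    "rise_free V (1 + g) l m" "drop_free V (1 + g) m r"
proof -
  obtain l m r where *: "(refine V)\<^sup>*\<^sup>* (l0, m0, r0) (l, m, r)" "valley0 V (1 + g) (l, m, r)"
    "ends_from V (1 + g) (l0, m0, r0) (l, m, r)" "rise_free V (1 + g) l m" "drop_free V (1 + g) m r"
    using descent[OF v] g by auto
  have "V t + g \<le> V l" if "0 < m" "t \<in> {0..m}" for t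
    using left_top_high[OF *(2,4) that(1), of t] *(3) l0 that by auto
  moreover have "V t + g \<le> V r" if "m < 0" "t \<in> {m..0}" for t
    using right_top_high[OF *(2,5) that(1), of t] *(3) r0 that by auto
  ultimately have "deep_valley_around_0 V g (l, m, r)"
    using *(2) unfolding deep_valley_around_0_iff by blast
  then show ?thesis using that * by blast
qed

text \<open>The descent starts from the valley whose ends are the first points of height
  \<open>1 + 2 * g\<close> on either side of 0; being first, they dominate everything between
  them.\<close>

lemma basic_bottom_exists: "\<exists>l m r. smallest_valley V g (l, of_int m, r)"
proof -
  define kr where "kr = (LEAST k::nat. 1 + 2 * g \<le> V (real k))"
  define kl where "kl = (LEAST k::nat. 1 + 2 * g \<le> V (- real k))"
  have kr: "1 + 2 * g \<le> V (real kr)" unfolding kr_def using reach_right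
    by (blast intro: LeastI_ex[of "\<lambda>k. 1 + 2 * g \<le> V (real k)"])
  have kl: "1 + 2 * g \<le> V (- real kl)" unfolding kl_def using reach_left
    by (blast intro: LeastI_ex[of "\<lambda>k. 1 + 2 * g \<le> V (- real k)"])
  have krl: "V (real k) < 1 + 2 * g" if "k < kr" for k
    using not_less_Least[of k "\<lambda>k. 1 + 2 * g \<le> V (real k)"] that unfolding kr_def by auto
  have kll: "V (- real k) < 1 + 2 * g" if "k < kl" for k
    using not_less_Least[of k "\<lambda>k. 1 + 2 * g \<le> V (- real k)"] that unfolding kl_def by auto
  define K where "K = {- real kl..real kr}"
  have "compact K" "0 \<in> K" by (auto simp: K_def)
  then obtain z where z: "z \<in> K" "\<And>t. t \<in> K \<Longrightarrow> V z \<le> V t"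
    using continuous_attains_inf[of K V] continuous_on_subset[OF continuous] by blast
  have "compact (K \<inter> {t. V t = V z})"
    by (intro compact_Int_closed \<open>compact K\<close> closed_Collect_eq continuous continuous_intros)
  then obtain m where m: "m \<in> K" "V m = V z" "\<And>t. t \<in> K \<Longrightarrow> V t = V z \<Longrightarrow> \<bar>m\<bar> \<le> \<bar>t\<bar>"
    using continuous_attains_inf[of "K \<inter> {t. V t = V z}" "\<lambda>t. \<bar>t\<bar>"] z(1)
      continuous_on_rabs[OF continuous_on_id] by blast
  have mt: "V m \<le> V t" if "t \<in> K" for t using z m that by simp
  then have m0: "V m \<le> 0" using mt[OF \<open>0 \<in> K\<close>] V0 by simp
  then have "m \<noteq> - real kl" "m \<noteq> real kr" using kl kr g by auto
  then have mk: "- real kl < m" "m < real kr" using m(1) by (auto simp: K_def)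
  have "m \<in> \<int>"
    by (rule closest_extremum_Ints[OF mk]) (use mt m in \<open>auto simp: K_def\<close>)
  then obtain m' where m': "m = of_int m'" by (rule Ints_cases)
  have low: "V (of_int i) < 1 + 2 * g" if "- int kl < i" "i < int kr" for i
    using krl[of "nat i"] kll[of "nat (- i)"] that by (cases "i \<ge> 0") auto
  have left: "V t \<le> V (- real kl)" if "- real kl \<le> t" "t \<le> m" for t
  proof (rule le_int_bound[of "- int kl" m'])
    fix k assume "- int kl \<le> k" "k \<le> m'"
    then show "V (of_int k) \<le> V (- real kl)"
      using low[of k] kl mk m' by (cases "k = - int kl") auto
  qed (use that m' in auto)
  have right: "V t \<le> V (real kr)" if "m \<le> t" "t \<le> real kr" for t
  proof (rule le_int_bound[of m' "int kr"])
    fix k assume "m' \<le> k" "k \<le> int kr"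
    then show "V (of_int k) \<le> V (real kr)"
      using low[of k] kr mk m' by (cases "k = int kr") auto
  qed (use that m' in auto)
  have "valley V (- real kl, m, real kr)"
    using left right mk mt m unfolding K_def valley.simps by auto
  then have "valley0 V (1 + g) (- real kl, m, real kr)"
    using m0 kl kr g by (auto simp: valley0.simps)
  then obtain T' where "deep_valley_around_0 V g T'"
    using descent_deep kl kr by blast
  then obtain T where T: "smallest_valley V g T" using smallest_valley_exists by blast
  obtain l b r where lbr: "T = (l, b, r)" by (cases T)
  have "valley0 V (1 + g) (l, b, r)"
    using T deep_valley_around_0_iff unfolding smallest_valley_def lbr by blast
  then have "b \<in> \<int>" using bottom_Ints g by simp
  then show ?thesis using T unfolding lbr by (auto elim!: Ints_cases)
qed

text \<open>If \<open>k\<close> were at most \<open>m\<close>, condition (3) would raise the left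
  end to \<open>1 + 2 * g\<close>, so the descent could start from this valley. The rise from 0 to
  \<open>k\<close> lies inside \<open>{l..m}\<close>, hence the descent makes at least one step and
  ends in a deep proper refinement, against minimality.\<close>

lemma smallest_valley_bottom_less:
  assumes T: "smallest_valley V g (l, m, r)" and k: "1 + g \<le> V (real k)"
  shows "m < real k"
proof (rule ccontr)
  assume neg: "\<not> m < real k"
  have "k \<noteq> 0" using k V0 g by (intro notI) simp
  then have m: "0 < m" using neg by auto
  have d: "deep_valley_around_0 V g (l, m, r)" using T unfolding smallest_valley_def by blast
  then have v: "valley0 V (1 + g) (l, m, r)" and "V (real k) + g \<le> V l"
    using m neg unfolding deep_valley_around_0_iff by auto
  then have "1 + 2 * g \<le> V l" using k by simp
  then obtain l' m' r' where T': "(refine V)\<^sup>*\<^sup>* (l, m, r) (l', m', r')"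
      "deep_valley_around_0 V g (l', m', r')" "rise_free V (1 + g) l' m'"
    using descent_deep[OF v] m by (metis less_asym)
  have "\<not> rise_free V (1 + g) l m"
  proof
    assume "rise_free V (1 + g) l m"
    moreover have "l \<le> 0" using v by (simp add: valley0.simps)
    ultimately have "V (real k) - V 0 < 1 + g"
      using neg unfolding rise_free_def by simp
    then show False using k V0 by simp
  qed
  then have "(refine V)\<^sup>+\<^sup>+ (l, m, r) (l', m', r')"
    using T'(1,3) by (metis old.prod.inject rtranclpD)
  then show False using T T'(2) unfolding smallest_valley_def by blast
qed

text \<open>The bottom precedes the first point \<open>y\<close> of height \<open>1 + g\<close>, so
  the potential is below \<open>1 + g\<close> on \<open>{0..m}\<close>. Therefore \<open>y\<close>
  itself is a right top, and any point of height \<open>1 + 2 * g\<close> on the negative side is a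
  left top.\<close>

lemma tops_bounded_of_nonneg:
  assumes T: "smallest_valley V g (l, of_int m, r)" and m: "0 \<le> m"
  shows "m \<le> int T" "\<exists>x\<in>left_tops V g m. - int T \<le> x" "\<exists>y\<in>right_tops V g m. y \<le> int T"
proof -
  define y where "y = (LEAST k::nat. 1 + g \<le> V (real k))"
  obtain k0 where k0: "k0 \<le> T" "1 + 2 * g \<le> V (real k0)" using reach_right by blast
  have y: "1 + g \<le> V (real y)" unfolding y_def
    by (rule LeastI[of "\<lambda>k. 1 + g \<le> V (real k)" k0]) (use k0 g in linarith)
  have yT: "y \<le> T"
    using Least_le[of "\<lambda>k. 1 + g \<le> V (real k)" k0] k0 g unfolding y_def by linarith
  have my: "m < int y" using smallest_valley_bottom_less[OF T y] by simp
  then show "m \<le> int T" using yT by simp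
  have "valley0 V (1 + g) (l, of_int m, r)"
    using T deep_valley_around_0_iff unfolding smallest_valley_def by blast
  then have m0: "V (of_int m) \<le> 0" by (rule bottom_nonpos)
  have "int y \<in> right_tops V g m"
    unfolding right_tops_def using my m y m0 by auto
  then show "\<exists>y\<in>right_tops V g m. y \<le> int T"
    by (rule rev_bexI) (simp add: yT)
  obtain k where k: "k \<le> T" "1 + 2 * g \<le> V (- real k)" using reach_left by blast
  have "k \<noteq> 0" using k V0 g by (intro notI) simp
  have "(MAX k\<in>{0..m}. V (of_int k)) \<le> V (- real k) - g"
  proof (rule Max.boundedI)
    fix a assume "a \<in> (\<lambda>k. V (of_int k)) ` {0..m}"
    then obtain i where i: "0 \<le> i" "i \<le> m" "a = V (of_int i)" by auto
    then have "nat i < y" using my by linarith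
    then have "V (real (nat i)) < 1 + g"
      using not_less_Least[of "nat i" "\<lambda>k. 1 + g \<le> V (real k)"] unfolding y_def by simp
    then show "a \<le> V (- real k) - g" using i k by simp
  qed (use m in auto)
  then have "g \<le> V (of_int (- int k)) - (MAX k\<in>{0..m}. V (of_int k))"
    by (simp del: Max_le_iff)
  moreover have "1 + g \<le> V (of_int (- int k)) - V (of_int m)" "- int k \<le> 0" "- int k < m"
    using k m0 m g \<open>k \<noteq> 0\<close> by auto
  ultimately have "- int k \<in> left_tops V g m"
    unfolding left_tops_def by blast
  then show "\<exists>x\<in>left_tops V g m. - int T \<le> x"
    by (rule rev_bexI) (simp add: k)
qed

end

context good_potential
begin

lemma tops_bounded:
  assumes T: "smallest_valley V g (l, of_int m, r)"
  shows "\<bar>m\<bar> \<le> int T" "\<exists>x\<in>left_tops V g m. - int T \<le> x" "\<exists>y\<in>right_tops V g m. y \<le> int T"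
proof -
  interpret m: good_potential "\<lambda>t. V (- t)" by (rule good_potential_mirror)
  have "smallest_valley (\<lambda>t. V (- t)) g (- r, of_int (- m), - l)"
    using smallest_valley_mirror[OF T] by simp
  note * = m.tops_bounded_of_nonneg[OF this]
  show "\<bar>m\<bar> \<le> int T" using tops_bounded_of_nonneg(1)[OF T] *(1) by linarith
  show "\<exists>x\<in>left_tops V g m. - int T \<le> x"
  proof (cases "0 \<le> m")
    case False
    then obtain y where "y \<in> right_tops (\<lambda>t. V (- t)) g (- m)" "y \<le> int T" using *(3) by auto
    then show ?thesis unfolding right_tops_mirror by (intro bexI[of _ "- y"]) auto
  qed (use tops_bounded_of_nonneg(2)[OF T] in blast)
  show "\<exists>y\<in>right_tops V g m. y \<le> int T"
  proof (cases "0 \<le> m")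
    case False
    then obtain y where "y \<in> left_tops (\<lambda>t. V (- t)) g (- m)" "- int T \<le> y" using *(2) by auto
    then show ?thesis unfolding left_tops_mirror by (intro bexI[of _ "- y"]) auto
  qed (use tops_bounded_of_nonneg(3)[OF T] in blast)
qed

end

section \<open>Exit probabilities of the walk\<close>

lemma sets_walk_law: "sets (walk_law a x) = sets (PiM UNIV (\<lambda>_. count_space UNIV))"
  by (rule walk.PF.sets_lim)

lemma measurable_walk_law [measurable]: "(\<lambda>X. X k) \<in> walk_law a x \<rightarrow>\<^sub>M count_space UNIV"
  unfolding measurable_cong_sets[OF sets_walk_law refl]
  by (rule measurable_component_singleton) simp

lemma space_walk_law: "space (walk_law a x) = UNIV"
  using sets_eq_imp_space_eq[OF sets_walk_law] by (simp add: space_PiM)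

lemma prob_space_walk_law: "prob_space (walk_law a x)"
proof
  have "emeasure (walk_law a x) (walk.PF.emb UNIV {} (space (PiM {} (\<lambda>_. count_space UNIV)))) =
      emeasure (walk.CI a x {}) (space (PiM {} (\<lambda>_. count_space UNIV)))"
    by (rule walk.lim) auto
  moreover have "emeasure (walk.CI a x {}) (space (PiM {} (\<lambda>_. count_space UNIV))) = 1"
    using prob_space.emeasure_space_1[OF walk.PF.prob_space_P[of "{}" a x]]
      sets_eq_imp_space_eq[OF walk.PF.sets_P[of "{}" a x]] by simp
  moreover have "(\<lambda>X. restrict X {}) -` {\<lambda>_. undefined} = (UNIV :: (nat \<Rightarrow> int) set)"
    by (auto simp: restrict_def)
  ultimately show "emeasure (walk_law a x) (space (walk_law a x)) = 1"
    by (simp add: space_walk_law prod_emb_def space_PiM)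
qed

lemma sets_exit: "(\<Union>k\<in>{0..n}. {X. X k \<notin> B}) \<in> sets (walk_law a x)"
proof -
  have "{X \<in> space (walk_law a x). \<exists>k\<in>{0..n}. X k \<notin> B} \<in> sets (walk_law a x)" by measurable
  then show ?thesis by (simp only: space_walk_law UNIV_I simp_thms Collect_bex_eq)
qed

section \<open>The walk killed outside a finite set\<close>

context
  fixes a :: "int \<Rightarrow> real" and x0 :: int and B :: "int set"
  assumes B: "finite B"
begin

interpretation prob_space "walk_law a x0" by (rule prob_space_walk_law)

definition killed :: "nat \<Rightarrow> int \<Rightarrow> real" where
  "killed k x = prob {X. (\<forall>i\<le>k. X i \<in> B) \<and> X k = x}"

lemma prob_path:
  "prob {X. \<forall>i\<le>k. X i = p i} = (if p 0 = x0 then \<Prod>i<k. pmf (jump a (p i)) (p (Suc i)) else 0)"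
  unfolding measure_def walk_law_path by (simp add: prod_nonneg)

lemma prob_path_Suc:
  "prob {X. (\<forall>i\<le>k. X i = p i) \<and> X (Suc k) = y} = prob {X. \<forall>i\<le>k. X i = p i} * pmf (jump a (p k)) y"
proof -
  define q where "q = p(Suc k := y)"
  have "{X. (\<forall>i\<le>k. X i = p i) \<and> X (Suc k) = y} = {X. \<forall>i\<le>Suc k. X i = q i}"
    by (auto simp: q_def le_Suc_eq)
  moreover have "{X. \<forall>i\<le>k. X i = p i} = {X. \<forall>i\<le>k. X i = q i}"
    by (auto simp: q_def)
  moreover have "pmf (jump a (q k)) (q (Suc k)) = pmf (jump a (p k)) y"
    by (simp add: q_def)
  ultimately show ?thesis by (simp only: prob_path) simp
qed

text \<open>The Markov property at time \<open>k\<close> for the killed walk: as \<open>B\<close> is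
  finite, the event splits into finitely many paths inside \<open>B\<close>, and each path
  probability is the product from \<open>walk_law_path\<close>.\<close>

lemma killed_step:
  "prob {X. (\<forall>i\<le>k. X i \<in> B) \<and> X k = x \<and> X (Suc k) = y} = killed k x * pmf (jump a x) y"
proof -
  define P where "P = {p \<in> PiE {..k} (\<lambda>_. B). p k = x}"
  have fin: "finite P" unfolding P_def using B by (auto intro!: finite_PiE)
  have mem: "(\<exists>p\<in>P. \<forall>i\<le>k. X i = p i) \<longleftrightarrow> (\<forall>i\<le>k. X i \<in> B) \<and> X k = x" for X
  proof
    assume "(\<forall>i\<le>k. X i \<in> B) \<and> X k = x"
    then have "restrict X {..k} \<in> P" by (auto simp: P_def)
    then show "\<exists>p\<in>P. \<forall>i\<le>k. X i = p i" by (intro bexI[of _ "restrict X {..k}"]) auto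
  qed (auto simp: P_def PiE_iff)
  have disj: "p = q" if "p \<in> P" "q \<in> P" "\<And>i. i \<le> k \<Longrightarrow> X i = p i" "\<And>i. i \<le> k \<Longrightarrow> X i = q i" for p q and X :: "nat \<Rightarrow> int"
    using that by (auto simp: P_def intro!: PiE_ext[of p "{..k}" "\<lambda>_. B" q])
  have ev: "{X. \<forall>i\<le>k. X i = p i} \<in> events" "{X. (\<forall>i\<le>k. X i = p i) \<and> X (Suc k) = y} \<in> events" for p
  proof -
    have "{X \<in> space (walk_law a x0). \<forall>i\<in>{..k}. X i = p i} \<in> events" by measurable
    then show "{X. \<forall>i\<le>k. X i = p i} \<in> events" by (simp only: space_walk_law UNIV_I simp_thms Ball_def atMost_iff)
    have "{X \<in> space (walk_law a x0). (\<forall>i\<in>{..k}. X i = p i) \<and> X (Suc k) = y} \<in> events" by measurable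
    then show "{X. (\<forall>i\<le>k. X i = p i) \<and> X (Suc k) = y} \<in> events"
      by (simp only: space_walk_law UNIV_I simp_thms Ball_def atMost_iff)
  qed
  have "killed k x = prob (\<Union>p\<in>P. {X. \<forall>i\<le>k. X i = p i})"
    unfolding killed_def using mem by (intro arg_cong[where f=prob]) auto
  also have "\<dots> = (\<Sum>p\<in>P. prob {X. \<forall>i\<le>k. X i = p i})"
    using fin ev disj by (intro finite_measure_finite_Union) (auto simp: disjoint_family_on_def)
  finally have 1: "killed k x = (\<Sum>p\<in>P. prob {X. \<forall>i\<le>k. X i = p i})" .
  have "prob {X. (\<forall>i\<le>k. X i \<in> B) \<and> X k = x \<and> X (Suc k) = y} =
      prob (\<Union>p\<in>P. {X. (\<forall>i\<le>k. X i = p i) \<and> X (Suc k) = y})"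
    using mem by (intro arg_cong[where f=prob]) auto
  also have "\<dots> = (\<Sum>p\<in>P. prob {X. (\<forall>i\<le>k. X i = p i) \<and> X (Suc k) = y})"
    using fin ev disj by (intro finite_measure_finite_Union) (auto simp: disjoint_family_on_def)
  also have "\<dots> = (\<Sum>p\<in>P. prob {X. \<forall>i\<le>k. X i = p i} * pmf (jump a x) y)"
    by (intro sum.cong refl) (simp add: prob_path_Suc, simp add: P_def)
  finally show ?thesis unfolding 1 by (simp add: sum_distrib_right)
qed

lemma events_killed: "{X. (\<forall>i\<le>k. X i \<in> B) \<and> X k = x} \<in> events"
proof -
  have "{X \<in> space (walk_law a x0). (\<forall>i\<in>{..k}. X i \<in> B) \<and> X k = x} \<in> events" by measurable
  then show ?thesis by (simp only: space_walk_law UNIV_I simp_thms Ball_def atMost_iff)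
qed

lemma killed_Suc:
  assumes "y \<in> B"
  shows "killed (Suc k) y = (\<Sum>x\<in>B. killed k x * pmf (jump a x) y)"
proof -
  have ev: "{X. (\<forall>i\<le>k. X i \<in> B) \<and> X k = x \<and> X (Suc k) = y} \<in> events" for x
  proof -
    have "{X \<in> space (walk_law a x0). (\<forall>i\<in>{..k}. X i \<in> B) \<and> X k = x \<and> X (Suc k) = y} \<in> events"
      by measurable
    then show ?thesis by (simp only: space_walk_law UNIV_I simp_thms Ball_def atMost_iff)
  qed
  have "killed (Suc k) y = prob (\<Union>x\<in>B. {X. (\<forall>i\<le>k. X i \<in> B) \<and> X k = x \<and> X (Suc k) = y})"
    unfolding killed_def using assms by (intro arg_cong[where f=prob]) (auto simp: le_Suc_eq)
  also have "\<dots> = (\<Sum>x\<in>B. prob {X. (\<forall>i\<le>k. X i \<in> B) \<and> X k = x \<and> X (Suc k) = y})"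
    using B ev by (intro finite_measure_finite_Union) (auto simp: disjoint_family_on_def)
  finally show ?thesis by (simp only: killed_step)
qed

lemma stay_eq_sum_killed: "prob {X. \<forall>i\<le>k. X i \<in> B} = (\<Sum>x\<in>B. killed k x)"
proof -
  have "prob {X. \<forall>i\<le>k. X i \<in> B} = prob (\<Union>x\<in>B. {X. (\<forall>i\<le>k. X i \<in> B) \<and> X k = x})"
    by (intro arg_cong[where f=prob]) auto
  also have "\<dots> = (\<Sum>x\<in>B. killed k x)" unfolding killed_def
    using B events_killed by (intro finite_measure_finite_Union) (auto simp: disjoint_family_on_def)
  finally show ?thesis .
qed

text \<open>\<open>F k x\<close> bounds the exit probability with \<open>k\<close> steps to go. The
  sum of \<open>killed i x * (1 - F (n - i) x)\<close> over \<open>x\<close> in \<open>B\<close>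
  does not decrease with \<open>i\<close>: neighbours outside \<open>B\<close> contribute
  nonpositive terms because \<open>F\<close> is at least 1 there. It equals
  \<open>1 - F n x0\<close> at \<open>i = 0\<close> if the start is in \<open>B\<close>, and is at
  most the probability of staying at \<open>i = n\<close>.\<close>

lemma exit_le_supersolution:
  fixes F :: "nat \<Rightarrow> int \<Rightarrow> real"
  assumes a: "\<And>i. a i \<in> {0<..<1}"
    and nonneg: "\<And>k x. 0 \<le> F k x"
    and outside: "\<And>k x. x \<notin> B \<Longrightarrow> 1 \<le> F k x"
    and inside: "\<And>k x. x \<in> B \<Longrightarrow> a x * F k (x + 1) + (1 - a x) * F k (x - 1) \<le> F (Suc k) x"
  shows "emeasure (walk_law a x0) (\<Union>k\<in>{0..n}. {X. X k \<notin> B}) \<le> ennreal (F n x0)"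
proof -
  have jump: "pmf (jump a x) (x + 1) = a x" "pmf (jump a x) (x - 1) = 1 - a x"
    "set_pmf (jump a x) \<subseteq> {x + 1, x - 1}" for x
  proof -
    have inj: "inj (\<lambda>b. if b then x + 1 else x - 1)" by (auto simp: inj_def split: if_splits)
    show "pmf (jump a x) (x + 1) = a x"
      using pmf_map_inj'[OF inj, of "bernoulli_pmf (a x)" True] a[of x] by (simp add: jump_def)
    show "pmf (jump a x) (x - 1) = 1 - a x"
      using pmf_map_inj'[OF inj, of "bernoulli_pmf (a x)" False] a[of x] by (simp add: jump_def)
    show "set_pmf (jump a x) \<subseteq> {x + 1, x - 1}" by (auto simp: jump_def)
  qed
  have gen: "1 - F (Suc k) x \<le> (\<Sum>y\<in>B. pmf (jump a x) y * (1 - F k y))" if "x \<in> B" for k x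
  proof -
    have "(\<Sum>y\<in>{x + 1, x - 1}. pmf (jump a x) y * (1 - F k y)) =
        a x * (1 - F k (x + 1)) + (1 - a x) * (1 - F k (x - 1))"
      by (subst sum.insert) (auto simp: jump(1,2))
    then have "1 - F (Suc k) x \<le> (\<Sum>y\<in>{x + 1, x - 1}. pmf (jump a x) y * (1 - F k y))"
      using inside[OF that, of k] by (simp add: algebra_simps)
    also have "\<dots> = (\<Sum>y\<in>B \<union> {x + 1, x - 1}. pmf (jump a x) y * (1 - F k y))"
      using B jump(3)[of x] by (intro sum.mono_neutral_left) (auto simp: pmf_eq_0_set_pmf)
    also have "\<dots> = (\<Sum>y\<in>B. pmf (jump a x) y * (1 - F k y)) +
        (\<Sum>y\<in>{x + 1, x - 1} - B. pmf (jump a x) y * (1 - F k y))"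
      using B by (subst Un_Diff_cancel[symmetric], subst sum.union_disjoint) auto
    also have "(\<Sum>y\<in>{x + 1, x - 1} - B. pmf (jump a x) y * (1 - F k y)) \<le> 0"
      using outside by (intro sum_nonpos mult_nonneg_nonpos) auto
    finally show ?thesis by simp
  qed
  have killed_nonneg: "0 \<le> killed k x" for k x by (simp add: killed_def)
  have step: "(\<Sum>x\<in>B. killed k x * (1 - F (Suc j) x)) \<le> (\<Sum>y\<in>B. killed (Suc k) y * (1 - F j y))" for k j
  proof -
    have "(\<Sum>x\<in>B. killed k x * (1 - F (Suc j) x)) \<le>
        (\<Sum>x\<in>B. killed k x * (\<Sum>y\<in>B. pmf (jump a x) y * (1 - F j y)))"
      by (intro sum_mono mult_left_mono gen killed_nonneg)
    also have "\<dots> = (\<Sum>y\<in>B. (\<Sum>x\<in>B. killed k x * pmf (jump a x) y) * (1 - F j y))"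
      by (simp add: sum_distrib_left sum_distrib_right mult.assoc) (rule sum.swap)
    finally show ?thesis by (simp add: killed_Suc)
  qed
  have mono: "(\<Sum>x\<in>B. killed 0 x * (1 - F k x)) \<le> (\<Sum>y\<in>B. killed k y * (1 - F 0 y))" for k
  proof -
    have "(\<Sum>x\<in>B. killed 0 x * (1 - F (j + i) x)) \<le> (\<Sum>y\<in>B. killed i y * (1 - F j y))" for i j
    proof (induction i arbitrary: j)
      case (Suc i)
      show ?case using Suc[of "Suc j"] step[of i j] by simp
    qed simp
    from this[of 0 k] show ?thesis by simp
  qed
  have "1 - F n x0 \<le> prob {X. \<forall>i\<le>n. X i \<in> B}"
  proof (cases "x0 \<in> B")
    case True
    have k0: "killed 0 x = (if x = x0 then 1 else 0)" if "x \<in> B" for x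
    proof -
      have "{X. (\<forall>i\<le>0::nat. X i \<in> B) \<and> X 0 = x} = {X. \<forall>i\<le>0. X i = (\<lambda>_. x) i}" using that by auto
      then show ?thesis unfolding killed_def by (simp add: prob_path del: le_zero_eq)
    qed
    have "1 - F n x0 = (\<Sum>x\<in>B. killed 0 x * (1 - F n x))"
      using True B by (simp add: k0 if_distrib[of "\<lambda>c. c * _"] cong: if_cong)
    also have "\<dots> \<le> (\<Sum>y\<in>B. killed n y * (1 - F 0 y))" by (rule mono)
    also have "\<dots> \<le> (\<Sum>y\<in>B. killed n y)"
      using nonneg killed_nonneg by (intro sum_mono mult_left_le) auto
    finally show ?thesis by (simp add: stay_eq_sum_killed)
  next
    case False
    then show ?thesis using outside[of x0 n] measure_nonneg[of "walk_law a x0"] by (smt (verit))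
  qed
  moreover have "prob (\<Union>k\<in>{0..n}. {X. X k \<notin> B}) = 1 - prob {X. \<forall>i\<le>n. X i \<in> B}"
  proof -
    have "{X \<in> space (walk_law a x0). \<forall>i\<in>{..n}. X i \<in> B} \<in> events" by measurable
    then have "{X. \<forall>i\<le>n. X i \<in> B} \<in> events"
      by (simp only: space_walk_law UNIV_I simp_thms Ball_def atMost_iff)
    then have "prob (UNIV - {X. \<forall>i\<le>n. X i \<in> B}) = 1 - prob {X. \<forall>i\<le>n. X i \<in> B}"
      using prob_compl[of "{X. \<forall>i\<le>n. X i \<in> B}"] unfolding space_walk_law by blast
    moreover have "(\<Union>k\<in>{0..n}. {X. X k \<notin> B}) = UNIV - {X. \<forall>i\<le>n. X i \<in> B}" by auto
    ultimately show ?thesis by (simp only:)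
  qed
  ultimately have "prob (\<Union>k\<in>{0..n}. {X. X k \<notin> B}) \<le> F n x0" by linarith
  then show ?thesis unfolding emeasure_eq_measure by (rule ennreal_leI)
qed

end

section \<open>Resistances of the edges\<close>

lemma S_int_rec: "S_int a k = S_int a (k - 1) + eps a k"
proof -
  have 1: "{1..k} = insert k {1..k - 1}" if "1 \<le> k" using that by auto
  have 2: "{k..0} = insert k {k + 1..0}" if "k \<le> 0" using that by auto
  show ?thesis
  proof (cases "1 \<le> k")
    case True
    then show ?thesis unfolding S_int_def by (simp add: 1)
  next
    case False
    then have "k \<le> 0" by simp
    then show ?thesis using 2 unfolding S_int_def by auto
  qed
qed

lemma exp_S_int:
  assumes "a k \<in> {0<..<1}"
  shows "a k * exp (S_int a k) = (1 - a k) * exp (S_int a (k - 1))"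
  using assms unfolding S_int_rec[of a k] eps_def by (simp add: exp_add field_simps)

text \<open>\<open>exp (S_int a k)\<close> is the resistance of the edge between \<open>k\<close> and \<open>k + 1\<close>, so sums of
  these are harmonic. Normalized to be at least 1 outside \<open>{L..R}\<close> and glued at the bottom \<open>m\<close>,
  two such sums are superharmonic up to a defect of \<open>\<delta>\<close> per step at \<open>m\<close>.\<close>

lemma walk_exit_bound:
  fixes a :: "int \<Rightarrow> real"
  defines "S \<equiv> S_int a"
  assumes a: "\<And>i. a i \<in> {0<..<1}" and m: "L < m" "m \<le> R"
  shows "emeasure (walk_law a 0) (\<Union>k\<in>{0..n}. {X. X k \<notin> {L..R}}) \<le>
    ennreal ((\<Sum>k\<in>{0..<m}. exp (S k - S L)) + (\<Sum>k\<in>{m..<0}. exp (S k - S R)) +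
      real n * (exp (S m - S L) + exp (S m - S R)))"
proof -
  define h where "h x = (\<Sum>k\<in>{x..<m}. exp (S k - S L)) + (\<Sum>k\<in>{m..<x}. exp (S k - S R))" for x
  define \<delta> where "\<delta> = exp (S m - S L) + exp (S m - S R)"
  define F where "F k x = h x + real k * \<delta>" for k x
  have h0: "0 \<le> h x" for x by (simp add: h_def add_nonneg_nonneg sum_nonneg)
  have d0: "0 \<le> \<delta>" by (simp add: \<delta>_def)
  have left: "h (x - 1) = h x + exp (S (x - 1) - S L)" if "x \<le> m" for x
  proof -
    have "{x - 1..<m} = insert (x - 1) {x..<m}" using that by auto
    then show ?thesis using that by (simp add: h_def)
  qed
  have right: "h (x + 1) = h x + exp (S x - S R)" if "m \<le> x" for x
  proof -
    have "{m..<x + 1} = insert x {m..<x}" using that by auto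
    then show ?thesis using that by (simp add: h_def)
  qed
  have h1: "1 \<le> h x" if "x \<notin> {L..R}" for x
  proof (cases "x < L")
    case True
    then have "exp (S L - S L) \<le> (\<Sum>k\<in>{x..<m}. exp (S k - S L))"
      using m by (intro member_le_sum[of L]) auto
    then show ?thesis using True m by (simp add: h_def)
  next
    case False
    then have "exp (S R - S R) \<le> (\<Sum>k\<in>{m..<x}. exp (S k - S R))"
      using m that by (intro member_le_sum[of R]) auto
    then show ?thesis using False m that by (simp add: h_def)
  qed
  have harm: "a x * exp (S x - c) = (1 - a x) * exp (S (x - 1) - c)" for x c
    using exp_S_int[of a x] a[of x] unfolding S_def by (simp add: exp_diff field_simps)
  have super: "a x * h (x + 1) + (1 - a x) * h (x - 1) \<le> h x + \<delta>" for x
  proof -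
    consider "x < m" | "x = m" | "m < x" by linarith
    then show ?thesis
    proof cases
      case 1
      then have "h (x - 1) = h x + exp (S (x - 1) - S L)" "h x = h (x + 1) + exp (S x - S L)"
        using left[of x] left[of "x + 1"] by auto
      then have "a x * h (x + 1) + (1 - a x) * h (x - 1) = h x"
        using harm[of x "S L"] by (simp add: algebra_simps)
      then show ?thesis using d0 by simp
    next
      case 2
      \<comment> \<open>At the bottom \<open>h\<close> vanishes, while both neighbours have positive
        values. Harmonicity turns the left contribution into a multiple of \<open>a m\<close> as
        well, so the defect is exactly \<open>a m * \<delta>\<close>.\<close>
      then have "a x * h (x + 1) + (1 - a x) * h (x - 1) = h m + a m * \<delta>"
        using left[of m] right[of m] harm[of m "S L"] by (simp add: \<delta>_def algebra_simps)
      then show ?thesis using 2 d0 a[of m] mult_left_le_one_le[of \<delta> "a m"] by auto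
    next
      case 3
      then have "h (x + 1) = h x + exp (S x - S R)" "h x = h (x - 1) + exp (S (x - 1) - S R)"
        using right[of x] right[of "x - 1"] by auto
      then have "a x * h (x + 1) + (1 - a x) * h (x - 1) = h x"
        using harm[of x "S R"] by (simp add: algebra_simps)
      then show ?thesis using d0 by simp
    qed
  qed
  have "emeasure (walk_law a 0) (\<Union>k\<in>{0..n}. {X. X k \<notin> {L..R}}) \<le> ennreal (F n 0)"
  proof (rule exit_le_supersolution[OF _ a])
    show "0 \<le> F k x" for k x using h0 d0 by (simp add: F_def)
    show "1 \<le> F k x" if "x \<notin> {L..R}" for k x using h1[OF that] d0 by (simp add: F_def add_increasing2)
    show "a x * F k (x + 1) + (1 - a x) * F k (x - 1) \<le> F (Suc k) x" for k x
      using super[of x] by (simp add: F_def algebra_simps)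
  qed simp
  then show ?thesis by (simp add: F_def h_def \<delta>_def)
qed

section \<open>Sums of independent centred steps\<close>

definition active :: "(nat \<Rightarrow> real) \<Rightarrow> real \<Rightarrow> real \<Rightarrow> real \<Rightarrow> nat \<Rightarrow> bool" where
  "active f h u d i \<longleftrightarrow> (\<exists>j\<le>i. h \<le> f j) \<and>
     (\<forall>t\<le>i. f t < h + u \<and> ((\<exists>j\<le>t. h \<le> f j) \<longrightarrow> h - d < f t))"

text \<open>Predictability: whether step \<open>i\<close> counts is decided by the path up to time
  \<open>i\<close>, hence independently of the step.\<close>

lemma active_cong: "(\<And>k. k \<le> i \<Longrightarrow> f k = f' k) \<Longrightarrow> active f h u d i = active f' h u d i"
  unfolding active_def by (smt (verit, best) order.trans)

text \<open>The increment of \<open>f\<close> between its first visit above \<open>h\<close> and the following exit from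
  the interval from \<open>h - d\<close> to \<open>h + u\<close>. For a random walk this is a martingale transform and has mean 0.\<close>

definition gain :: "(nat \<Rightarrow> real) \<Rightarrow> real \<Rightarrow> real \<Rightarrow> real \<Rightarrow> nat \<Rightarrow> real" where
  "gain f h u d k = (\<Sum>i<k. if active f h u d i then f (Suc i) - f i else 0)"

lemma gain_Suc: "gain f h u d (Suc k) =
    gain f h u d k + (if active f h u d k then f (Suc k) - f k else 0)"
  by (simp add: gain_def)

lemma active_Suc: "active f h u d (Suc k) \<longleftrightarrow>
    (active f h u d k \<or> (\<forall>j\<le>k. f j < h) \<and> (\<forall>t\<le>k. f t < h + u)) \<and>
    (\<exists>j\<le>Suc k. h \<le> f j) \<and> f (Suc k) < h + u \<and> h - d < f (Suc k)"
proof -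
  have all: "(\<forall>t\<le>Suc k. P t) \<longleftrightarrow> (\<forall>t\<le>k. P t) \<and> P (Suc k)" for P by (auto simp: le_Suc_eq)
  show ?thesis
  proof (cases "\<exists>j\<le>k. h \<le> f j")
    case True
    then have "\<exists>j\<le>Suc k. h \<le> f j" by (auto intro: le_SucI)
    moreover have "\<not> (\<forall>j\<le>k. f j < h)" using True by (auto simp: not_less)
    ultimately show ?thesis using True unfolding active_def all by blast
  next
    case False
    then have "\<And>t. t \<le> k \<Longrightarrow> \<not> (\<exists>j\<le>t. h \<le> f j)" "\<forall>j\<le>k. f j < h" by auto
    then show ?thesis using False unfolding active_def all by blast
  qed
qed

text \<open>While the strategy is active the gain is \<open>f k - f j\<close> for a time
  \<open>j\<close> with \<open>h \<le> f j\<close>; afterwards it is frozen. The last active step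
  starts below \<open>h + u\<close> and adds at most \<open>K\<close>, which gives the upper bound.
  If it stopped without \<open>h + u\<close> being reached, it stopped at or below
  \<open>h - d\<close>.\<close>

lemma gain_bounds:
  assumes u: "0 < u" and d: "0 < d" and K: "0 \<le> K" "\<And>i. i < k \<Longrightarrow> \<bar>f (Suc i) - f i\<bar> \<le> K"
  shows "gain f h u d k \<le> u + K"
    and "\<not> active f h u d k \<Longrightarrow> \<exists>j\<le>k. h \<le> f j \<Longrightarrow> \<forall>t\<le>k. f t < h + u \<Longrightarrow> gain f h u d k \<le> - d"
proof -
  let ?g = "gain f h u d" and ?a = "active f h u d"
  have "(?a k \<longrightarrow> (\<exists>j\<le>k. h \<le> f j \<and> ?g k = f k - f j)) \<and>
    ((\<forall>j\<le>k. f j < h) \<longrightarrow> ?g k = 0) \<and> ?g k \<le> u + K \<and>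
    (\<not> ?a k \<and> (\<exists>j\<le>k. h \<le> f j) \<and> (\<forall>t\<le>k. f t < h + u) \<longrightarrow> ?g k \<le> - d)"
    using K(2)
  proof (induction k)
    case 0
    show ?case using u d K(1) by (auto simp: gain_def active_def)
  next
    case (Suc k)
    have K: "\<bar>f (Suc k) - f k\<bar> \<le> K" using Suc.prems by simp
    have IH: "?a k \<Longrightarrow> \<exists>j\<le>k. h \<le> f j \<and> ?g k = f k - f j" "\<forall>j\<le>k. f j < h \<Longrightarrow> ?g k = 0" "?g k \<le> u + K"
      "\<not> ?a k \<Longrightarrow> \<exists>j\<le>k. h \<le> f j \<Longrightarrow> \<forall>t\<le>k. f t < h + u \<Longrightarrow> ?g k \<le> - d"
      using Suc by auto
    show ?case
    proof (cases "?a k")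
      case True
      then obtain j where j: "j \<le> k" "h \<le> f j" "?g k = f k - f j" using IH(1) by blast
      have g: "?g (Suc k) = f (Suc k) - f j" using True j by (simp add: gain_Suc)
      have fk: "f k < h + u" using True by (simp add: active_def)
      have "j \<le> Suc k" using j by simp
      moreover have "?g (Suc k) \<le> u + K" using g fk K j(2) by linarith
      moreover have "?g (Suc k) \<le> - d" if "\<not> ?a (Suc k)" "\<forall>t\<le>Suc k. f t < h + u"
      proof -
        have "f (Suc k) \<le> h - d"
          using that True \<open>j \<le> Suc k\<close> j(2) unfolding active_Suc by (meson le_refl not_less)
        then show ?thesis using g j(2) by linarith
      qed
      ultimately show ?thesis using g j(2) by (meson not_less)
    next
      case False
      then have g: "?g (Suc k) = ?g k" by (simp add: gain_Suc)
      show ?thesis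
      proof (cases "\<exists>j\<le>k. h \<le> f j")
        case True
        then have "\<not> ?a (Suc k)" using False unfolding active_Suc by (meson not_less)
        then show ?thesis using g IH False True by (auto simp: le_Suc_eq not_less)
      next
        case nr: False
        then have g0: "?g (Suc k) = 0" using g IH(2) by (metis not_le)
        have nr': "\<forall>j\<le>k. f j < h" using nr by (metis not_le)
        have "?a (Suc k)" if "h \<le> f (Suc k)" "\<forall>t\<le>Suc k. f t < h + u"
          unfolding active_Suc
        proof (intro conjI disjI2)
          show "\<forall>t\<le>k. f t < h + u" "f (Suc k) < h + u" using that by auto
          show "\<exists>j\<le>Suc k. h \<le> f j" using that by blast
        qed (use nr' that d in auto)
        moreover have "\<exists>j\<le>Suc k. h \<le> f j \<Longrightarrow> h \<le> f (Suc k)"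
          using nr by (auto simp: le_Suc_eq)
        moreover have "?a (Suc k) \<Longrightarrow> h \<le> f (Suc k)"
          using nr unfolding active_def by (auto simp: le_Suc_eq)
        ultimately show ?thesis using g0 u \<open>0 \<le> K\<close> by force
      qed
    qed
  qed
  then show "gain f h u d k \<le> u + K"
    and "\<not> active f h u d k \<Longrightarrow> \<exists>j\<le>k. h \<le> f j \<Longrightarrow> \<forall>t\<le>k. f t < h + u \<Longrightarrow> gain f h u d k \<le> - d"
    by blast+
qed

lemma gain_plunges:
  assumes "plunges f T h u d" "0 < u" "0 < d"
  shows "gain f h u d T \<le> - d"
proof -
  obtain i k where ik: "i < k" "k \<le> T" "h \<le> f i" "f k \<le> h - d" "\<forall>t\<le>k. f t < h + u"
    using assms(1) unfolding plunges_def by blast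
  have reach: "\<exists>j\<le>t. h \<le> f j" if "k \<le> t" for t using ik that by (intro exI[of _ i]) auto
  have dead: "\<not> active f h u d t" if "k \<le> t" for t
    using ik that reach unfolding active_def by (meson le_refl not_less)
  \<comment> \<open>The bound by \<open>- d\<close> does not involve \<open>K\<close>, so any bound
    on the increments will do, here their total variation.\<close>
  have "gain f h u d k \<le> - d"
  proof (rule gain_bounds(2)[where K="\<Sum>i<k. \<bar>f (Suc i) - f i\<bar>"])
    show "\<bar>f (Suc i) - f i\<bar> \<le> (\<Sum>i<k. \<bar>f (Suc i) - f i\<bar>)" if "i < k" for i
      using that by (intro member_le_sum) auto
  qed (use assms ik reach dead in \<open>auto intro: sum_nonneg\<close>)
  moreover have "gain f h u d (k + t) = gain f h u d k" for t
    by (induction t) (auto simp: gain_Suc dead)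
  then have "gain f h u d T = gain f h u d k" using ik(2) by (metis le_add_diff_inverse)
  ultimately show ?thesis by simp
qed

lemma (in prob_space) indep_var_blocks:
  fixes X :: "'i \<Rightarrow> 'a \<Rightarrow> real"
  assumes X: "indep_vars (\<lambda>_. borel) X UNIV" and AB: "A \<inter> B = {}"
    and f: "f \<in> PiM A (\<lambda>_. borel) \<rightarrow>\<^sub>M borel" and g: "g \<in> PiM B (\<lambda>_. borel) \<rightarrow>\<^sub>M borel"
  shows "indep_var borel (\<lambda>\<omega>. f (\<lambda>i\<in>A. X i \<omega>) :: real) borel (\<lambda>\<omega>. g (\<lambda>i\<in>B. X i \<omega>) :: real)"
  using indep_var_compose[OF indep_var_restrict[OF X AB] f g] by (simp add: comp_def)

lemma (in prob_space) prob_block_conj: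
  fixes X :: "'i \<Rightarrow> 'a \<Rightarrow> real"
  assumes X: "indep_vars (\<lambda>_. borel) X UNIV" and AB: "A \<inter> B = {}"
    and P: "Measurable.pred (PiM A (\<lambda>_. borel)) P" and R: "Measurable.pred (PiM B (\<lambda>_. borel)) R"
  shows "prob {\<omega> \<in> space M. P (\<lambda>i\<in>A. X i \<omega>) \<and> R (\<lambda>i\<in>B. X i \<omega>)} =
    prob {\<omega> \<in> space M. P (\<lambda>i\<in>A. X i \<omega>)} * prob {\<omega> \<in> space M. R (\<lambda>i\<in>B. X i \<omega>)}"
proof -
  have "indep_var (PiM A (\<lambda>_. borel)) (\<lambda>\<omega>. \<lambda>i\<in>A. X i \<omega>) (PiM B (\<lambda>_. borel)) (\<lambda>\<omega>. \<lambda>i\<in>B. X i \<omega>)"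
    by (rule indep_var_restrict[OF X AB]) auto
  from indep_varD[OF this, of "{x \<in> space (PiM A (\<lambda>_. borel)). P x}" "{x \<in> space (PiM B (\<lambda>_. borel)). R x}"]
  show ?thesis using P R by (simp add: vimage_def Int_def pred_def space_PiM conj_commute cong: conj_cong)
qed

text \<open>Either half of the potential is such a walk. Its law is represented by \<open>v\<close>
  and \<open>q\<close> alone; independence and equal second and fourth moments are what the
  estimates rest on.\<close>

locale walk_steps = prob_space +
  fixes \<xi> :: "nat \<Rightarrow> 'a \<Rightarrow> real" and v q :: real
  assumes indep: "indep_vars (\<lambda>_. borel) \<xi> UNIV"
    and fourth: "\<And>i. integrable M (\<lambda>\<omega>. \<xi> i \<omega> ^ 4)" "\<And>i. expectation (\<lambda>\<omega>. \<xi> i \<omega> ^ 4) = q"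
    and mean: "\<And>i. expectation (\<xi> i) = 0"
    and var: "\<And>i. expectation (\<lambda>\<omega>. (\<xi> i \<omega>)\<^sup>2) = v"
    and v_pos: "0 < v"
begin

abbreviation W :: "nat \<Rightarrow> 'a \<Rightarrow> real" where
  "W k \<omega> \<equiv> \<Sum>i<k. \<xi> i \<omega>"

lemma measurable_step [measurable]: "\<xi> i \<in> borel_measurable M"
  using indep unfolding indep_vars_def by auto

text \<open>Controls the largest of \<open>T\<close> steps: replacing the second term by its sum
  over all steps bounds every step at once, with expectation
  \<open>K + T * q / K ^ 3\<close>.\<close>

lemma abs_le_fourth: "K > 0 \<Longrightarrow> \<bar>x\<bar> \<le> K + x ^ 4 / K ^ 3" for x K :: real
proof (cases "\<bar>x\<bar> \<le> K")
  case False
  assume "K > 0"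
  then have "\<bar>x\<bar> * K ^ 3 \<le> \<bar>x\<bar> * \<bar>x\<bar> ^ 3" using False by (intro mult_left_mono power_mono) auto
  also have "\<dots> = x ^ 4" by (simp add: power_numeral_reduce abs_mult flip: power_even_abs)
  finally have "\<bar>x\<bar> \<le> x ^ 4 / K ^ 3" using \<open>K > 0\<close> by (simp add: field_simps)
  then show ?thesis using \<open>K > 0\<close> by simp
next
  case True
  assume "K > 0"
  then show ?thesis using True by (simp add: add_increasing2)
qed

lemma integrable_power_le_4:
  assumes [measurable]: "Z \<in> borel_measurable M" and "integrable M (\<lambda>\<omega>. Z \<omega> ^ 4)" and "j \<le> 4"
  shows "integrable M (\<lambda>\<omega>. Z \<omega> ^ j :: real)"
proof (rule Bochner_Integration.integrable_bound[where f="\<lambda>\<omega>. 1 + Z \<omega> ^ 4"])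
  have "\<bar>x\<bar> ^ j \<le> 1 + \<bar>x\<bar> ^ 4" for x :: real
  proof (cases "\<bar>x\<bar> \<le> 1")
    case True
    then have "\<bar>x\<bar> ^ j \<le> 1" by (intro power_le_one) auto
    then show ?thesis by (simp add: add_increasing2)
  next
    case False
    then have "\<bar>x\<bar> ^ j \<le> \<bar>x\<bar> ^ 4" using assms(3) by (intro power_increasing) auto
    then show ?thesis by simp
  qed
  then show "AE \<omega> in M. norm (Z \<omega> ^ j) \<le> norm (1 + Z \<omega> ^ 4)"
    by (auto simp: power_abs)
qed (use assms in auto)

lemma integrable_step_power: "j \<le> 4 \<Longrightarrow> integrable M (\<lambda>\<omega>. \<xi> i \<omega> ^ j)"
  using integrable_power_le_4[OF measurable_step fourth(1)] by blast

text \<open>Optional stopping: the gain has mean 0, is always at most \<open>u\<close> plus the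
  overshoot, and is at most \<open>- d\<close> on the event. Hence \<open>d\<close> times its
  probability is at most \<open>u\<close> plus the expected overshoot.\<close>

lemma prob_plunges_le:
  assumes u: "0 < u" and d: "0 < d" and K: "0 < K"
  shows "prob {\<omega> \<in> space M. plunges (\<lambda>k. W k \<omega>) T h u d} \<le> (u + K + real T * q / K ^ 3) / d"
proof -
  let ?B = "{\<omega> \<in> space M. plunges (\<lambda>k. W k \<omega>) T h u d}"
  define Y where "Y \<omega> = gain (\<lambda>k. W k \<omega>) h u d T" for \<omega>
  have [measurable]: "Measurable.pred M (\<lambda>\<omega>. active (\<lambda>k. W k \<omega>) h u d i)" for i
    unfolding active_def by measurable
  have [measurable]: "?B \<in> events" unfolding plunges_def by measurable
  define D where "D i \<omega> = (if active (\<lambda>k. W k \<omega>) h u d i then 1 else 0 :: real)" for i \<omega>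
  have [measurable]: "D i \<in> borel_measurable M" for i
    unfolding D_def by measurable
  have Y: "Y \<omega> = (\<Sum>i<T. D i \<omega> * \<xi> i \<omega>)" for \<omega>
    unfolding Y_def gain_def by (intro sum.cong) (auto simp: D_def)
  have int1: "integrable M (\<xi> i)" for i using integrable_step_power[of 1 i] by simp
  have intD: "integrable M (D i)" for i
  proof (rule integrable_const_bound[where B=1])
    show "AE \<omega> in M. norm (D i \<omega>) \<le> 1" by (intro AE_I2) (simp add: D_def)
  qed measurable
  have int: "integrable M (\<lambda>\<omega>. D i \<omega> * \<xi> i \<omega>)" for i
  proof (rule Bochner_Integration.integrable_bound[OF int1])
    show "AE \<omega> in M. norm (D i \<omega> * \<xi> i \<omega>) \<le> norm (\<xi> i \<omega>)"
      by (intro AE_I2) (simp add: D_def)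
  qed measurable
  have "expectation (\<lambda>\<omega>. D i \<omega> * \<xi> i \<omega>) = 0" for i
  proof -
    \<comment> \<open>The weight of step \<open>i\<close> is written as a function of the steps
      before \<open>i\<close>, which makes it independent of step \<open>i\<close>, so the product
      has mean 0.\<close>
    define f where "f = (\<lambda>x::nat \<Rightarrow> real. if active (\<lambda>k. \<Sum>j<k. x j) h u d i then 1 else 0 :: real)"
    have eq: "f (\<lambda>j\<in>{..<i}. \<xi> j \<omega>) = D i \<omega>" for \<omega>
    proof -
      have "(\<Sum>j<k. (\<lambda>j\<in>{..<i}. \<xi> j \<omega>) j) = W k \<omega>" if "k \<le> i" for k
        using that by (intro sum.cong) auto
      then have "active (\<lambda>k. \<Sum>j<k. (\<lambda>j\<in>{..<i}. \<xi> j \<omega>) j) h u d i = active (\<lambda>k. W k \<omega>) h u d i"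
        by (intro active_cong)
      then show ?thesis by (simp only: f_def D_def)
    qed
    have [measurable]: "(\<lambda>x. \<Sum>j<k. x j) \<in> borel_measurable (PiM {..<i} (\<lambda>_. borel :: real measure))"
      if "k \<in> {..i}" for k
      using that by (intro borel_measurable_sum measurable_component_singleton) auto
    have "f \<in> borel_measurable (PiM {..<i} (\<lambda>_. borel))"
      unfolding f_def active_def by measurable
    then have "indep_var borel (\<lambda>\<omega>. f (\<lambda>j\<in>{..<i}. \<xi> j \<omega>)) borel (\<lambda>\<omega>. (\<lambda>x. x i) (\<lambda>j\<in>{i}. \<xi> j \<omega>))"
      by (intro indep_var_blocks[OF indep] measurable_component_singleton) auto
    then have "indep_var borel (D i) borel (\<xi> i)"
      by (simp add: eq)
    then show ?thesis
      using indep_var_lebesgue_integral[OF _ intD int1] mean by simp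
  qed
  then have EY: "expectation Y = 0" unfolding Y using int by simp
  have intY: "integrable M Y" unfolding Y using int by auto
  define K' where "K' \<omega> = K + (\<Sum>i<T. \<xi> i \<omega> ^ 4 / K ^ 3)" for \<omega>
  have le: "Y \<omega> \<le> u + K' \<omega> - d * indicator ?B \<omega>" if "\<omega> \<in> space M" for \<omega>
  proof -
    have K'0: "0 \<le> K' \<omega>" using K by (auto simp: K'_def intro!: add_nonneg_nonneg sum_nonneg)
    have "\<bar>W (Suc i) \<omega> - W i \<omega>\<bar> \<le> K' \<omega>" if "i < T" for i
    proof -
      have "\<xi> i \<omega> ^ 4 / K ^ 3 \<le> (\<Sum>i<T. \<xi> i \<omega> ^ 4 / K ^ 3)"
        using that K by (intro member_le_sum) auto
      then show ?thesis using abs_le_fourth[OF K, of "\<xi> i \<omega>"] by (simp add: K'_def)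
    qed
    then have "Y \<omega> \<le> u + K' \<omega>"
      unfolding Y_def by (intro gain_bounds(1)[OF u d K'0]) auto
    moreover have "Y \<omega> \<le> - d" if "\<omega> \<in> ?B"
      using gain_plunges[OF _ u d] that unfolding Y_def by auto
    ultimately show ?thesis using u K'0 by (auto simp: indicator_def)
  qed
  have intK': "integrable M K'" unfolding K'_def using fourth(1) by auto
  have EK': "expectation K' = K + real T * q / K ^ 3"
    unfolding K'_def using fourth by (simp add: prob_space)
  have "expectation Y \<le> expectation (\<lambda>\<omega>. u + K' \<omega> - d * indicator ?B \<omega>)"
    using intY intK' by (intro integral_mono le) (auto simp: emeasure_eq_measure)
  also have "\<dots> = u + (K + real T * q / K ^ 3) - d * prob ?B"
    using intK' EK' by (simp add: prob_space emeasure_eq_measure)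
  finally show ?thesis using EY d by (simp add: field_simps)
qed

end

section \<open>Block sums and leaving an interval\<close>

context walk_steps
begin

abbreviation Z :: "nat \<Rightarrow> nat \<Rightarrow> 'a \<Rightarrow> real" where
  "Z k N \<omega> \<equiv> \<Sum>i\<in>{k..<k + N}. \<xi> i \<omega>"

text \<open>Induction on the length. In the fourth power, the mixed terms with an odd exponent have
  mean 0 by independence and centring; the remaining one contributes \<open>6 * N * v^2\<close>,
  which is dominated by the growth of \<open>3 * N^2 * v^2\<close>.\<close>

lemma block_moments:
  shows "integrable M (\<lambda>\<omega>. Z k N \<omega> ^ 4)" "expectation (Z k N) = 0"
    "expectation (\<lambda>\<omega>. (Z k N \<omega>)\<^sup>2) = real N * v"
    "expectation (\<lambda>\<omega>. Z k N \<omega> ^ 4) \<le> 3 * (real N)\<^sup>2 * v\<^sup>2 + real N * q"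
proof (induction N)
  case 0
  { case 1 show ?case by simp }
  { case 2 show ?case by simp }
  { case 3 show ?case by simp }
  { case 4 show ?case by simp }
next
  case (Suc N)
  let ?x = "\<xi> (k + N)"
  have Z': "Z k (Suc N) \<omega> = Z k N \<omega> + ?x \<omega>" for \<omega> by simp
  have meas: "(\<lambda>x. \<Sum>i\<in>{k..<k + N}. x i) \<in> PiM {k..<k + N} (\<lambda>_. borel :: real measure) \<rightarrow>\<^sub>M borel"
    by (intro borel_measurable_sum measurable_component_singleton)
  have "indep_var borel (\<lambda>\<omega>. \<Sum>i\<in>{k..<k + N}. (\<lambda>j\<in>{k..<k + N}. \<xi> j \<omega>) i)
      borel (\<lambda>\<omega>. (\<lambda>x. x (k + N)) (\<lambda>j\<in>{k + N}. \<xi> j \<omega>))"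
    by (rule indep_var_blocks[OF indep _ meas]) (auto intro: measurable_component_singleton)
  then have ind: "indep_var borel (Z k N) borel ?x" by simp
  have ind': "indep_var borel (\<lambda>\<omega>. Z k N \<omega> ^ a) borel (\<lambda>\<omega>. ?x \<omega> ^ b)" for a b
    using indep_var_compose[OF ind, of "\<lambda>x. x ^ a" borel "\<lambda>x. x ^ b" borel] by (simp add: comp_def)
  have intZ: "integrable M (\<lambda>\<omega>. Z k N \<omega> ^ a)" if "a \<le> 4" for a
    using integrable_power_le_4[OF _ Suc(1) that] by simp
  note intx = integrable_step_power[of _ "k + N"]
  have E: "integrable M (\<lambda>\<omega>. Z k N \<omega> ^ a * ?x \<omega> ^ b) \<and> expectation (\<lambda>\<omega>. Z k N \<omega> ^ a * ?x \<omega> ^ b) =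
      expectation (\<lambda>\<omega>. Z k N \<omega> ^ a) * expectation (\<lambda>\<omega>. ?x \<omega> ^ b)" if "a \<le> 4" "b \<le> 4" for a b
    using indep_var_lebesgue_integral[OF ind' intZ intx] indep_var_integrable[OF ind' intZ intx] that
    by blast
  note I = E[THEN conjunct1] and E = E[THEN conjunct2]
  have EZ: "expectation (\<lambda>\<omega>. Z k N \<omega> ^ 1) = 0" "expectation (\<lambda>\<omega>. Z k N \<omega> ^ 2) = real N * v"
    using Suc(2,3) by simp_all
  have Ex: "expectation (\<lambda>\<omega>. ?x \<omega> ^ 1) = 0" "expectation (\<lambda>\<omega>. ?x \<omega> ^ 2) = v"
    "expectation (\<lambda>\<omega>. ?x \<omega> ^ 4) = q"
    using mean var fourth(2) by simp_all
  have e4: "Z k (Suc N) \<omega> ^ 4 = Z k N \<omega> ^ 4 + 4 * (Z k N \<omega> ^ 3 * ?x \<omega> ^ 1) + 6 * (Z k N \<omega> ^ 2 * ?x \<omega> ^ 2)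
      + 4 * (Z k N \<omega> ^ 1 * ?x \<omega> ^ 3) + ?x \<omega> ^ 4" for \<omega>
    unfolding Z' by (simp add: power_numeral_reduce algebra_simps)
  have e2: "(Z k (Suc N) \<omega>)\<^sup>2 = Z k N \<omega> ^ 2 + 2 * (Z k N \<omega> ^ 1 * ?x \<omega> ^ 1) + ?x \<omega> ^ 2" for \<omega>
    unfolding Z' by (simp add: power2_eq_square algebra_simps)
  { case 1 show ?case
      unfolding e4
      by (intro Bochner_Integration.integrable_add integrable_mult_right I intx Suc(1)) simp_all }
  { case 2 show ?case
      unfolding Z' using intZ[of 1] intx[of 1] EZ(1) Ex(1) by simp }
  { case 3
    have "expectation (\<lambda>\<omega>. (Z k (Suc N) \<omega>)\<^sup>2) = real N * v + 2 * (0 * 0) + v"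
      unfolding e2 using I[of 1 1] E[of 1 1] intZ[of 2] intx[of 2] EZ Ex
      by (subst Bochner_Integration.integral_add; (subst Bochner_Integration.integral_add)?) simp_all
    then show ?case by (simp add: algebra_simps) }
  { case 4
    have "expectation (\<lambda>\<omega>. Z k (Suc N) \<omega> ^ 4) = expectation (\<lambda>\<omega>. Z k N \<omega> ^ 4) + 6 * (real N * v * v) + q"
    proof -
      have "expectation (\<lambda>\<omega>. Z k (Suc N) \<omega> ^ 4) = expectation (\<lambda>\<omega>. Z k N \<omega> ^ 4) +
          4 * expectation (\<lambda>\<omega>. Z k N \<omega> ^ 3 * ?x \<omega> ^ 1) + 6 * expectation (\<lambda>\<omega>. Z k N \<omega> ^ 2 * ?x \<omega> ^ 2)
          + 4 * expectation (\<lambda>\<omega>. Z k N \<omega> ^ 1 * ?x \<omega> ^ 3) + expectation (\<lambda>\<omega>. ?x \<omega> ^ 4)"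
        unfolding e4
        using I[of 3 1] I[of 2 2] I[of 1 3] Suc(1) intx[of 4]
        by (simp del: power_one_right sum.op_ivl_Suc)
      then show ?thesis
        using E[of 3 1] E[of 2 2] E[of 1 3] EZ Ex by (simp del: power_one_right sum.op_ivl_Suc)
    qed
    also have "\<dots> \<le> 3 * (real N)\<^sup>2 * v\<^sup>2 + real N * q + 6 * (real N * v * v) + q"
      using Suc(4) by simp
    also have "\<dots> \<le> 3 * (real (Suc N))\<^sup>2 * v\<^sup>2 + real (Suc N) * q"
      by (simp add: power2_eq_square algebra_simps)
    finally show ?case . }
qed

text \<open>This is the Paley-Zygmund inequality, with an elementary bound in place of Cauchy-Schwarz.\<close>

lemma prob_block_small:
  assumes N: "q \<le> real N * v\<^sup>2" "0 < N" and c: "2 * c\<^sup>2 \<le> real N * v"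
  shows "prob {\<omega> \<in> space M. \<bar>Z k N \<omega>\<bar> < c} \<le> 15 / 16"
proof -
  define m where "m = real N * v"
  have m: "0 < m" using N v_pos by (simp add: m_def)
  have [measurable]: "{\<omega> \<in> space M. m / 2 \<le> (Z k N \<omega>)\<^sup>2} \<in> events" by measurable
  have int2: "integrable M (\<lambda>\<omega>. (Z k N \<omega>)\<^sup>2)"
    using integrable_power_le_4[OF _ block_moments(1)[of k N], of 2] by simp
  \<comment> \<open>For large \<open>z\<close> this is \<open>(z - 8 * m)^2 \<ge> 0\<close>. It is
    applied to the square of the block sum, whose mean is \<open>m\<close>.\<close>
  have pt: "z \<le> m / 2 + z\<^sup>2 / (16 * m) + 4 * m * (if m / 2 \<le> z then 1 else 0)" if "0 \<le> z" for z :: real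
  proof (cases "m / 2 \<le> z")
    case True
    have "z * (16 * m) \<le> z\<^sup>2 + 4 * m * (16 * m)"
      using zero_le_power2[of "z - 8 * m"] by (simp add: power2_eq_square algebra_simps)
    then have "z \<le> (z\<^sup>2 + 4 * m * (16 * m)) / (16 * m)" using m by (simp add: pos_le_divide_eq)
    also have "\<dots> = z\<^sup>2 / (16 * m) + 4 * m" using m by (simp add: field_simps)
    finally show ?thesis using True m by simp
  next
    case False
    then show ?thesis using m by (simp add: add_increasing2)
  qed
  have "m = expectation (\<lambda>\<omega>. (Z k N \<omega>)\<^sup>2)" using block_moments(3) by (simp add: m_def)
  also have "\<dots> \<le> expectation (\<lambda>\<omega>. m / 2 + Z k N \<omega> ^ 4 / (16 * m) +
      4 * m * indicator {\<omega> \<in> space M. m / 2 \<le> (Z k N \<omega>)\<^sup>2} \<omega>)"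
  proof (intro integral_mono int2)
    show "(Z k N \<omega>)\<^sup>2 \<le> m / 2 + Z k N \<omega> ^ 4 / (16 * m) +
      4 * m * indicator {\<omega> \<in> space M. m / 2 \<le> (Z k N \<omega>)\<^sup>2} \<omega>" if "\<omega> \<in> space M" for \<omega>
      using pt[of "(Z k N \<omega>)\<^sup>2"] that
      by (cases "m / 2 \<le> (Z k N \<omega>)\<^sup>2") (simp_all flip: power_mult)
  qed (use block_moments(1) in \<open>auto simp: emeasure_eq_measure\<close>)
  also have "\<dots> = m / 2 + expectation (\<lambda>\<omega>. Z k N \<omega> ^ 4) / (16 * m) +
      4 * m * prob {\<omega> \<in> space M. m / 2 \<le> (Z k N \<omega>)\<^sup>2}"
    using block_moments(1)[of k N] by (simp add: prob_space emeasure_eq_measure)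
  \<comment> \<open>Blocks are long enough for \<open>q \<le> N * v^2\<close>, so the fourth moment
    is at most \<open>4 * m^2\<close>. Then \<open>m \<le> m / 2 + m / 4 + 4 * m * p\<close>, which
    gives \<open>p \<ge> 1 / 16\<close>.\<close>
  also have "expectation (\<lambda>\<omega>. Z k N \<omega> ^ 4) / (16 * m) \<le> (4 * m\<^sup>2) / (16 * m)"
  proof (rule divide_right_mono)
    have "real N * q \<le> real N * (real N * v\<^sup>2)" using N by (intro mult_left_mono) auto
    then show "expectation (\<lambda>\<omega>. Z k N \<omega> ^ 4) \<le> 4 * m\<^sup>2"
      using block_moments(4)[of k N] by (simp add: m_def power2_eq_square algebra_simps)
  qed (use m in simp)
  also have "(4 * m\<^sup>2) / (16 * m) = m / 4" using m by (simp add: power2_eq_square)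
  finally have "m * (1 / 16) \<le> m * prob {\<omega> \<in> space M. m / 2 \<le> (Z k N \<omega>)\<^sup>2}" by simp
  then have p: "1 / 16 \<le> prob {\<omega> \<in> space M. m / 2 \<le> (Z k N \<omega>)\<^sup>2}" using m by (simp only: mult_le_cancel_left_pos)
  have "prob {\<omega> \<in> space M. \<bar>Z k N \<omega>\<bar> < c} \<le> prob (space M - {\<omega> \<in> space M. m / 2 \<le> (Z k N \<omega>)\<^sup>2})"
  proof (rule finite_measure_mono)
    show "{\<omega> \<in> space M. \<bar>Z k N \<omega>\<bar> < c} \<subseteq> space M - {\<omega> \<in> space M. m / 2 \<le> (Z k N \<omega>)\<^sup>2}"
    proof safe
      fix \<omega> assume z: "\<bar>Z k N \<omega>\<bar> < c" "m / 2 \<le> (Z k N \<omega>)\<^sup>2"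
      have "\<bar>Z k N \<omega>\<bar>\<^sup>2 < c\<^sup>2" using z(1) by (intro power_strict_mono) auto
      then show False using z(2) c by (simp add: m_def)
    qed
  qed measurable
  also have "\<dots> = 1 - prob {\<omega> \<in> space M. m / 2 \<le> (Z k N \<omega>)\<^sup>2}" by (rule prob_compl) measurable
  finally show ?thesis using p by simp
qed

lemma prob_blocks_small:
  assumes N: "q \<le> real N * v\<^sup>2" "0 < N" and c: "2 * c\<^sup>2 \<le> real N * v"
  shows "prob {\<omega> \<in> space M. \<forall>j<J. \<bar>Z (j * N) N \<omega>\<bar> < c} \<le> (15 / 16) ^ J"
proof (induction J)
  case (Suc J)
  let ?A = "{..<J * N}" and ?B = "{J * N..<J * N + N}"
  define P where "P x \<longleftrightarrow> (\<forall>j\<in>{..<J}. \<bar>\<Sum>i\<in>{j * N..<j * N + N}. x i\<bar> < c)" for x :: "nat \<Rightarrow> real"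
  define R where "R x \<longleftrightarrow> \<bar>\<Sum>i\<in>?B. x i\<bar> < c" for x :: "nat \<Rightarrow> real"
  have sub: "i < J * N" if "j < J" "i < j * N + N" for i j
  proof -
    have "j * N + N = (j + 1) * N" by simp
    also have "\<dots> \<le> J * N" using that by (intro mult_right_mono) auto
    finally show ?thesis using that by simp
  qed
  have P: "P (\<lambda>i\<in>?A. \<xi> i \<omega>) \<longleftrightarrow> (\<forall>j<J. \<bar>Z (j * N) N \<omega>\<bar> < c)" for \<omega>
    unfolding P_def using sub by (auto intro!: ball_cong arg_cong2[where f="(<)"] sum.cong arg_cong[where f=abs])
  have R: "R (\<lambda>i\<in>?B. \<xi> i \<omega>) \<longleftrightarrow> \<bar>Z (J * N) N \<omega>\<bar> < c" for \<omega> by (simp add: R_def)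
  have [measurable]: "(\<lambda>x. \<Sum>i\<in>{j * N..<j * N + N}. x i) \<in> borel_measurable (PiM ?A (\<lambda>_. borel :: real measure))"
    if "j \<in> {..<J}" for j
    using that sub by (intro borel_measurable_sum measurable_component_singleton) auto
  have mP: "Measurable.pred (PiM ?A (\<lambda>_. borel)) P" unfolding P_def by measurable
  have [measurable]: "(\<lambda>x. \<Sum>i\<in>?B. x i) \<in> borel_measurable (PiM ?B (\<lambda>_. borel :: real measure))"
    by (intro borel_measurable_sum measurable_component_singleton) auto
  have mR: "Measurable.pred (PiM ?B (\<lambda>_. borel)) R" unfolding R_def by measurable
  have "prob {\<omega> \<in> space M. \<forall>j<Suc J. \<bar>Z (j * N) N \<omega>\<bar> < c} =
      prob {\<omega> \<in> space M. P (\<lambda>i\<in>?A. \<xi> i \<omega>) \<and> R (\<lambda>i\<in>?B. \<xi> i \<omega>)}"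
    unfolding P R by (intro arg_cong[where f=prob]) (auto simp: less_Suc_eq)
  also have "\<dots> = prob {\<omega> \<in> space M. P (\<lambda>i\<in>?A. \<xi> i \<omega>)} * prob {\<omega> \<in> space M. R (\<lambda>i\<in>?B. \<xi> i \<omega>)}"
    by (rule prob_block_conj[OF indep _ mP mR]) auto
  also have "\<dots> \<le> (15 / 16) ^ J * (15 / 16)"
    unfolding P R using Suc.IH prob_block_small[OF N c] by (intro mult_mono) auto
  finally show ?case by simp
qed (simp add: prob_space)

text \<open>Below \<open>x\<close>, the walk can leave the interval from \<open>- w\<close> to
  \<open>w\<close> only at the bottom, and this is a plunge from level 0. If it never leaves, every
  block increment is below \<open>2 * w\<close>; applying the block estimate to \<open>2 * w\<close>
  accounts for the 8 in the hypothesis.\<close>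

lemma prob_not_reach_le:
  assumes x: "0 < x" "x \<le> w" and K: "0 < K" and N: "q \<le> real N * v\<^sup>2" "0 < N"
    and w: "8 * w\<^sup>2 \<le> real N * v" and T: "J * N \<le> T"
  shows "prob {\<omega> \<in> space M. \<forall>k\<le>T. W k \<omega> < x} \<le> (x + K + real T * q / K ^ 3) / w + (15 / 16) ^ J"
proof -
  let ?P = "{\<omega> \<in> space M. plunges (\<lambda>k. W k \<omega>) T 0 x w}"
  let ?B = "{\<omega> \<in> space M. \<forall>j<J. \<bar>Z (j * N) N \<omega>\<bar> < 2 * w}"
  have ev: "?P \<in> events" "?B \<in> events" unfolding plunges_def by measurable
  have "{\<omega> \<in> space M. \<forall>k\<le>T. W k \<omega> < x} \<subseteq> ?P \<union> ?B"
  proof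
    fix \<omega> assume \<omega>: "\<omega> \<in> {\<omega> \<in> space M. \<forall>k\<le>T. W k \<omega> < x}"
    show "\<omega> \<in> ?P \<union> ?B"
    proof (cases "\<forall>k\<le>T. \<bar>W k \<omega>\<bar> < w")
      case True
      have "\<bar>Z (j * N) N \<omega>\<bar> < 2 * w" if "j < J" for j
      proof -
        have "j * N + N = (j + 1) * N" by simp
        also have "\<dots> \<le> J * N" using that by (intro mult_right_mono) auto
        finally have "j * N + N \<le> T" using T by simp
        then have "\<bar>W (j * N + N) \<omega>\<bar> < w" "\<bar>W (j * N) \<omega>\<bar> < w" using True by auto
        moreover have "W (j * N + N) \<omega> = W (j * N) \<omega> + Z (j * N) N \<omega>"
          by (subst sum.atLeastLessThan_concat[of 0 "j * N" "j * N + N", symmetric, folded lessThan_atLeast0]) auto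
        ultimately show ?thesis by linarith
      qed
      then show ?thesis using \<omega> by auto
    next
      case False
      then obtain k where k: "k \<le> T" "w \<le> \<bar>W k \<omega>\<bar>" by (auto simp: not_less)
      have "W k \<omega> < x" using \<omega> k by blast
      then have "W k \<omega> \<le> - w" using k x by linarith
      moreover have "k \<noteq> 0" using k x by (intro notI) simp
      ultimately have "plunges (\<lambda>k. W k \<omega>) T 0 x w"
        unfolding plunges_def using \<omega> k by (intro exI[of _ 0] exI[of _ k]) auto
      then show ?thesis using \<omega> by auto
    qed
  qed
  then have "prob {\<omega> \<in> space M. \<forall>k\<le>T. W k \<omega> < x} \<le> prob (?P \<union> ?B)"
    using ev by (intro finite_measure_mono) auto
  also have "\<dots> \<le> prob ?P + prob ?B" using ev by (rule measure_Un_le)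
  also have "prob ?P \<le> (x + K + real T * q / K ^ 3) / w"
    using x K by (intro prob_plunges_le) auto
  also have "prob ?B \<le> (15 / 16) ^ J"
    using w N by (intro prob_blocks_small) (auto simp: power2_eq_square)
  finally show ?thesis by simp
qed

end

section \<open>Estimates at the scale of n\<close>

lemma (in walk_steps) q_nonneg: "0 \<le> q"
  using fourth(2)[of 0] by (auto intro!: integral_nonneg_AE simp flip: fourth(2)[of 0])

text \<open>Within \<open>L\<^sup>2 l / v\<close> steps the walk leaves an interval of width \<open>L sqrt (l / \<rho>) / 10\<close> except with
  probability \<open>1 / sqrt l\<close>, and it does so at the bottom with probability at most
  \<open>40 sqrt (\<rho> / l)\<close>.\<close>

lemma (in walk_steps) prob_not_reach_scaled:
  fixes L l \<rho> x :: real
  defines "T \<equiv> nat \<lfloor>L\<^sup>2 * l / v\<rfloor>"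
  assumes L: "0 < L" and l: "1 \<le> \<rho>" "l = exp \<rho>" "400 * \<rho> \<le> l"
    and N_large: "q / v\<^sup>2 + 1 \<le> (L\<^sup>2 * l / v - 1) / (9 * \<rho>) - 1"
    and w_large: "L\<^sup>2 * l / (100 * \<rho>) \<le> v * ((L\<^sup>2 * l / v - 1) / (9 * \<rho>) - 1) / 8"
    and K_large: "l * q / v \<le> L\<^sup>2"
    and x: "0 < x" "x \<le> 2 * L"
  shows "prob {\<omega> \<in> space M. \<forall>k\<le>T. W k \<omega> < x} \<le> 41 * sqrt (\<rho> / l)"
proof -
  \<comment> \<open>With this many blocks, \<open>(15 / 16) ^ J \<le> exp (- J / 16) \<le> exp (-
    \<rho> / 2) = 1 / sqrt l\<close>.\<close>
  define J where "J = nat \<lceil>8 * \<rho>\<rceil>"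
  define N where "N = T div J"
  \<comment> \<open>The largest value that \<open>8 * w^2 \<le> N * v\<close> permits. As
    \<open>N\<close> is at least about \<open>L^2 * l / (9 * v * \<rho>)\<close>, the lower bound
    for \<open>w^2\<close> is about \<open>L^2 * l / (72 * \<rho>)\<close>; the 100 in
    \<open>w_large\<close> absorbs the rounding.\<close>
  define w where "w = sqrt (real N * v / 8)"
  have l0: "0 < l" using l by simp
  have J: "8 * \<rho> \<le> real J" "real J \<le> 9 * \<rho>" "0 < J" using l(1) unfolding J_def by (simp, linarith, simp)
  have T: "L\<^sup>2 * l / v - 1 \<le> real T" "real T \<le> L\<^sup>2 * l / v"
  proof -
    have "0 \<le> L\<^sup>2 * l / v" using l0 v_pos by simp
    then have "real T = of_int \<lfloor>L\<^sup>2 * l / v\<rfloor>" unfolding T_def by simp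
    then show "L\<^sup>2 * l / v - 1 \<le> real T" "real T \<le> L\<^sup>2 * l / v" by linarith+
  qed
  have "T < J * (N + 1)" using dividend_less_times_div[of J T] J(3) unfolding N_def by simp
  then have "real T < real J * (real N + 1)" by (metis of_nat_1 of_nat_add of_nat_less_iff of_nat_mult)
  also have "\<dots> \<le> 9 * \<rho> * (real N + 1)" using J by (intro mult_right_mono) auto
  finally have "real T / (9 * \<rho>) < real N + 1" using l(1) by (simp add: field_simps)
  moreover have "(L\<^sup>2 * l / v - 1) / (9 * \<rho>) \<le> real T / (9 * \<rho>)"
    using T l(1) by (intro divide_right_mono) auto
  ultimately have N: "(L\<^sup>2 * l / v - 1) / (9 * \<rho>) - 1 \<le> real N" by linarith
  have q0: "0 \<le> q / v\<^sup>2" using q_nonneg by simp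
  have N1: "0 < N" using N N_large q0 by linarith
  have N2: "q \<le> real N * v\<^sup>2" using N N_large v_pos by (simp add: pos_divide_le_eq[symmetric])
  have "L\<^sup>2 * l / (100 * \<rho>) \<le> v * real N / 8"
    using w_large N v_pos by (smt (verit) divide_right_mono mult_left_mono)
  then have "sqrt (L\<^sup>2 * l / (100 * \<rho>)) \<le> w" unfolding w_def by (simp add: mult.commute)
  moreover have "sqrt (L\<^sup>2 * l / (100 * \<rho>)) = L / 10 * sqrt (l / \<rho>)"
    using L by (simp add: real_sqrt_mult real_sqrt_divide)
  ultimately have w: "L / 10 * sqrt (l / \<rho>) \<le> w" by simp
  \<comment> \<open>The hypothesis \<open>400 * \<rho> \<le> l\<close> serves to make
    \<open>w\<close> at least \<open>2 * L\<close>, hence at least \<open>x\<close>.\<close>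
  have "20 = sqrt 400" by simp
  also have "\<dots> \<le> sqrt (l / \<rho>)" using l by (intro real_sqrt_le_mono) (simp add: field_simps)
  finally have "L / 10 * 20 \<le> L / 10 * sqrt (l / \<rho>)" using L by (intro mult_left_mono) auto
  then have xw: "x \<le> w" using w x by linarith
  have KT: "real T * q / L ^ 3 \<le> L"
  proof -
    have "real T * q \<le> L\<^sup>2 * l / v * q" using T q_nonneg by (intro mult_right_mono)
    also have "\<dots> = L\<^sup>2 * (l * q / v)" by simp
    also have "\<dots> \<le> L\<^sup>2 * L\<^sup>2" using K_large by (intro mult_left_mono) auto
    also have "\<dots> = L * L ^ 3" by (simp add: power_numeral_reduce)
    finally show ?thesis using L by (simp add: pos_divide_le_eq)
  qed
  have "(x + L + real T * q / L ^ 3) / w \<le> 4 * L / (L / 10 * sqrt (l / \<rho>))"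
    using x L KT w l l0 q_nonneg by (intro frac_le) (auto intro!: mult_pos_pos)
  also have "\<dots> = 40 * sqrt (\<rho> / l)" using L l l0 by (simp add: real_sqrt_divide field_simps)
  finally have 1: "(x + L + real T * q / L ^ 3) / w \<le> 40 * sqrt (\<rho> / l)" .
  have "(15 / 16) ^ J \<le> exp (- 1 / 16 :: real) ^ J"
    using exp_ge_add_one_self[of "- 1 / 16"] by (intro power_mono) auto
  also have "\<dots> = exp (- (real J / 16))" by (simp flip: exp_of_nat_mult)
  also have "\<dots> \<le> exp (- (\<rho> / 2))" using J by simp
  also have "\<dots> = 1 / sqrt l"
  proof -
    have "sqrt (exp \<rho>) = exp (\<rho> / 2)" by (rule real_sqrt_unique) (simp_all add: power2_eq_square flip: exp_add)
    then show ?thesis using l(2) by (simp add: exp_minus field_simps)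
  qed
  also have "\<dots> \<le> sqrt \<rho> / sqrt l" using l(1) l0 by (intro divide_right_mono) auto
  finally have 2: "(15 / 16) ^ J \<le> sqrt (\<rho> / l)" by (simp add: real_sqrt_divide)
  have "prob {\<omega> \<in> space M. \<forall>k\<le>T. W k \<omega> < x} \<le> (x + L + real T * q / L ^ 3) / w + (15 / 16) ^ J"
  proof (rule prob_not_reach_le[OF x(1) xw L N2 N1])
    show "8 * w\<^sup>2 \<le> real N * v" unfolding w_def using v_pos by simp
    show "J * N \<le> T" unfolding N_def by simp
  qed
  then show ?thesis using 1 2 by simp
qed

text \<open>With truncation at \<open>K = L / l\<close> the numerator of
  \<open>prob_plunges_le\<close> is at most four meshes \<open>L / l\<close>, two for the tolerance
  and one each for \<open>K\<close> and the tail; the fall is at least \<open>L / 2\<close>.\<close>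

lemma (in walk_steps) prob_plunges_scaled:
  fixes L l h :: real
  defines "T \<equiv> nat \<lfloor>L\<^sup>2 * l / v\<rfloor>"
  assumes L: "0 < L" and l: "2 \<le> l" and K_large: "q * l ^ 5 / v \<le> L\<^sup>2"
  shows "prob {\<omega> \<in> space M. plunges (\<lambda>k. W k \<omega>) T h (2 * (1 / l) * L) ((1 - 1 / l) * L)} \<le> 8 / l"
proof -
  have T: "real T \<le> L\<^sup>2 * l / v" using L l v_pos unfolding T_def by simp
  have d: "1 / 2 * L \<le> (1 - 1 / l) * L" using l L by (intro mult_right_mono) (auto simp: field_simps)
  have "real T * q / (L / l) ^ 3 \<le> L\<^sup>2 * l / v * q / (L / l) ^ 3"
    using T q_nonneg L l by (intro divide_right_mono mult_right_mono) auto
  also have "\<dots> = (q * l ^ 5 / v) / (L * l)"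
    using L l v_pos by (simp add: field_simps power_numeral_reduce)
  also have "\<dots> \<le> L\<^sup>2 / (L * l)" using K_large L l by (intro divide_right_mono) auto
  also have "\<dots> = L / l" using L by (simp add: power2_eq_square)
  finally have KT: "real T * q / (L / l) ^ 3 \<le> L / l" .
  have "prob {\<omega> \<in> space M. plunges (\<lambda>k. W k \<omega>) T h (2 * (1 / l) * L) ((1 - 1 / l) * L)} \<le>
      (2 * (1 / l) * L + L / l + real T * q / (L / l) ^ 3) / ((1 - 1 / l) * L)"
    using L l by (intro prob_plunges_le) auto
  also have "\<dots> \<le> (4 * (L / l)) / (1 / 2 * L)"
    using KT d L l q_nonneg by (intro frac_le) (auto intro!: add_nonneg_nonneg)
  also have "\<dots> = 8 / l" using L by simp
  finally show ?thesis .
qed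

text \<open>All dependence of the threshold on \<open>\<gamma>\<close>, \<open>v\<close> and
  \<open>q\<close> is collected here. The eighth condition yields \<open>2 * g \<le> 1 / l\<close>,
  the ninth makes the ties negligible (36864 is the square of 192), and the last makes the
  half-width of the box at least 2.\<close>

lemma eventually_scales:
  fixes \<gamma> v q :: real
  assumes "0 < \<gamma>" "0 < v" "0 \<le> q"
  shows "\<forall>\<^sub>F n :: nat in sequentially. 1 < real n"
    "\<forall>\<^sub>F n :: nat in sequentially. 1 \<le> ln (ln (ln (real n)))"
    "\<forall>\<^sub>F n :: nat in sequentially. 400 * ln (ln (ln (real n))) \<le> ln (ln (real n))"
    "\<forall>\<^sub>F n :: nat in sequentially. q / v\<^sup>2 + 1 \<le> ((ln (real n))\<^sup>2 * ln (ln (real n)) / v - 1) / (9 * ln (ln (ln (real n)))) - 1"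
    "\<forall>\<^sub>F n :: nat in sequentially. (ln (real n))\<^sup>2 * ln (ln (real n)) / (100 * ln (ln (ln (real n))))
      \<le> v * (((ln (real n))\<^sup>2 * ln (ln (real n)) / v - 1) / (9 * ln (ln (ln (real n)))) - 1) / 8"
    "\<forall>\<^sub>F n :: nat in sequentially. ln (ln (real n)) * q / v \<le> (ln (real n))\<^sup>2"
    "\<forall>\<^sub>F n :: nat in sequentially. q * ln (ln (real n)) ^ 5 / v \<le> (ln (real n))\<^sup>2"
    "\<forall>\<^sub>F n :: nat in sequentially. 2 * \<gamma> * (ln (ln (real n)))\<^sup>2 \<le> ln (real n)"
    "\<forall>\<^sub>F n :: nat in sequentially. 36864 \<le> ln (ln (ln (real n))) * ln (ln (real n))"
    "\<forall>\<^sub>F n :: nat in sequentially. 2 * v \<le> (ln (real n))\<^sup>2 * ln (ln (real n))"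
  subgoal by real_asymp
  subgoal by real_asymp
  subgoal by real_asymp
  subgoal using assms by real_asymp
  subgoal using assms by real_asymp
  subgoal using assms by real_asymp
  subgoal using assms by real_asymp
  subgoal using assms by real_asymp
  subgoal by real_asymp
  subgoal using assms by real_asymp
  done

section \<open>The potential of a random environment\<close>

text \<open>Fourth power of \<open>y \<le> exp y\<close> at
  \<open>y = \<kappa> * \<bar>x\<bar> / 4\<close>.\<close>

lemma power4_le_exp:
  fixes x \<kappa> :: real
  assumes "0 < \<kappa>"
  shows "x ^ 4 \<le> (4 / \<kappa>) ^ 4 * (exp (\<kappa> * x) + exp (- \<kappa> * x))"
proof -
  have "(\<kappa> * \<bar>x\<bar> / 4) ^ 4 \<le> exp (\<kappa> * \<bar>x\<bar> / 4) ^ 4"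
  proof (rule power_mono)
    show "\<kappa> * \<bar>x\<bar> / 4 \<le> exp (\<kappa> * \<bar>x\<bar> / 4)"
      using exp_ge_add_one_self[of "\<kappa> * \<bar>x\<bar> / 4"] by linarith
  qed (use assms in simp)
  also have "\<dots> = exp (\<kappa> * \<bar>x\<bar>)" by (simp flip: exp_of_nat_mult)
  also have "\<dots> \<le> exp (\<kappa> * x) + exp (- \<kappa> * x)" by (cases "0 \<le> x") auto
  finally have "(4 / \<kappa>) ^ 4 * (\<kappa> * \<bar>x\<bar> / 4) ^ 4 \<le> (4 / \<kappa>) ^ 4 * (exp (\<kappa> * x) + exp (- \<kappa> * x))"
    using assms by (intro mult_left_mono) auto
  moreover have "(4 / \<kappa>) ^ 4 * (\<kappa> * \<bar>x\<bar> / 4) ^ 4 = x ^ 4"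
    using assms by (simp flip: power_mult_distrib)
  ultimately show ?thesis by simp
qed

context random_environment
begin

lemma measurable_alpha [measurable]: "(\<lambda>\<omega>. \<alpha> \<omega> i) \<in> borel_measurable Q"
  using indep unfolding indep_vars_def by auto

lemma measurable_eps [measurable]: "(\<lambda>\<omega>. eps (\<alpha> \<omega>) i) \<in> borel_measurable Q"
  unfolding eps_def by measurable

lemma indep_eps: "indep_vars (\<lambda>_. borel) (\<lambda>i \<omega>. eps (\<alpha> \<omega>) i) UNIV"
  unfolding eps_def by (rule indep_vars_compose2[OF indep]) measurable

lemma
  fixes f :: "real \<Rightarrow> real"
  assumes [measurable]: "f \<in> borel_measurable borel"
  shows integrable_eps_iff: "integrable Q (\<lambda>\<omega>. f (eps (\<alpha> \<omega>) i)) \<longleftrightarrow> integrable Q (\<lambda>\<omega>. f (eps (\<alpha> \<omega>) 0))"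
    and expectation_eps: "expectation (\<lambda>\<omega>. f (eps (\<alpha> \<omega>) i)) = expectation (\<lambda>\<omega>. f (eps (\<alpha> \<omega>) 0))"
proof -
  have 1: "integrable Q (\<lambda>\<omega>. f (eps (\<alpha> \<omega>) i)) \<longleftrightarrow>
      integrable (distr Q borel (\<lambda>\<omega>. \<alpha> \<omega> i)) (\<lambda>x. f (ln ((1 - x) / x)))" for i
    unfolding eps_def by (subst integrable_distr_eq) auto
  show "integrable Q (\<lambda>\<omega>. f (eps (\<alpha> \<omega>) i)) \<longleftrightarrow> integrable Q (\<lambda>\<omega>. f (eps (\<alpha> \<omega>) 0))"
    unfolding 1[of i] 1[of 0] identically_distributed[of i] ..
  have 2: "expectation (\<lambda>\<omega>. f (eps (\<alpha> \<omega>) i)) =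
      integral\<^sup>L (distr Q borel (\<lambda>\<omega>. \<alpha> \<omega> i)) (\<lambda>x. f (ln ((1 - x) / x)))" for i
    unfolding eps_def by (subst integral_distr) auto
  show "expectation (\<lambda>\<omega>. f (eps (\<alpha> \<omega>) i)) = expectation (\<lambda>\<omega>. f (eps (\<alpha> \<omega>) 0))"
    unfolding 2[of i] 2[of 0] identically_distributed[of i] ..
qed

lemma integrable_eps_power4: "integrable Q (\<lambda>\<omega>. eps (\<alpha> \<omega>) 0 ^ 4)"
proof -
  obtain \<kappa>0 where \<kappa>0: "\<kappa>0 > 0" "\<forall>\<kappa>\<in>{0<..<\<kappa>0}. integrable Q (\<lambda>\<omega>. exp (\<kappa> * eps (\<alpha> \<omega>) 0)) \<and>
        integrable Q (\<lambda>\<omega>. exp (- \<kappa> * eps (\<alpha> \<omega>) 0))"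
    using exp_moments by blast
  define \<kappa> where "\<kappa> = \<kappa>0 / 2"
  have \<kappa>: "\<kappa> > 0" "integrable Q (\<lambda>\<omega>. exp (\<kappa> * eps (\<alpha> \<omega>) 0))" "integrable Q (\<lambda>\<omega>. exp (- \<kappa> * eps (\<alpha> \<omega>) 0))"
    using \<kappa>0(1) \<kappa>0(2)[rule_format, of \<kappa>] by (auto simp: \<kappa>_def)
  show ?thesis
  proof (rule Bochner_Integration.integrable_bound)
    show "integrable Q (\<lambda>\<omega>. (4 / \<kappa>) ^ 4 * (exp (\<kappa> * eps (\<alpha> \<omega>) 0) + exp (- \<kappa> * eps (\<alpha> \<omega>) 0)))"
      using \<kappa> by (intro integrable_mult_right Bochner_Integration.integrable_add)
    show "AE \<omega> in Q. norm (eps (\<alpha> \<omega>) 0 ^ 4) \<le>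
        norm ((4 / \<kappa>) ^ 4 * (exp (\<kappa> * eps (\<alpha> \<omega>) 0) + exp (- \<kappa> * eps (\<alpha> \<omega>) 0)))"
    proof (intro AE_I2)
      fix \<omega>
      show "norm (eps (\<alpha> \<omega>) 0 ^ 4) \<le>
        norm ((4 / \<kappa>) ^ 4 * (exp (\<kappa> * eps (\<alpha> \<omega>) 0) + exp (- \<kappa> * eps (\<alpha> \<omega>) 0)))"
        using power4_le_exp[OF \<kappa>(1), of "eps (\<alpha> \<omega>) 0"] by (simp add: abs_mult)
    qed
  qed measurable
qed

definition fourth_moment :: real where
  "fourth_moment = expectation (\<lambda>\<omega>. eps (\<alpha> \<omega>) 0 ^ 4)"

lemma sigma_pos: "0 < sigma Q \<alpha>" and sigma_square: "(sigma Q \<alpha>)\<^sup>2 = expectation (\<lambda>\<omega>. (eps (\<alpha> \<omega>) 0)\<^sup>2)"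
  using variance_pos by (auto simp: sigma_def)

lemma walk_steps_side:
  assumes "inj (p :: nat \<Rightarrow> int)" "s = 1 \<or> s = - 1"
  shows "walk_steps Q (\<lambda>i \<omega>. s * eps (\<alpha> \<omega>) (p i)) ((sigma Q \<alpha>)\<^sup>2) fourth_moment"
proof
  have "indep_vars (\<lambda>i. PiM {p i} (\<lambda>_. borel)) (\<lambda>i \<omega>. \<lambda>j\<in>{p i}. eps (\<alpha> \<omega>) j) UNIV"
    using assms(1) by (intro indep_vars_restrict[OF indep_eps]) (auto simp: disjoint_family_on_def inj_def)
  then have "indep_vars (\<lambda>_. borel) (\<lambda>i \<omega>. (\<lambda>x. s * x (p i)) (\<lambda>j\<in>{p i}. eps (\<alpha> \<omega>) j)) UNIV"
    by (rule indep_vars_compose2) (intro borel_measurable_times measurable_component_singleton measurable_const, auto)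
  then show "indep_vars (\<lambda>_. borel) (\<lambda>i \<omega>. s * eps (\<alpha> \<omega>) (p i)) UNIV" by simp
  have s: "s ^ 4 = 1" "s\<^sup>2 = 1" using assms(2) by auto
  show "integrable Q (\<lambda>\<omega>. (s * eps (\<alpha> \<omega>) (p i)) ^ 4)" for i
    using integrable_eps_iff[of "\<lambda>x. x ^ 4" "p i"] integrable_eps_power4 by (simp add: power_mult_distrib s)
  show "expectation (\<lambda>\<omega>. (s * eps (\<alpha> \<omega>) (p i)) ^ 4) = fourth_moment" for i
    using expectation_eps[of "\<lambda>x. x ^ 4" "p i"] by (simp add: power_mult_distrib s fourth_moment_def)
  show "expectation (\<lambda>\<omega>. s * eps (\<alpha> \<omega>) (p i)) = 0" for i
    using expectation_eps[of "\<lambda>x. x" "p i"] centred by simp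
  show "expectation (\<lambda>\<omega>. (s * eps (\<alpha> \<omega>) (p i))\<^sup>2) = (sigma Q \<alpha>)\<^sup>2" for i
    using expectation_eps[of "\<lambda>x. x\<^sup>2" "p i"] by (simp add: power_mult_distrib s sigma_square)
  show "0 < (sigma Q \<alpha>)\<^sup>2" using sigma_pos by simp
qed

end

section \<open>The two halves of the potential as walks\<close>

lemma S_int_right: "S_int a (int k) = (\<Sum>i<k. eps a (int i + 1))"
proof (induction k)
  case (Suc k)
  then show ?case using S_int_rec[of a "int k + 1"] by (simp add: add.commute)
qed (simp add: S_int_def)

lemma S_int_left: "S_int a (- int k) = (\<Sum>i<k. - eps a (- int i))"
proof (induction k)
  case (Suc k)
  moreover have "- int (Suc k) = - int k - 1" by simp
  ultimately show ?case using S_int_rec[of a "- int k"] by (simp only: sum.lessThan_Suc)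
qed (simp add: S_int_def)

lemma S_real_of_int [simp]: "S_real a (of_int k) = S_int a k"
  by (simp add: S_real_def)

lemma polygon_Sn: "polygon (Sn a n)"
proof
  fix k :: int and t :: real assume k: "of_int k \<le> t" "t \<le> of_int k + 1"
  have "S_real a (of_int k + 1) = S_int a (k + 1)"
    using S_real_of_int[of a "k + 1"] by simp
  moreover have "S_real a t = S_int a k + (t - of_int k) * (S_int a (k + 1) - S_int a k)"
  proof (cases "t = of_int k + 1")
    case True
    then show ?thesis using calculation by simp
  next
    case False
    then have "\<lfloor>t\<rfloor> = k" using k by linarith
    then show ?thesis by (simp add: S_real_def frac_def)
  qed
  ultimately show "Sn a n t = Sn a n (of_int k) + (t - of_int k) * (Sn a n (of_int k + 1) - Sn a n (of_int k))"
    by (simp add: Sn_def add_divide_distrib diff_divide_distrib right_diff_distrib)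
qed

lemma Sn_right: "Sn a n (real k) = S_int a (int k) / ln (real n)"
  using S_real_of_int[of a "int k"] by (simp add: Sn_def)

lemma Sn_left: "Sn a n (- real k) = S_int a (- int k) / ln (real n)"
  using S_real_of_int[of a "- int k"] by (simp add: Sn_def)

lemma plunges_divide:
  assumes "0 < c"
  shows "plunges (\<lambda>k. f k / c) T h u d \<longleftrightarrow> plunges f T (h * c) (u * c) (d * c)"
proof -
  have "(h \<le> x / c) = (h * c \<le> x)" "(x / c \<le> h - d) = (x \<le> h * c - d * c)"
    "(x / c < h + u) = (x < h * c + u * c)" for x
    using assms by (auto simp: field_simps)
  then show ?thesis unfolding plunges_def by simp
qed

lemma plunges_cong: "(\<And>k. k \<le> T \<Longrightarrow> f k = f' k) \<Longrightarrow> plunges f T h u d = plunges f' T h u d"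
  unfolding plunges_def by (intro ex_cong1 conj_cong refl) (auto intro!: arg_cong2[where f="(\<le>)"])

lemma (in random_environment) prob_plunges_both:
  "prob {\<omega> \<in> space Q. plunges (\<lambda>k. S_int (\<alpha> \<omega>) (int k)) T h u d \<and> plunges (\<lambda>k. S_int (\<alpha> \<omega>) (- int k)) T h u d} =
    prob {\<omega> \<in> space Q. plunges (\<lambda>k. S_int (\<alpha> \<omega>) (int k)) T h u d} *
    prob {\<omega> \<in> space Q. plunges (\<lambda>k. S_int (\<alpha> \<omega>) (- int k)) T h u d}"
proof -
  define A B where "A = {1..int T}" and "B = {- int T<..0}"
  \<comment> \<open>Truncating the sums at \<open>T\<close> makes every partial sum measurable on
    the block \<open>A\<close>, and changes nothing because \<open>plunges\<close> only looks at
    times up to \<open>T\<close>. The step at index 0 belongs to the left half, so the blocks are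
    disjoint.\<close>
  define P where "P x \<longleftrightarrow> plunges (\<lambda>k. \<Sum>i<min k T. x (int i + 1)) T h u d" for x :: "int \<Rightarrow> real"
  define R where "R x \<longleftrightarrow> plunges (\<lambda>k. \<Sum>i<min k T. - x (- int i)) T h u d" for x :: "int \<Rightarrow> real"
  have P: "P (\<lambda>i\<in>A. eps (\<alpha> \<omega>) i) = plunges (\<lambda>k. S_int (\<alpha> \<omega>) (int k)) T h u d" for \<omega>
    unfolding P_def S_int_right by (intro plunges_cong sum.cong) (auto simp: A_def min_def)
  have R: "R (\<lambda>i\<in>B. eps (\<alpha> \<omega>) i) = plunges (\<lambda>k. S_int (\<alpha> \<omega>) (- int k)) T h u d" for \<omega>
    unfolding R_def S_int_left by (intro plunges_cong sum.cong) (auto simp: B_def min_def)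
  have [measurable]: "(\<lambda>x. \<Sum>i<min k T. x (int i + 1)) \<in> borel_measurable (PiM A (\<lambda>_. borel :: real measure))" for k
    by (intro borel_measurable_sum measurable_component_singleton) (auto simp: A_def)
  have mP: "Measurable.pred (PiM A (\<lambda>_. borel)) P" unfolding P_def plunges_def by measurable
  have [measurable]: "(\<lambda>x. \<Sum>i<min k T. - x (- int i)) \<in> borel_measurable (PiM B (\<lambda>_. borel :: real measure))" for k
    by (intro borel_measurable_sum borel_measurable_uminus measurable_component_singleton) (auto simp: B_def)
  have mR: "Measurable.pred (PiM B (\<lambda>_. borel)) R" unfolding R_def plunges_def by measurable
  have "A \<inter> B = {}" by (auto simp: A_def B_def)
  from prob_block_conj[OF indep_eps this mP mR] show ?thesis unfolding P R .
qed

definition confining :: "real \<Rightarrow> 'a measure \<Rightarrow> ('a \<Rightarrow> int \<Rightarrow> real) \<Rightarrow> real \<Rightarrow> nat \<Rightarrow> 'a set \<Rightarrow> bool" where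
  "confining h Q \<alpha> \<gamma> n G \<longleftrightarrow>
     (\<forall>\<omega>\<in>G. \<exists>L m R. basic_valley (\<alpha> \<omega>) n \<gamma> L m R) \<and>
     measure Q G \<ge> 1 - h * sqrt (ln (ln (ln (real n))) / ln (ln (real n))) \<and>
     (SUP (\<omega>, L, m, R) \<in> {(\<omega>, L, m, R). \<omega> \<in> G \<and> basic_valley (\<alpha> \<omega>) n \<gamma> L m R}.
        emeasure (walk_law (\<alpha> \<omega>) 0) (\<Union>k\<in>{0..n}. {X. X k \<notin> {L..R}}))
      \<le> ennreal (2 * ln (ln (real n)) / ((sigma Q \<alpha>)\<^sup>2 * ln (real n) powr (\<gamma> - 2))) \<and>
     (SUP \<omega>\<in>G.
        emeasure (walk_law (\<alpha> \<omega>) 0)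
          (\<Union>k\<in>{0..n}. {X. real_of_int (X k) \<notin>
             {- (ln (real n) / sigma Q \<alpha>)\<^sup>2 * ln (ln (real n)) ..
                (ln (real n) / sigma Q \<alpha>)\<^sup>2 * ln (ln (real n))}}))
      \<le> ennreal (2 * ln (ln (real n)) / ((sigma Q \<alpha>)\<^sup>2 * ln (real n) powr (\<gamma> - 2)))"

lemma confinement_iff_confining:
  "confinement h Q \<alpha> \<longleftrightarrow> (\<forall>\<gamma>>2. \<exists>n\<^sub>0. \<forall>n>n\<^sub>0. \<exists>G\<in>sets Q. confining h Q \<alpha> \<gamma> n G)"
  unfolding confinement_def confining_def ..

section \<open>From a good potential to confinement of the walk\<close>

lemma int_Sup_mem:
  fixes X :: "int set"
  assumes "x \<in> X" "\<And>x. x \<in> X \<Longrightarrow> x \<le> b"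
  shows "Sup X \<in> X" "x \<le> Sup X"
proof -
  have fin: "finite (X \<inter> {x..b})" and ne: "x \<in> X \<inter> {x..b}" using assms by auto
  have "Max (X \<inter> {x..b}) \<in> X \<inter> {x..b}" using fin ne by (intro Max_in) auto
  moreover have "y \<le> Max (X \<inter> {x..b})" if "y \<in> X" for y
  proof (cases "x \<le> y")
    case True
    then show ?thesis using fin that assms by (intro Max_ge) auto
  qed (use Max_ge[OF fin ne] in simp)
  ultimately have "Sup X = Max (X \<inter> {x..b})" "Max (X \<inter> {x..b}) \<in> X"
    by (auto intro!: cSup_eq_maximum)
  then show "Sup X \<in> X" "x \<le> Sup X" using Max_ge[OF fin ne] by auto
qed

lemma int_Inf_mem:
  fixes X :: "int set"
  assumes "x \<in> X" "\<And>x. x \<in> X \<Longrightarrow> b \<le> x"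
  shows "Inf X \<in> X" "Inf X \<le> x"
proof -
  have fin: "finite (X \<inter> {b..x})" and ne: "x \<in> X \<inter> {b..x}" using assms by auto
  have "Min (X \<inter> {b..x}) \<in> X \<inter> {b..x}" using fin ne by (intro Min_in) auto
  moreover have "Min (X \<inter> {b..x}) \<le> y" if "y \<in> X" for y
  proof (cases "y \<le> x")
    case True
    then show ?thesis using fin that assms by (intro Min_le) auto
  qed (use Min_le[OF fin ne] in simp)
  ultimately have "Inf X = Min (X \<inter> {b..x})" "Min (X \<inter> {b..x}) \<in> X"
    by (auto intro!: cInf_eq_minimum)
  then show "Inf X \<in> X" "Inf X \<le> x" using Min_le[OF fin ne] by auto
qed

lemma basic_valley_exists:
  assumes "good_potential (Sn a n) (gamma_n \<gamma> n) \<eta> T"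
  shows "\<exists>L m R. basic_valley a n \<gamma> L m R"
proof -
  interpret good_potential "Sn a n" "gamma_n \<gamma> n" \<eta> T by fact
  obtain l m r where "smallest_valley (Sn a n) (gamma_n \<gamma> n) (l, of_int m, r)"
    using basic_bottom_exists by blast
  then show ?thesis
    unfolding basic_valley_def Let_def using tops_bounded(2,3) by blast
qed

text \<open>The choice of \<open>gamma_n\<close> means
  \<open>exp (- g * ln n) = (ln n) powr - \<gamma>\<close>. In \<open>walk_exit_bound\<close> the
  depth \<open>1 + g\<close> cancels the factor \<open>n\<close> and leaves two such terms. Each of
  the at most \<open>T\<close> resistances between 0 and the bottom costs one more, by the condition
  on the maximum in the definition of the tops; one of the two sums is empty.\<close>

lemma basic_valley_confines:
  assumes gp: "good_potential (Sn a n) (gamma_n \<gamma> n) \<eta> T" and bv: "basic_valley a n \<gamma> L m R"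
    and a: "\<And>i. a i \<in> {0<..<1}" and n: "1 < ln (real n)"
  shows "- int T \<le> L" "R \<le> int T"
    "emeasure (walk_law a 0) (\<Union>k\<in>{0..n}. {X. X k \<notin> {L..R}}) \<le>
      ennreal ((real T + 2) * ln (real n) powr - \<gamma>)"
proof -
  let ?V = "Sn a n" and ?g = "gamma_n \<gamma> n" and ?S = "S_int a" and ?p = "ln (real n) powr - \<gamma>"
  interpret good_potential ?V ?g \<eta> T by fact
  obtain l r where sv: "smallest_valley ?V ?g (l, of_int m, r)"
    and L: "L = Sup (left_tops ?V ?g m)" and R: "R = Inf (right_tops ?V ?g m)"
    using bv unfolding basic_valley_def Let_def by blast
  obtain x y where x: "x \<in> left_tops ?V ?g m" "- int T \<le> x" and y: "y \<in> right_tops ?V ?g m" "y \<le> int T"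
    using tops_bounded[OF sv] by blast
  have "L \<in> left_tops ?V ?g m" "x \<le> L"
    unfolding L using int_Sup_mem[OF x(1), of 0] by (auto simp: left_tops_def)
  then have Lt: "L < m" "?V (of_int L) - ?V (of_int m) \<ge> 1 + ?g" "- int T \<le> L"
    "m > 0 \<Longrightarrow> ?V (of_int L) - (MAX k\<in>{0..m}. ?V (of_int k)) \<ge> ?g"
    using x(2) order_trans unfolding left_tops_def by blast+
  have "R \<in> right_tops ?V ?g m" "R \<le> y"
    unfolding R using int_Inf_mem[OF y(1), of 0] by (auto simp: right_tops_def)
  then have Rt: "m < R" "?V (of_int R) - ?V (of_int m) \<ge> 1 + ?g" "R \<le> int T"
    "m < 0 \<Longrightarrow> ?V (of_int R) - (MAX k\<in>{m..0}. ?V (of_int k)) \<ge> ?g"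
    using y(2) order_trans unfolding right_tops_def by blast+
  show "- int T \<le> L" "R \<le> int T" by fact+
  have S: "?S k = ?V (of_int k) * ln (real n)" for k using n by (simp add: Sn_def)
  have g: "?g * ln (real n) = \<gamma> * ln (ln (real n))" using n by (simp add: gamma_n_def)
  have p: "exp (- (?g * ln (real n))) = ?p" using n by (simp add: g powr_def)
  have n0: "0 < real n" using n by (cases "n = 0") auto
  have expS: "exp (?S i - ?S j) \<le> exp (- (c * ln (real n)))" if "c \<le> ?V (of_int j) - ?V (of_int i)" for i j c
  proof -
    have "c * ln (real n) \<le> (?V (of_int j) - ?V (of_int i)) * ln (real n)"
      using that n by (intro mult_right_mono) auto
    then show ?thesis by (simp add: S algebra_simps)
  qed
  have "exp (- ((1 + ?g) * ln (real n))) = exp (- ln (real n)) * exp (- (?g * ln (real n)))"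
    by (simp add: ring_distribs flip: exp_add)
  then have p1: "exp (- ((1 + ?g) * ln (real n))) = ?p / real n"
    unfolding p using n0 by (simp add: exp_minus field_simps)
  have "exp (?S m - ?S L) + exp (?S m - ?S R) \<le> ?p / real n + ?p / real n"
    using expS[OF Lt(2)] expS[OF Rt(2)] unfolding p1 by (rule add_mono)
  then have "real n * (exp (?S m - ?S L) + exp (?S m - ?S R)) \<le> real n * (?p / real n + ?p / real n)"
    by (intro mult_left_mono) auto
  then have 1: "real n * (exp (?S m - ?S L) + exp (?S m - ?S R)) \<le> 2 * ?p" using n0 by simp
  have left: "exp (?S k - ?S L) \<le> ?p" if "k \<in> {0..<m}" for k
  proof -
    have "?V (of_int k) \<le> (MAX k\<in>{0..m}. ?V (of_int k))" using that by (intro Max_ge) auto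
    moreover have "0 < m" using that by auto
    ultimately have "?g \<le> ?V (of_int L) - ?V (of_int k)" using Lt(4) by linarith
    then show ?thesis unfolding p[symmetric] by (rule expS)
  qed
  have right: "exp (?S k - ?S R) \<le> ?p" if "k \<in> {m..<0}" for k
  proof -
    have "?V (of_int k) \<le> (MAX k\<in>{m..0}. ?V (of_int k))" using that by (intro Max_ge) auto
    moreover have "m < 0" using that by auto
    ultimately have "?g \<le> ?V (of_int R) - ?V (of_int k)" using Rt(4) by linarith
    then show ?thesis unfolding p[symmetric] by (rule expS)
  qed
  have "(\<Sum>k\<in>{0..<m}. exp (?S k - ?S L)) + (\<Sum>k\<in>{m..<0}. exp (?S k - ?S R)) \<le>
      real (card {0..<m}) * ?p + real (card {m..<0}) * ?p"
    using left right by (intro add_mono sum_bounded_above) auto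
  also have "\<dots> = \<bar>real_of_int m\<bar> * ?p" by (cases "0 \<le> m") auto
  also have "\<dots> \<le> real T * ?p" using tops_bounded(1)[OF sv] by (intro mult_right_mono) auto
  finally have "(\<Sum>k\<in>{0..<m}. exp (?S k - ?S L)) + (\<Sum>k\<in>{m..<0}. exp (?S k - ?S R)) +
      real n * (exp (?S m - ?S L) + exp (?S m - ?S R)) \<le> (real T + 2) * ?p"
    using 1 by (simp add: algebra_simps)
  then show "emeasure (walk_law a 0) (\<Union>k\<in>{0..n}. {X. X k \<notin> {L..R}}) \<le>
      ennreal ((real T + 2) * ?p)"
    using walk_exit_bound[OF a Lt(1), where R=R and n=n] Rt(1) by (meson ennreal_leI less_imp_le order_trans)
qed

section \<open>Probability of a good potential and the constant 83\<close>

context random_environment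
begin

lemma good_event:
  fixes n :: nat and \<gamma> :: real
  defines "L \<equiv> ln (real n)"
  defines "l \<equiv> ln L"
  defines "\<rho> \<equiv> ln l"
  defines "v \<equiv> (sigma Q \<alpha>)\<^sup>2" and "q \<equiv> fourth_moment" and "g \<equiv> gamma_n \<gamma> n"
  defines "T \<equiv> nat \<lfloor>L\<^sup>2 * l / v\<rfloor>"
  assumes \<gamma>: "0 < \<gamma>" and n: "1 < real n" and \<rho>: "1 \<le> \<rho>" "400 * \<rho> \<le> l"
    and N_large: "q / v\<^sup>2 + 1 \<le> (L\<^sup>2 * l / v - 1) / (9 * \<rho>) - 1"
    and w_large: "L\<^sup>2 * l / (100 * \<rho>) \<le> v * ((L\<^sup>2 * l / v - 1) / (9 * \<rho>) - 1) / 8"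
    and K_large: "l * q / v \<le> L\<^sup>2" "q * l ^ 5 / v \<le> L\<^sup>2"
    and g_small: "2 * \<gamma> * l\<^sup>2 \<le> L" and tie_small: "36864 \<le> \<rho> * l"
  obtains G where "G \<in> events" "1 - 83 * sqrt (\<rho> / l) \<le> prob G"
    "\<And>\<omega>. \<omega> \<in> G \<Longrightarrow> good_potential (Sn (\<alpha> \<omega>) n) g (1 / l) T"
proof -
  have L: "0 < L" using n by (simp add: L_def)
  have l: "400 \<le> l" using \<rho> by linarith
  have l_exp: "l = exp \<rho>" using l by (simp add: \<rho>_def)
  have g_eq: "g = \<gamma> * l / L" by (simp add: g_def gamma_n_def l_def L_def)
  have g0: "0 < g" using \<gamma> l L by (simp add: g_eq)
  have g2: "2 * g \<le> 1 / l"
    using g_small L l by (simp add: g_eq field_simps power2_eq_square)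
  have l1: "1 / l \<le> 1 / 2" using l by (simp add: field_simps)
  define x where "x = (1 + 2 * g) * L"
  have x: "0 < x" "x \<le> 2 * L"
    using g0 g2 l1 L by (auto simp: x_def intro!: mult_right_mono)
  define r where "r = (\<lambda>\<omega> k. S_int (\<alpha> \<omega>) (int k))"
  define s where "s = (\<lambda>\<omega> k. S_int (\<alpha> \<omega>) (- int k))"
  interpret right: walk_steps Q "\<lambda>i \<omega>. 1 * eps (\<alpha> \<omega>) (int i + 1)" v q
    unfolding v_def q_def by (rule walk_steps_side) (auto simp: inj_def)
  interpret left: walk_steps Q "\<lambda>i \<omega>. (- 1) * eps (\<alpha> \<omega>) (- int i)" v q
    unfolding v_def q_def by (rule walk_steps_side) (auto simp: inj_def)
  have rW: "r \<omega> k = (\<Sum>i<k. 1 * eps (\<alpha> \<omega>) (int i + 1))" for \<omega> k by (simp add: r_def S_int_right)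
  have sW: "s \<omega> k = (\<Sum>i<k. (- 1) * eps (\<alpha> \<omega>) (- int i))" for \<omega> k by (simp add: s_def S_int_left)
  have [measurable]: "(\<lambda>\<omega>. r \<omega> k) \<in> borel_measurable Q" "(\<lambda>\<omega>. s \<omega> k) \<in> borel_measurable Q" for k
    unfolding rW sW by measurable
  define P where "P f j \<longleftrightarrow> plunges f T (real j * (1 / l) * L) (2 * (1 / l) * L) ((1 - 1 / l) * L)" for f and j :: nat
  define NR where "NR = {\<omega> \<in> space Q. \<forall>k\<le>T. r \<omega> k < x}"
  define NL where "NL = {\<omega> \<in> space Q. \<forall>k\<le>T. s \<omega> k < x}"
  define TI where "TI j = {\<omega> \<in> space Q. P (r \<omega>) j \<and> P (s \<omega>) j}" for j
  \<comment> \<open>A tie can occur only at levels \<open>j / l \<le> 1 + g \<le> 2\<close>, hence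
    \<open>j \<le> 2 * l\<close>. The union of these events has probability at most
    \<open>3 * l * (64 / l^2) = 192 / l\<close>.\<close>
  define m where "m = nat \<lfloor>2 * l\<rfloor>"
  define B where "B = NR \<union> NL \<union> (\<Union>j\<in>{..m}. TI j)"
  have [measurable]: "NR \<in> events" "NL \<in> events" unfolding NR_def NL_def by measurable
  have TI [measurable]: "TI j \<in> events" for j unfolding TI_def P_def plunges_def by measurable
  have NR: "prob NR \<le> 41 * sqrt (\<rho> / l)"
    unfolding NR_def rW T_def
    using L \<rho> l_exp N_large w_large K_large x by (intro right.prob_not_reach_scaled)
  have NL: "prob NL \<le> 41 * sqrt (\<rho> / l)"
    unfolding NL_def sW T_def
    using L \<rho> l_exp N_large w_large K_large x by (intro left.prob_not_reach_scaled)
  have tie: "prob (TI j) \<le> 64 / l\<^sup>2" for j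
  proof -
    have "prob (TI j) = prob {\<omega> \<in> space Q. P (r \<omega>) j} * prob {\<omega> \<in> space Q. P (s \<omega>) j}"
      unfolding TI_def P_def r_def s_def by (rule prob_plunges_both)
    also have "\<dots> \<le> (8 / l) * (8 / l)"
    proof (intro mult_mono)
      show "prob {\<omega> \<in> space Q. P (r \<omega>) j} \<le> 8 / l"
        unfolding P_def rW T_def using L l K_large by (intro right.prob_plunges_scaled) auto
      show "prob {\<omega> \<in> space Q. P (s \<omega>) j} \<le> 8 / l"
        unfolding P_def sW T_def using L l K_large by (intro left.prob_plunges_scaled) auto
    qed (use l in auto)
    finally show ?thesis by (simp add: power2_eq_square)
  qed
  have "prob (\<Union>j\<in>{..m}. TI j) \<le> (\<Sum>j\<in>{..m}. prob (TI j))"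
    using TI by (intro finite_measure_subadditive_finite) auto
  also have "\<dots> \<le> real (card {..m}) * (64 / l\<^sup>2)"
    using tie by (intro sum_bounded_above)
  also have "\<dots> \<le> (3 * l) * (64 / l\<^sup>2)"
  proof (intro mult_right_mono)
    have "real m \<le> 2 * l" using l unfolding m_def by simp
    then show "real (card {..m}) \<le> 3 * l" using l by simp
  qed simp
  also have "\<dots> = 192 / l" using l by (simp add: power2_eq_square)
  also have "\<dots> \<le> sqrt (\<rho> / l)"
  proof (rule real_le_rsqrt)
    have "(192 / l)\<^sup>2 = 36864 / l\<^sup>2" by (simp add: power_divide)
    also have "\<dots> \<le> \<rho> * l / l\<^sup>2" using tie_small by (intro divide_right_mono) auto
    also have "\<dots> = \<rho> / l" using l by (simp add: power2_eq_square)
    finally show "(192 / l)\<^sup>2 \<le> \<rho> / l" .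
  qed
  finally have TIE: "prob (\<Union>j\<in>{..m}. TI j) \<le> sqrt (\<rho> / l)" .
  have UT: "(\<Union>j\<in>{..m}. TI j) \<in> events" by measurable
  have Bev: "B \<in> events" unfolding B_def using UT by measurable
  have "prob B \<le> prob NR + prob NL + prob (\<Union>j\<in>{..m}. TI j)"
    unfolding B_def using UT measure_Un_le[of "NR \<union> NL" Q "\<Union>j\<in>{..m}. TI j"] measure_Un_le[of NR Q NL]
    by auto
  then have PB: "prob B \<le> 83 * sqrt (\<rho> / l)" using NR NL TIE by simp
  show ?thesis
  proof (rule that[of "space Q - B"])
    show "space Q - B \<in> events" using Bev by auto
    show "1 - 83 * sqrt (\<rho> / l) \<le> prob (space Q - B)" using PB Bev by (simp add: prob_compl)
    fix \<omega> assume \<omega>: "\<omega> \<in> space Q - B"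
    let ?V = "Sn (\<alpha> \<omega>) n"
    have Vr: "?V (real k) = r \<omega> k / L" and Vs: "?V (- real k) = s \<omega> k / L" for k
      by (simp_all add: Sn_right Sn_left r_def s_def L_def)
    interpret polygon ?V by (rule polygon_Sn)
    show "good_potential ?V g (1 / l) T"
    proof
      show "?V 0 = 0" using Vr[of 0] by (simp add: r_def S_int_def)
      show "0 < g" "g \<le> 1 / l" using g0 g2 by auto
      show "\<exists>k\<le>T. 1 + 2 * g \<le> ?V (real k)"
        using \<omega> L unfolding B_def NR_def Vr x_def by (auto simp: not_less pos_le_divide_eq)
      show "\<exists>k\<le>T. 1 + 2 * g \<le> ?V (- real k)"
        using \<omega> L unfolding B_def NL_def Vs x_def by (auto simp: not_less pos_le_divide_eq)
      fix j :: nat assume "real j * (1 / l) \<le> 1 + g"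
      also have "1 + g \<le> 2" using g0 g2 l1 by linarith
      finally have "real j \<le> 2 * l" using l by (simp add: field_simps)
      then have "j \<le> m" unfolding m_def by linarith
      then have "\<not> (P (r \<omega>) j \<and> P (s \<omega>) j)" using \<omega> unfolding B_def TI_def by blast
      then show "\<not> (plunges (\<lambda>k. ?V (real k)) T (real j * (1 / l)) (2 * (1 / l)) (1 - 1 / l) \<and>
          plunges (\<lambda>k. ?V (- real k)) T (real j * (1 / l)) (2 * (1 / l)) (1 - 1 / l))"
        unfolding Vr Vs plunges_divide[OF L] P_def .
    qed
  qed
qed

lemma confinement_83: "confinement 83 Q \<alpha>"
  unfolding confinement_iff_confining
proof (intro allI impI)
  fix \<gamma> :: real assume \<gamma>: "2 < \<gamma>"
  define v where "v = (sigma Q \<alpha>)\<^sup>2"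
  have v: "0 < v" using sigma_pos by (simp add: v_def)
  have q: "0 \<le> fourth_moment" unfolding fourth_moment_def by (auto intro!: integral_nonneg_AE)
  have \<gamma>0: "0 < \<gamma>" using \<gamma> by simp
  have "\<forall>\<^sub>F n in sequentially. \<exists>G\<in>sets Q. confining 83 Q \<alpha> \<gamma> n G"
    using eventually_scales[OF \<gamma>0 v q]
  proof eventually_elim
    case (elim n)
    define L where "L = ln (real n)"
    define l where "l = ln L"
    define A where "A = L\<^sup>2 * l / v"
    define T where "T = nat \<lfloor>A\<rfloor>"
    let ?b = "2 * ln (ln (real n)) / ((sigma Q \<alpha>)\<^sup>2 * ln (real n) powr (\<gamma> - 2))"
    obtain G where G: "G \<in> events" "1 - 83 * sqrt (ln (ln (ln (real n))) / ln (ln (real n))) \<le> prob G"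
      "\<And>\<omega>. \<omega> \<in> G \<Longrightarrow> good_potential (Sn (\<alpha> \<omega>) n) (gamma_n \<gamma> n) (1 / l) T"
      by (rule good_event[of \<gamma> n]) (use elim \<gamma>0 in \<open>simp_all add: v_def A_def T_def l_def L_def\<close>)
    have l: "400 \<le> l" using elim(2,3) by (simp add: l_def L_def)
    have L: "1 < L"
    proof (rule ccontr)
      assume "\<not> 1 < L"
      moreover have "0 < L" using elim(1) by (simp add: L_def)
      ultimately show False using l ln_le_zero_iff[of L] unfolding l_def by linarith
    qed
    have A2: "2 \<le> A" using elim(10) v by (simp add: A_def l_def L_def pos_le_divide_eq)
    then have TA: "real T \<le> A" unfolding T_def by simp
    \<comment> \<open>Absorbing the 2 into \<open>A\<close> produces the factor 2 of the final
      bound; the rest is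
      \<open>A * L powr - \<gamma> = l / (v * L powr (\<gamma> - 2))\<close>.\<close>
    have "(real T + 2) * L powr - \<gamma> \<le> (2 * A) * L powr - \<gamma>"
      using TA A2 by (intro mult_right_mono) auto
    also have "\<dots> = 2 * l / v * (L\<^sup>2 * L powr - \<gamma>)" by (simp add: A_def)
    also have "L\<^sup>2 * L powr - \<gamma> = L powr (2 - \<gamma>)"
      using L by (simp add: powr_diff powr_minus field_simps powr_numeral)
    also have "\<dots> = 1 / L powr (\<gamma> - 2)" by (simp flip: powr_minus_divide)
    finally have bound: "(real T + 2) * ln (real n) powr - \<gamma> \<le> ?b"
      by (simp add: L_def l_def v_def)
    have AT: "{- (ln (real n) / sigma Q \<alpha>)\<^sup>2 * ln (ln (real n)) .. (ln (real n) / sigma Q \<alpha>)\<^sup>2 * ln (ln (real n))}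
        = {- A..A}"
      by (simp add: A_def l_def L_def v_def power_divide)
    have valley: "- int T \<le> L'" "R' \<le> int T"
      "emeasure (walk_law (\<alpha> \<omega>) 0) (\<Union>k\<in>{0..n}. {X. X k \<notin> {L'..R'}}) \<le> ennreal ?b"
      if "\<omega> \<in> G" "basic_valley (\<alpha> \<omega>) n \<gamma> L' m R'" for \<omega> L' m R'
    proof -
      have a: "\<alpha> \<omega> i \<in> {0<..<1}" for i
        using range sets.sets_into_space[OF G(1)] that(1) by blast
      note * = basic_valley_confines[OF G(3)[OF that(1)] that(2) a L[unfolded L_def]]
      show "- int T \<le> L'" "R' \<le> int T" by (fact *)+
      show "emeasure (walk_law (\<alpha> \<omega>) 0) (\<Union>k\<in>{0..n}. {X. X k \<notin> {L'..R'}}) \<le> ennreal ?b"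
        using *(3) ennreal_leI[OF bound] by (rule order_trans)
    qed
    have ex: "\<exists>L m R. basic_valley (\<alpha> \<omega>) n \<gamma> L m R" if "\<omega> \<in> G" for \<omega>
      using basic_valley_exists[OF G(3)[OF that]] .
    \<comment> \<open>Every basic valley on the good event lies in \<open>{- T..T}\<close>, and
      \<open>A\<close> is exactly the half-width of the box, so leaving the box implies leaving the
      valley.\<close>
    have box: "emeasure (walk_law (\<alpha> \<omega>) 0) (\<Union>k\<in>{0..n}. {X. real_of_int (X k) \<notin> {- A..A}}) \<le> ennreal ?b"
      if \<omega>: "\<omega> \<in> G" for \<omega>
    proof -
      obtain L' m R' where bv: "basic_valley (\<alpha> \<omega>) n \<gamma> L' m R'" using ex[OF \<omega>] by blast
      note V = valley[OF \<omega> bv]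
      have "(\<Union>k\<in>{0..n}. {X. real_of_int (X k) \<notin> {- A..A}}) \<subseteq> (\<Union>k\<in>{0..n}. {X. X k \<notin> {L'..R'}})"
      proof (intro UN_mono Collect_mono impI order_refl)
        fix k and X :: "nat \<Rightarrow> int" assume "real_of_int (X k) \<notin> {- A..A}"
        moreover have "- A \<le> real_of_int (X k) \<and> real_of_int (X k) \<le> A" if "X k \<in> {L'..R'}"
        proof -
          have "- int T \<le> X k" "X k \<le> int T" using that V(1,2) by simp_all
          then have "- real T \<le> real_of_int (X k)" "real_of_int (X k) \<le> real T" by linarith+
          then show ?thesis using TA by linarith
        qed
        ultimately show "X k \<notin> {L'..R'}" by auto
      qed
      from order_trans[OF emeasure_mono[OF this sets_exit] V(3)] show ?thesis .
    qed
    show ?case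
      unfolding confining_def
    proof (intro bexI[OF _ G(1)] conjI ballI)
      show "\<exists>L m R. basic_valley (\<alpha> \<omega>) n \<gamma> L m R" if "\<omega> \<in> G" for \<omega> using ex[OF that] .
      show "1 - 83 * sqrt (ln (ln (ln (real n))) / ln (ln (real n))) \<le> prob G" by fact
    next
      show "(SUP (\<omega>, L, m, R) \<in> {(\<omega>, L, m, R). \<omega> \<in> G \<and> basic_valley (\<alpha> \<omega>) n \<gamma> L m R}.
           emeasure (walk_law (\<alpha> \<omega>) 0) (\<Union>k\<in>{0..n}. {X. X k \<notin> {L..R}})) \<le> ennreal ?b"
      proof (rule SUP_least)
        fix z assume "z \<in> {(\<omega>, L, m, R). \<omega> \<in> G \<and> basic_valley (\<alpha> \<omega>) n \<gamma> L m R}"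
        then obtain \<omega> L m R where "z = (\<omega>, L, m, R)" "\<omega> \<in> G" "basic_valley (\<alpha> \<omega>) n \<gamma> L m R" by blast
        then show "(case z of (\<omega>, L, m, R) \<Rightarrow>
            emeasure (walk_law (\<alpha> \<omega>) 0) (\<Union>k\<in>{0..n}. {X. X k \<notin> {L..R}})) \<le> ennreal ?b"
          by (simp only: prod.case valley(3))
      qed
    next
      show "(SUP \<omega>\<in>G. emeasure (walk_law (\<alpha> \<omega>) 0)
             (\<Union>k\<in>{0..n}. {X. real_of_int (X k) \<notin>
                {- (ln (real n) / sigma Q \<alpha>)\<^sup>2 * ln (ln (real n)) ..
                   (ln (real n) / sigma Q \<alpha>)\<^sup>2 * ln (ln (real n))}})) \<le> ennreal ?b"
        unfolding AT by (intro SUP_least box)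
    qed
  qed
  then show "\<exists>n\<^sub>0. \<forall>n>n\<^sub>0. \<exists>G\<in>sets Q. confining 83 Q \<alpha> \<gamma> n G"
    unfolding eventually_sequentially by (meson less_imp_le)
qed

end

section \<open>Transfer to canonical environments\<close>

text \<open>Independence says that the law of the whole family is the product of its marginals,
  which is a property of the image measure. The factors are restricted to the open unit interval
  because \<open>range\<close> is required at every point of the sample space.\<close>

lemma random_environment_canonical:
  fixes Q :: "'a measure"
  assumes "random_environment Q \<alpha>"
  defines "C \<equiv> PiM UNIV (\<lambda>_::int. restrict_space (borel :: real measure) {0<..<1})"
  shows "\<alpha> \<in> Q \<rightarrow>\<^sub>M C" "random_environment (distr Q C \<alpha>) (\<lambda>x. x)"
    "sigma (distr Q C \<alpha>) (\<lambda>x. x) = sigma Q \<alpha>"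
proof -
  interpret random_environment Q \<alpha> by fact
  have rv [measurable]: "(\<lambda>\<omega>. \<alpha> \<omega> i) \<in> borel_measurable Q" for i
    using indep unfolding indep_vars_def by auto
  show m [measurable]: "\<alpha> \<in> Q \<rightarrow>\<^sub>M C"
    unfolding C_def by (rule measurable_PiM_single')
      (use range in \<open>auto intro!: measurable_restrict_space2 simp: space_restrict_space PiE_iff\<close>)
  let ?Q = "distr Q C \<alpha>"
  have coord [measurable]: "(\<lambda>x. x i) \<in> borel_measurable C" for i
  proof -
    have "(\<lambda>x. x i) \<in> C \<rightarrow>\<^sub>M restrict_space borel {0<..<1}"
      unfolding C_def by (rule measurable_component_singleton) simp
    then show ?thesis by (rule measurable_restrict_space2_iff[THEN iffD1, THEN conjunct1])
  qed
  have eps [measurable]: "(\<lambda>x. eps x i) \<in> borel_measurable C" for i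
    unfolding eps_def by measurable
  interpret Q': prob_space ?Q using m by (rule prob_space_distr)
  have d: "distr ?Q borel (\<lambda>x. x i) = distr Q borel (\<lambda>\<omega>. \<alpha> \<omega> i)" for i
    using distr_distr[OF coord m, of i] by (simp add: comp_def)
  have "(\<lambda>x. x) \<in> C \<rightarrow>\<^sub>M PiM UNIV (\<lambda>_. borel)"
    by (rule measurable_PiM_single') auto
  then have "distr ?Q (PiM UNIV (\<lambda>_. borel)) (\<lambda>x. x) = distr Q (PiM UNIV (\<lambda>_. borel)) \<alpha>"
    using distr_distr[OF _ m] by (simp add: comp_def)
  also have "\<dots> = PiM UNIV (\<lambda>i. distr ?Q borel (\<lambda>x. x i))"
    using indep indep_vars_iff_distr_eq_PiM'[of UNIV "\<lambda>i \<omega>. \<alpha> \<omega> i" "\<lambda>_. borel"]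
    by (simp add: d restrict_def)
  finally have ind: "Q'.indep_vars (\<lambda>_. borel) (\<lambda>i x. x i) UNIV"
    by (subst Q'.indep_vars_iff_distr_eq_PiM') (auto simp: restrict_def)
  show "random_environment ?Q (\<lambda>x. x)"
  proof
    show "Q'.indep_vars (\<lambda>_. borel) (\<lambda>i x. x i) UNIV" by (rule ind)
    show "distr ?Q borel (\<lambda>x. x i) = distr ?Q borel (\<lambda>x. x 0)" for i
      unfolding d by (rule identically_distributed)
    show "x i \<in> {0<..<1}" if "x \<in> space ?Q" for x i
      using that by (auto simp: C_def space_PiM space_restrict_space PiE_iff)
    show "integral\<^sup>L ?Q (\<lambda>x. eps x 0) = 0"
      using centred by (subst integral_distr) auto
    show "0 < integral\<^sup>L ?Q (\<lambda>x. (eps x 0)\<^sup>2)"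
      using variance_pos by (subst integral_distr) auto
    show "\<exists>\<kappa>\<^sub>0>0. \<forall>\<kappa>\<in>{0<..<\<kappa>\<^sub>0}. integrable ?Q (\<lambda>x. exp (\<kappa> * eps x 0)) \<and>
        integrable ?Q (\<lambda>x. exp (- \<kappa> * eps x 0))"
      using exp_moments by (subst (1 2) integrable_distr_eq) auto
  qed
  show "sigma ?Q (\<lambda>x. x) = sigma Q \<alpha>"
    unfolding sigma_def by (subst integral_distr) auto
qed

text \<open>Valleys and walk laws depend on the sample point only through its environment. The
  preimage of \<open>G\<close> therefore has the same probability, and its suprema run over a subset
  of the environments in \<open>G\<close>.\<close>

lemma confining_vimage:
  assumes \<alpha>: "\<alpha> \<in> Q \<rightarrow>\<^sub>M C" and \<sigma>: "sigma (distr Q C \<alpha>) (\<lambda>x. x) = sigma Q \<alpha>"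
    and G: "G \<in> sets C" "confining h (distr Q C \<alpha>) (\<lambda>x. x) \<gamma> n G"
  shows "confining h Q \<alpha> \<gamma> n (\<alpha> -` G \<inter> space Q)"
  unfolding confining_def
proof (intro conjI ballI)
  note conf = G(2)[unfolded confining_def \<sigma>]
  let ?G = "\<alpha> -` G \<inter> space Q"
  show "\<exists>L m R. basic_valley (\<alpha> \<omega>) n \<gamma> L m R" if "\<omega> \<in> ?G" for \<omega> using conf that by blast
  show "1 - h * sqrt (ln (ln (ln (real n))) / ln (ln (real n))) \<le> measure Q ?G"
    using conf measure_distr[OF \<alpha> G(1)] by simp
  show "(SUP (\<omega>, L, m, R) \<in> {(\<omega>, L, m, R). \<omega> \<in> ?G \<and> basic_valley (\<alpha> \<omega>) n \<gamma> L m R}.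
       emeasure (walk_law (\<alpha> \<omega>) 0) (\<Union>k\<in>{0..n}. {X. X k \<notin> {L..R}}))
     \<le> ennreal (2 * ln (ln (real n)) / ((sigma Q \<alpha>)\<^sup>2 * ln (real n) powr (\<gamma> - 2)))"
    by (rule order_trans[OF SUP_mono conf[THEN conjunct2, THEN conjunct2, THEN conjunct1]]) force
  show "(SUP \<omega>\<in>?G. emeasure (walk_law (\<alpha> \<omega>) 0)
         (\<Union>k\<in>{0..n}. {X. real_of_int (X k) \<notin>
            {- (ln (real n) / sigma Q \<alpha>)\<^sup>2 * ln (ln (real n)) ..
               (ln (real n) / sigma Q \<alpha>)\<^sup>2 * ln (ln (real n))}}))
     \<le> ennreal (2 * ln (ln (real n)) / ((sigma Q \<alpha>)\<^sup>2 * ln (real n) powr (\<gamma> - 2)))"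
    by (rule order_trans[OF SUP_mono conf[THEN conjunct2, THEN conjunct2, THEN conjunct2]]) blast
qed

lemma confinement_of_canonical:
  assumes env: "random_environment Q \<alpha>"
    and canonical: "\<And>(Q' :: (int \<Rightarrow> real) measure) \<alpha>'. random_environment Q' \<alpha>' \<Longrightarrow> confinement h Q' \<alpha>'"
  shows "confinement h Q \<alpha>"
  unfolding confinement_iff_confining
proof (intro allI impI)
  fix \<gamma> :: real assume "2 < \<gamma>"
  define C where "C = PiM UNIV (\<lambda>_::int. restrict_space (borel :: real measure) {0<..<1})"
  note * = random_environment_canonical[OF env, folded C_def]
  obtain n0 where n0: "\<And>n. n0 < n \<Longrightarrow> \<exists>G\<in>sets (distr Q C \<alpha>). confining h (distr Q C \<alpha>) (\<lambda>x. x) \<gamma> n G"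
    using canonical[OF *(2)] \<open>2 < \<gamma>\<close> unfolding confinement_iff_confining by blast
  show "\<exists>n\<^sub>0. \<forall>n>n\<^sub>0. \<exists>G\<in>sets Q. confining h Q \<alpha> \<gamma> n G"
  proof (intro exI[of _ n0] allI impI)
    fix n assume "n0 < n"
    from n0[OF this] obtain G where "G \<in> sets C" "confining h (distr Q C \<alpha>) (\<lambda>x. x) \<gamma> n G"
      unfolding sets_distr by blast
    then show "\<exists>G\<in>sets Q. confining h Q \<alpha> \<gamma> n G"
      using confining_vimage[OF *(1,3)] measurable_sets[OF *(1)] by blast
  qed
qed

theorem proposition2p8:
  shows "(\<exists>h>0. \<forall>(Q :: (int \<Rightarrow> real) measure) \<alpha>.
            random_environment Q \<alpha> \<longrightarrow> confinement h Q \<alpha>) \<and>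
         (\<forall>h>0. (\<forall>(Q :: (int \<Rightarrow> real) measure) \<alpha>.
              random_environment Q \<alpha> \<longrightarrow> confinement h Q \<alpha>) \<longrightarrow>
            (\<forall>(Q :: 'a measure) \<alpha>. random_environment Q \<alpha> \<longrightarrow> confinement h Q \<alpha>))"
proof (intro conjI allI impI)
  show "\<exists>h>0. \<forall>(Q :: (int \<Rightarrow> real) measure) \<alpha>. random_environment Q \<alpha> \<longrightarrow> confinement h Q \<alpha>"
    by (intro exI[of _ 83]) (simp add: random_environment.confinement_83)
next
  \<comment> \<open>Here \<open>h\<close> is arbitrary and may be smaller than 83, so the claim has
    to come from the assumption, applied to the law of the environment.\<close>
  fix h :: real and Q :: "'a measure" and \<alpha>
  assume canonical: "\<forall>(Q :: (int \<Rightarrow> real) measure) \<alpha>. random_environment Q \<alpha> \<longrightarrow> confinement h Q \<alpha>"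
    and "random_environment Q \<alpha>"
  from this(2) show "confinement h Q \<alpha>"
    by (rule confinement_of_canonical) (rule canonical[rule_format])
qed

end
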